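(* For every integer $k \geq 3$, there exist constants $K_{\mathrm{e}}$ and $K_{\mathrm{o}}$ (depending only on $k$) such that for every integer $r \geq 2$, there exists a graph $H$ with $\operatorname{girth}(H) = k$ and $H \rightarrow (C_k)_r$, which satisfies $|V(H)| \leq r^{K_{\mathrm{e}}}$ if $k$ is even and $|V(H)| \leq K_{\mathrm{o}}^{r\log r}$ if $k$ is odd.
   Context: All graphs are finite and simple. $C_k$ is the cycle of length $k$. For graphs $H$, $F$ and an integer $r \geq 2$, we write $H \rightarrow (F)_r$ if every colouring of the edges of $H$ with $r$ colours yields a monochromatic (not necessarily induced) copy of $F$. The girth of a graph is the length of its shortest cycle. $\log$ denotes the binary logarithm. *)

theory Defs
  imports Complex_Main "HOL-Library.Extended_Nat"
begin

text \<open>A graph is a pair of a vertex set and a set of edges, an edge being a two-element set of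
  vertices.\<close>

type_synonym 'a graph = "'a set \<times> 'a set set"

abbreviation verts :: "'a graph \<Rightarrow> 'a set" where "verts \<equiv> fst"
abbreviation edges :: "'a graph \<Rightarrow> 'a set set" where "edges \<equiv> snd"

definition finite_simple_graph :: "'a graph \<Rightarrow> bool" where
  "finite_simple_graph G \<longleftrightarrow>
     finite (verts G) \<and> (\<forall>e\<in>edges G. e \<subseteq> verts G \<and> card e = 2)"

text \<open>A genuine cycle only for \<open>k \<ge> 3\<close>: for \<open>k = 2\<close> the two edges coincide, and for \<open>k = 1\<close> the
  edge degenerates to a singleton.\<close>

definition cycle_graph :: "nat \<Rightarrow> nat graph" where
  "cycle_graph k = ({..<k}, {{i, Suc i mod k} | i. i < k})"

text \<open>\<open>f\<close> embeds \<open>F\<close> as a not necessarily induced subgraph of \<open>G\<close>: edges go to edges, but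
  non-edges need not go to non-edges. The copies of \<open>F\<close> in \<open>G\<close> are the images of such \<open>f\<close>.\<close>

definition embeds :: "('b \<Rightarrow> 'a) \<Rightarrow> 'b graph \<Rightarrow> 'a graph \<Rightarrow> bool" where
  "embeds f F G \<longleftrightarrow>
     inj_on f (verts F) \<and> f ` verts F \<subseteq> verts G \<and> (\<forall>e\<in>edges F. f ` e \<in> edges G)"

text \<open>The relation \<open>H \<rightarrow> (F)\<^sub>r\<close>; the colours are the numbers below \<open>r\<close>.\<close>

definition arrows :: "'a graph \<Rightarrow> 'b graph \<Rightarrow> nat \<Rightarrow> bool" where
  "arrows H F r \<longleftrightarrow>
     (\<forall>c :: 'a set \<Rightarrow> nat. (\<forall>e\<in>edges H. c e < r) \<longrightarrow>
        (\<exists>f. \<exists>i<r. embeds f F H \<and> (\<forall>e\<in>edges F. c (f ` e) = i)))"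

text \<open>The infimum over the empty set is \<open>\<infinity>\<close>, the girth of an acyclic graph.\<close>

definition girth :: "'a graph \<Rightarrow> enat" where
  "girth G = (INF l \<in> {l. 3 \<le> l \<and> (\<exists>f. embeds f (cycle_graph l) G)}. enat l)"

lemma finite_simple_graph_cycle_graph:
  assumes "3 \<le> k"
  shows "finite_simple_graph (cycle_graph k)"
proof -
  have "i \<noteq> Suc i mod k" if "i < k" for i
    using assms that by (cases "Suc i = k") auto
  then show ?thesis
    using assms by (auto simp: finite_simple_graph_def cycle_graph_def card_2_iff)
qed

lemma girth_eq_iff:
  "girth G = enat k \<longleftrightarrow>
     3 \<le> k \<and> (\<exists>f. embeds f (cycle_graph k) G) \<and>
     (\<forall>l. 3 \<le> l \<and> l < k \<longrightarrow> \<not> (\<exists>f. embeds f (cycle_graph l) G))"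
    (is "?L \<longleftrightarrow> ?R")
proof
  let ?S = "{l. 3 \<le> l \<and> (\<exists>f. embeds f (cycle_graph l) G)}"
  assume L: ?L
  then have "enat ` ?S \<noteq> {}"
    unfolding girth_def by (metis Inf_enat_def enat.distinct(1) infinity_enat_def)
  then have "girth G \<in> enat ` ?S"
    unfolding girth_def Inf_enat_def by (metis (mono_tags, lifting) LeastI ex_in_conv)
  moreover have "girth G \<le> enat l" if "l \<in> ?S" for l
    unfolding girth_def using that by (intro INF_lower)
  ultimately show ?R
    using L by (auto simp: not_less) (meson leD)
next
  assume ?R
  then show ?L
    unfolding girth_def
    by (intro antisym INF_lower INF_greatest) (auto simp: not_less[symmetric])
qed

end

theory Submission
  imports Defs "HOL-Analysis.Convex"
begin

text \<open>Write \<open>k = m + 2\<close>. The host graph is a random graph on \<open>n\<close> vertices of average degree about \<open>D\<close>,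
  with the few edges on cycles shorter than \<open>k\<close> deleted, where \<open>n\<close> lies polynomially between \<open>D ^ m\<close>
  and \<open>D ^ (m + 1)\<close>. Let \<open>C\<close> be a colour class without \<open>C\<^sub>k\<close> and \<open>F\<close> a sparse part of it. Two
  \<open>C - F\<close>-neighbours of a vertex are never joined by a walk of length \<open>m\<close> in \<open>F\<close>, because such a walk
  would close to a cycle of length at most \<open>k\<close>. By the Kleitman--Winston algorithm every neighbourhood
  in \<open>C - F\<close> is then, up to a short fingerprint, inside a container spanning few pairs joined
  by such walks. A bound on the number of closed walks of length \<open>2 * m\<close> turns this into a
  bound on the number of walks. As there are few choices of \<open>F\<close> and of the fingerprints, a union
  bound shows that the host graph meets every set of pairs described by containers in about the
  expected number of edges.

  If \<open>m\<close> is even, walks from a set \<open>X\<close> to itself are counted from below by Cauchy--Schwarz, so the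
  containers of the densest colour class are small and cannot accommodate its edges. In general, a
  container only has to be sparse in its own colour; as the containers of all colours together
  must cover most of the vertices, one of them has at least a \<open>1 / (2 * r)\<close> fraction of the vertices, and
  iterating inside it makes all \<open>r\<close> colours sparse on a set of size \<open>n / (2 * r) ^ r\<close>.\<close>

subsection \<open>Random subsets of a finite set\<close>

text \<open>Parity is the obstacle. If \<open>n \<le> 2 ^ r\<close>, every graph on \<open>n\<close>
  vertices splits into \<open>r\<close> bipartite graphs, so for odd \<open>k\<close> exponentially
  many vertices are unavoidable. Accordingly a container may then be large: no walk of odd length
  \<open>m\<close> joins two vertices on one side of a bipartite colour class. Cauchy--Schwarz over
  midpoints needs even \<open>m\<close>; otherwise the walks are kept inside the container, which
  must then contain edges of \<open>F\<close>, and the conclusion is only that it contains few.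

  The sizes fit as follows. Tree-like closed walks dominate when \<open>D ^ m \<le> n\<close>, so
  the squares of the walk counts sum to at most a constant times \<open>n * D ^ m\<close>. If
  \<open>F\<close> has degrees \<open>D\<close> up to powers of \<open>b\<close>, its walks must
  join about \<open>n * D ^ m\<close> pairs, again up to powers of \<open>b\<close>, whereas a
  container allows only \<open>n * g\<close> pairs, where \<open>g = D ^ m * b ^ 5 / D\<close>.
  Hence \<open>D\<close> is a large power of \<open>b\<close>. A choice of \<open>F\<close> and of
  all fingerprints involves about \<open>n * t\<close> edges per colour, up to a logarithm, while
  the host has about \<open>n * D = n * t * b ^ 2\<close> edges; this surplus pays for the union
  bound.\<close>

definition expect :: "real \<Rightarrow> 'a set \<Rightarrow> ('a set \<Rightarrow> real) \<Rightarrow> real" where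
  "expect p E f = (\<Sum>H\<in>Pow E. p ^ card H * (1 - p) ^ card (E - H) * f H)"

text \<open>The weights are those of a random \<open>H\<close> that contains each element
  independently with probability \<open>p\<close>. Expanding the product over all choices of one
  summand per element gives the identity; the indicators and exponential moments below are
  instances.\<close>

lemma expect_prod:
  assumes "finite E"
  shows "expect p E (\<lambda>H. (\<Prod>e\<in>H. a e) * (\<Prod>e\<in>E - H. b e)) = (\<Prod>e\<in>E. p * a e + (1 - p) * b e)"
  unfolding expect_def prod_add[OF assms] by (simp add: prod.distrib mult_ac)

lemma expect_const:
  assumes "finite E"
  shows "expect p E (\<lambda>_. c) = c"
proof -
  have "expect p E (\<lambda>_. 1) = 1"
    using expect_prod[OF assms, of p "\<lambda>_. 1" "\<lambda>_. 1"] by simp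
  then show ?thesis
    by (simp add: expect_def flip: sum_distrib_right)
qed

lemma expect_add: "expect p E (\<lambda>H. f H + g H) = expect p E f + expect p E g"
  by (simp add: expect_def sum.distrib algebra_simps)

lemma expect_cmult: "expect p E (\<lambda>H. c * f H) = c * expect p E f"
  by (simp add: expect_def sum_distrib_left algebra_simps)

lemma expect_sum: "expect p E (\<lambda>H. \<Sum>i\<in>I. f i H) = (\<Sum>i\<in>I. expect p E (f i))"
  unfolding expect_def by (simp add: sum_distrib_left) (rule sum.swap)

lemma expect_cong: "(\<And>H. H \<subseteq> E \<Longrightarrow> f H = g H) \<Longrightarrow> expect p E f = expect p E g"
  by (simp add: expect_def)

lemma expect_subset:
  assumes "finite E" "F \<subseteq> E"
  shows "expect p E (\<lambda>H. of_bool (F \<subseteq> H)) = p ^ card F"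
proof -
  \<comment> \<open>The indicator is a product over the absent elements, each of which must lie
    outside \<open>F\<close>.\<close>
  have "expect p E (\<lambda>H. of_bool (F \<subseteq> H))
      = expect p E (\<lambda>H. (\<Prod>e\<in>H. 1) * (\<Prod>e\<in>E - H. of_bool (e \<notin> F)))"
  proof (rule expect_cong)
    fix H assume "H \<subseteq> E"
    then have "finite (E - H)" using assms by auto
    then have "(\<Prod>e\<in>E - H. of_bool (e \<notin> F)) = (of_bool (F \<subseteq> H) :: real)"
      using assms(2) by (cases "F \<subseteq> H") (auto intro!: prod.neutral)
    then show "of_bool (F \<subseteq> H) = (\<Prod>e\<in>H. 1) * (\<Prod>e\<in>E - H. of_bool (e \<notin> F) :: real)"
      by simp
  qed
  also have "\<dots> = (\<Prod>e\<in>E. if e \<in> F then p else 1)"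
    unfolding expect_prod[OF assms(1)] by (auto intro!: prod.cong)
  also have "\<dots> = p ^ card F"
    using assms by (simp add: prod.If_cases Int_absorb1 flip: Collect_mem_eq)
  finally show ?thesis .
qed

lemma expect_power:
  assumes "finite E" "P \<subseteq> E"
  shows "expect p E (\<lambda>H. c ^ card (H \<inter> P)) = (1 + (c - 1) * p) ^ card P"
proof -
  have "expect p E (\<lambda>H. c ^ card (H \<inter> P))
      = expect p E (\<lambda>H. (\<Prod>e\<in>H. if e \<in> P then c else 1) * (\<Prod>e\<in>E - H. 1))"
  proof (rule expect_cong)
    fix H assume "H \<subseteq> E"
    then have "finite H" using assms finite_subset by blast
    then show "c ^ card (H \<inter> P) = (\<Prod>e\<in>H. if e \<in> P then c else 1) * (\<Prod>e\<in>E - H. 1)"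
      by (simp add: prod.If_cases)
  qed
  also have "\<dots> = (\<Prod>e\<in>E. if e \<in> P then 1 + (c - 1) * p else 1)"
    unfolding expect_prod[OF assms(1)] by (auto intro!: prod.cong simp: algebra_simps)
  also have "\<dots> = (1 + (c - 1) * p) ^ card P"
    using assms by (simp add: prod.If_cases Int_absorb1)
  finally show ?thesis .
qed

lemma expect_mono:
  assumes "0 \<le> p" "p \<le> 1" "\<And>H. H \<subseteq> E \<Longrightarrow> f H \<le> g H"
  shows "expect p E f \<le> expect p E g"
  unfolding expect_def using assms by (intro sum_mono mult_left_mono) auto

lemma expect_less_imp_ex:
  assumes "finite E" "0 \<le> p" "p \<le> 1" "expect p E f < c"
  obtains H where "H \<subseteq> E" "f H < c"
  using expect_mono[OF assms(2,3), of E "\<lambda>_. c" f] expect_const[OF assms(1), of p c] assms(4)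
  by (metis leD leI)

text \<open>Chernoff's method with base \<open>1/2\<close>, by
  \<open>1 - p / 2 \<le> exp (- p / 2)\<close>. The moment is kept instead of a probability, so that
  many such terms can be added up and averaged at once.\<close>

lemma expect_lower_tail:
  fixes p :: real
  assumes "finite E" "P \<subseteq> E" "0 \<le> p" "p \<le> 1"
  shows "expect p E (\<lambda>H. (1/2) ^ card (H \<inter> P)) \<le> exp (- (p * card P / 2))"
proof -
  have "(1 + (1/2 - 1) * p) ^ card P \<le> exp (- p / 2) ^ card P"
    using exp_ge_add_one_self[of "- p / 2"] assms by (intro power_mono) (auto simp: algebra_simps)
  also have "\<dots> = exp (- (p * card P / 2))"
    by (simp flip: exp_of_nat_mult add: mult_ac)
  finally show ?thesis using expect_power[OF assms(1,2), of p "1/2"] by simp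
qed

text \<open>The counterpart with base \<open>exp 1\<close>; the factor 2 bounds
  \<open>exp 1 - 1\<close>.\<close>

lemma expect_upper_tail:
  fixes p :: real
  assumes "finite E" "P \<subseteq> E" "0 \<le> p" "p \<le> 1"
  shows "expect p E (\<lambda>H. exp (card (H \<inter> P))) \<le> exp (2 * p * card P)"
proof -
  have "(1 + (exp 1 - 1) * p) ^ card P \<le> exp (2 * p) ^ card P"
  proof (intro power_mono)
    have "1 + (exp 1 - 1) * p \<le> 1 + 2 * p"
      using exp_le assms by (intro add_left_mono mult_right_mono) auto
    also have "\<dots> \<le> exp (2 * p)" by (rule exp_ge_add_one_self)
    finally show "1 + (exp 1 - 1) * p \<le> exp (2 * p)" .
    show "0 \<le> 1 + (exp 1 - 1) * p" using assms by simp
  qed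
  also have "\<dots> = exp (2 * p * card P)"
    by (simp flip: exp_of_nat_mult add: mult_ac)
  finally show ?thesis
    using expect_power[OF assms(1,2), of p "exp 1"] by (simp flip: exp_of_nat_mult)
qed

text \<open>A random subset of density \<open>p\<close> is penalised in \<open>f\<close> for meeting
  a member of the family too rarely and for being large. Either failure alone makes \<open>f\<close>
  at least 1, while the mean is at most \<open>1/2 + 1/4\<close>.\<close>

lemma sparse_sample:
  fixes \<F> :: "'a set set" and p s M :: real
  assumes "finite E" "finite \<F>" "\<And>F. F \<in> \<F> \<Longrightarrow> F \<subseteq> E \<and> s \<le> real (card F)" "0 < p" "p \<le> 1"
    and "real (card E) \<le> M" "0 < M" "card \<F> * exp (- (p * s / 4)) \<le> 1/2"
  obtains S where "S \<subseteq> E" "card S < 4 * p * M" "\<And>F. F \<in> \<F> \<Longrightarrow> p * s / 4 < card (S \<inter> F)"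
proof -
  define f :: "'a set \<Rightarrow> real" where "f = (\<lambda>H. (\<Sum>F\<in>\<F>. exp (p * s / 4) * (1/2) ^ card (H \<inter> F))
      + 1 / (4 * p * M) * (\<Sum>e\<in>E. of_bool ({e} \<subseteq> H)))"
  have "expect p E f = (\<Sum>F\<in>\<F>. exp (p * s / 4) * expect p E (\<lambda>H. (1/2) ^ card (H \<inter> F)))
      + 1 / (4 * p * M) * (\<Sum>e\<in>E. expect p E (\<lambda>H. of_bool ({e} \<subseteq> H)))"
    unfolding f_def expect_add expect_cmult expect_sum by simp
  also have "\<dots> \<le> (\<Sum>F\<in>\<F>. exp (p * s / 4) * exp (- (p * s / 2))) + 1 / (4 * p * M) * (\<Sum>e\<in>E. p)"
  proof (intro add_mono sum_mono mult_left_mono)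
    fix F assume F: "F \<in> \<F>"
    then have "expect p E (\<lambda>H. (1/2) ^ card (H \<inter> F)) \<le> exp (- (p * card F / 2))"
      using assms by (intro expect_lower_tail) auto
    also have "\<dots> \<le> exp (- (p * s / 2))" using assms F by simp
    finally show "expect p E (\<lambda>H. (1/2) ^ card (H \<inter> F)) \<le> exp (- (p * s / 2))" .
  next
    fix e assume "e \<in> E"
    then show "expect p E (\<lambda>H. of_bool ({e} \<subseteq> H)) \<le> p"
      using expect_subset[OF assms(1), of "{e}" p] by simp
  qed (use assms in auto)
  also have "(\<Sum>F\<in>\<F>. exp (p * s / 4) * exp (- (p * s / 2))) = card \<F> * exp (- (p * s / 4))"
    by (simp flip: exp_add)
  also have "1 / (4 * p * M) * (\<Sum>e\<in>E. p) \<le> 1 / 4"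
    using assms by (simp add: divide_simps)
  finally have "expect p E f < 1" using assms by linarith
  then obtain S where S: "S \<subseteq> E" "f S < 1"
    using expect_less_imp_ex assms by (metis less_imp_le)
  have "finite S" using S assms finite_subset by blast
  have cS: "(\<Sum>e\<in>E. of_bool ({e} \<subseteq> S)) = real (card S)"
    using S assms(1) by (simp add: Int_absorb1 Int_commute)
  define A where "A = (\<Sum>F\<in>\<F>. exp (p * s / 4) * (1/2) ^ card (S \<inter> F))"
  have less: "A + real (card S) / (4 * p * M) < 1"
    using S(2) cS by (simp add: f_def A_def)
  have "0 \<le> A" unfolding A_def by (intro sum_nonneg) auto
  show ?thesis
  proof
    have "real (card S) / (4 * p * M) < 1" using less \<open>0 \<le> A\<close> by linarith
    then show "card S < 4 * p * M" using assms by (simp add: divide_simps)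
    show "p * s / 4 < card (S \<inter> F)" if F: "F \<in> \<F>" for F
    proof -
      have "exp (p * s / 4) * (1/2) ^ card (S \<inter> F) \<le> A"
        unfolding A_def using F assms by (intro member_le_sum) auto
      also have "A < 1" using less assms by (smt (verit) divide_nonneg_pos mult_pos_pos of_nat_0_le_iff)
      finally have "exp (p * s / 4) < 2 ^ card (S \<inter> F)" by (simp add: power_one_over divide_simps)
      also have "(2::real) ^ card (S \<inter> F) \<le> exp 1 ^ card (S \<inter> F)"
        using exp_ge_add_one_self[of 1] by (intro power_mono) auto
      finally show ?thesis by (simp flip: exp_of_nat_mult)
    qed
  qed (fact S)
qed

subsection \<open>Closed walks\<close>

text \<open>A list is read as a closed walk whose starting vertex is listed once. The distinct lists
  of length at least 3 are the cycles, each with a starting point and a direction.\<close>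

definition cyc_edge :: "'a list \<Rightarrow> nat \<Rightarrow> 'a set" where
  "cyc_edge xs i = {xs ! i, xs ! (Suc i mod length xs)}"

definition cyc_edges :: "'a list \<Rightarrow> 'a set set" where
  "cyc_edges xs = cyc_edge xs ` {..<length xs}"

definition path_edges :: "'a list \<Rightarrow> 'a set set" where
  "path_edges xs = (\<lambda>i. {xs ! i, xs ! Suc i}) ` {..<length xs - 1}"

lemma path_edges_simps:
  "path_edges [] = {}" "path_edges [x] = {}"
  "path_edges (x # y # zs) = insert {x, y} (path_edges (y # zs))"
  by (auto simp: path_edges_def lessThan_Suc_eq_insert_0 image_image)

lemma finite_path_edges [simp]: "finite (path_edges xs)"
  by (simp add: path_edges_def)

lemma finite_cyc_edges [simp]: "finite (cyc_edges xs)"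
  by (simp add: cyc_edges_def)

lemma path_edges_subset: "e \<in> path_edges xs \<Longrightarrow> e \<subseteq> set xs"
  by (auto simp: path_edges_def)

text \<open>Reading the list from its end, every new vertex brings an edge that contains it and is
  therefore new as well.\<close>

lemma card_set_le_path_edges: "card (set xs) \<le> card (path_edges xs) + 1"
proof (induction xs rule: induct_list012)
  case (3 x y zs)
  show ?case
  proof (cases "x \<in> set (y # zs)")
    case True
    then have "card (set (x # y # zs)) = card (set (y # zs))" by (simp only: list.set insert_absorb)
    also have "\<dots> \<le> card (path_edges (y # zs)) + 1" by (rule 3)
    also have "\<dots> \<le> card (path_edges (x # y # zs)) + 1"
      by (intro add_mono card_mono) (auto simp: path_edges_simps simp del: finite_path_edges intro: finite_path_edges)
    finally show ?thesis .
  next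
    case False
    then have "{x, y} \<notin> path_edges (y # zs)" using path_edges_subset by blast
    then have "card (path_edges (x # y # zs)) = Suc (card (path_edges (y # zs)))"
      by (simp add: path_edges_simps)
    then show ?thesis using 3 False by simp
  qed
qed (auto simp: path_edges_simps)

text \<open>An edge traversed only once can be dropped from a closed walk without losing a vertex.\<close>

lemma card_set_le_cyc_edges:
  assumes "length xs < 2 * card (cyc_edges xs)"
  shows "card (set xs) \<le> card (cyc_edges xs)"
proof -
  define L where "L = length xs"
  let ?f = "cyc_edge xs"
  \<comment> \<open>Otherwise every edge is traversed at least twice, which needs at least
    \<open>2 * card (cyc_edges xs)\<close> steps.\<close>
  have "\<exists>i<L. \<forall>j<L. ?f j = ?f i \<longrightarrow> j = i"
  proof (rule ccontr)
    assume *: "\<not> ?thesis"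
    have "2 \<le> card {j \<in> {..<L}. ?f j = e}" if e: "e \<in> ?f ` {..<L}" for e
    proof -
      obtain i where i: "i < L" "e = ?f i" using e by auto
      with * obtain j where "j < L" "?f j = ?f i" "j \<noteq> i" by auto
      then have "card {i, j} \<le> card {j \<in> {..<L}. ?f j = e}"
        using i by (intro card_mono) auto
      then show ?thesis using \<open>j \<noteq> i\<close> by simp
    qed
    then have "(\<Sum>e\<in>?f ` {..<L}. 2 :: nat) \<le> (\<Sum>e\<in>?f ` {..<L}. \<Sum>j\<in>{j \<in> {..<L}. ?f j = e}. 1)"
      by (intro sum_mono) simp
    also have "\<dots> = L"
      by (subst sum.image_gen[symmetric]) auto
    finally show False using assms by (simp add: cyc_edges_def L_def)
  qed
  then obtain i where i: "i < L" and uniq: "\<And>j. j < L \<Longrightarrow> ?f j = ?f i \<Longrightarrow> j = i" by blast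
  \<comment> \<open>Starting just after the edge traversed once turns the closed walk into an open
    one that avoids this edge and still visits all vertices.\<close>
  define ys where "ys = rotate (Suc i) xs"
  have "path_edges ys \<subseteq> cyc_edges xs - {?f i}"
  proof
    fix e assume "e \<in> path_edges ys"
    then obtain j where "j < L - 1" and j: "e = {ys ! j, ys ! Suc j}"
      by (auto simp: path_edges_def ys_def L_def)
    then have j: "Suc j < L" "e = {ys ! j, ys ! Suc j}" by auto
    define q where "q = (Suc i + j) mod L"
    have q: "q < L" using i by (simp add: q_def)
    have "e = ?f q"
      using j i by (simp add: ys_def nth_rotate cyc_edge_def q_def mod_Suc_eq flip: L_def del: rotate_Suc)
    moreover have "q \<noteq> i"
    proof
      assume "q = i"
      have "Suc i + j < 2 * L" using i j by linarith
      then have "q = (if Suc i + j < L then Suc i + j else Suc i + j - L)"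
        unfolding q_def by (simp add: mod_if)
      then show False using \<open>q = i\<close> j i by (auto split: if_splits)
    qed
    ultimately show "e \<in> cyc_edges xs - {?f i}"
      using q uniq by (auto simp: cyc_edges_def L_def)
  qed
  then have "card (path_edges ys) \<le> card (cyc_edges xs - {?f i})"
    by (intro card_mono) auto
  moreover have "?f i \<in> cyc_edges xs" using i by (auto simp: cyc_edges_def L_def)
  then have "card (cyc_edges xs - {?f i}) + 1 = card (cyc_edges xs)"
    by (metis Suc_eq_plus1 card.remove finite_cyc_edges)
  moreover have "card (set xs) \<le> card (path_edges ys) + 1"
    using card_set_le_path_edges[of ys] by (simp add: ys_def)
  ultimately show ?thesis by linarith
qed

lemma card_set_le_Suc_cyc_edges: "card (set xs) \<le> card (cyc_edges xs) + 1"
proof -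
  have "path_edges xs \<subseteq> cyc_edges xs"
    by (fastforce simp: path_edges_def cyc_edges_def cyc_edge_def image_iff)
  then show ?thesis
    using card_set_le_path_edges[of xs] card_mono[OF finite_cyc_edges, of "path_edges xs" xs] by linarith
qed

text \<open>If the first bound does not apply, the length is at least twice the number of edges but
  exceeds it by at most 1, so it is at most 2.\<close>

lemma card_cyc_edges_distinct:
  assumes "distinct xs" "3 \<le> length xs"
  shows "length xs \<le> card (cyc_edges xs)"
proof (cases "length xs < 2 * card (cyc_edges xs)")
  case True
  then show ?thesis using card_set_le_cyc_edges[of xs] assms by (simp add: distinct_card)
next
  case False
  then show ?thesis
    using card_set_le_Suc_cyc_edges[of xs] assms by (simp add: distinct_card)
qed

text \<open>Group the lists by their vertex set. A set of size \<open>v\<close> carries at most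
  \<open>L ^ L\<close> lists and there are at most \<open>n ^ v\<close> such sets, so each
  \<open>v\<close> from 0 to \<open>L\<close> contributes at most \<open>L ^ L\<close>.\<close>

lemma sum_inverse_power_card_set:
  fixes V :: "'a set"
  assumes "finite V" "V \<noteq> {}"
  shows "(\<Sum>xs | set xs \<subseteq> V \<and> length xs = L. 1 / real (card V) ^ card (set xs)) \<le> real ((L + 1) * L ^ L)"
proof -
  define n where "n = card V"
  have n: "n > 0" using assms by (simp add: n_def card_gt_0_iff)
  let ?\<Omega> = "{xs. set xs \<subseteq> V \<and> length xs = L}"
  let ?\<A> = "{A. A \<subseteq> V \<and> card A \<le> L}"
  have fin: "finite ?\<Omega>" using assms by (rule_tac finite_lists_length_eq) simp
  have finA: "finite ?\<A>" using assms by (auto intro: finite_subset[of _ "Pow V"])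
  have "(\<Sum>xs\<in>?\<Omega>. 1 / real n ^ card (set xs))
      = (\<Sum>A\<in>?\<A>. \<Sum>xs | xs \<in> ?\<Omega> \<and> set xs = A. 1 / real n ^ card (set xs))"
    using fin finA by (intro sum.group[symmetric]) (auto intro: card_length)
  also have "\<dots> \<le> (\<Sum>A\<in>?\<A>. real (L ^ L) * (1 / real n ^ card A))"
  proof (intro sum_mono)
    fix A assume A: "A \<in> ?\<A>"
    then have "finite A" using assms finite_subset by auto
    have "card {xs. xs \<in> ?\<Omega> \<and> set xs = A} \<le> card {xs. set xs \<subseteq> A \<and> length xs = L}"
      using finite_lists_length_eq[OF \<open>finite A\<close>] by (intro card_mono) auto
    also have "\<dots> = card A ^ L" using card_lists_length_eq[OF \<open>finite A\<close>] by blast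
    also have "\<dots> \<le> L ^ L" using A by (auto intro: power_mono)
    finally have "real (card {xs. xs \<in> ?\<Omega> \<and> set xs = A}) \<le> real (L ^ L)" by (rule of_nat_mono)
    then show "(\<Sum>xs | xs \<in> ?\<Omega> \<and> set xs = A. 1 / real n ^ card (set xs)) \<le> real (L ^ L) * (1 / real n ^ card A)"
      by (simp add: divide_right_mono)
  qed
  also have "\<dots> = real (L ^ L) * (\<Sum>A\<in>?\<A>. 1 / real n ^ card A)"
    by (simp add: sum_distrib_left)
  also have "(\<Sum>A\<in>?\<A>. 1 / real n ^ card A) = (\<Sum>v\<in>{..L}. \<Sum>A | A \<in> ?\<A> \<and> card A = v. 1 / real n ^ card A)"
    using finA by (intro sum.group[symmetric]) auto
  also have "\<dots> \<le> (\<Sum>v\<in>{..L}. 1)"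
  proof (intro sum_mono)
    fix v assume "v \<in> {..L}"
    then have "{A. A \<in> ?\<A> \<and> card A = v} = {A. A \<subseteq> V \<and> card A = v}" by auto
    then have "(\<Sum>A | A \<in> ?\<A> \<and> card A = v. 1 / real n ^ card A) = real (n choose v) / real n ^ v"
      using n_subsets[OF assms(1), of v] by (simp add: n_def)
    moreover have "n choose v \<le> n ^ v"
      by (cases "v \<le> n") (simp_all add: binomial_le_pow binomial_eq_0)
    then have "real (n choose v) \<le> real n ^ v" by (metis of_nat_le_iff of_nat_power)
    ultimately show "(\<Sum>A | A \<in> ?\<A> \<and> card A = v. 1 / real n ^ card A) \<le> 1"
      using n by (simp add: divide_simps)
  qed
  also have "real (L ^ L) * (\<Sum>v\<in>{..L}. 1) = real ((L + 1) * L ^ L)" by (simp add: algebra_simps)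
  finally show ?thesis by (simp add: n_def mult_left_mono)
qed

text \<open>This is the expected number of closed walks in a random graph. A shape with
  \<open>v\<close> vertices and \<open>e\<close> edges costs \<open>n ^ v * p ^ e\<close>. If
  \<open>e \<le> m\<close>, then \<open>v \<le> e + 1\<close> gives at most
  \<open>n * D ^ e\<close>. If \<open>e > m\<close>, some edge is traversed only once, so
  \<open>v \<le> e\<close> and the cost is at most \<open>D ^ (2 * m)\<close>. The assumption
  \<open>D ^ m \<le> n\<close> puts both below \<open>n * D ^ m\<close>.\<close>

lemma sum_closed_walk_weights:
  fixes p D :: real
  assumes "finite V" "V \<noteq> {}" "0 \<le> p" "D = card V * p" "1 \<le> D" "D ^ m \<le> card V"
  shows "(\<Sum>xs | set xs \<subseteq> V \<and> length xs = 2 * m. p ^ card (cyc_edges xs))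
    \<le> card V * D ^ m * real ((2 * m + 1) * (2 * m) ^ (2 * m))"
proof -
  define n where "n = card V"
  have n: "n > 0" using assms by (simp add: n_def card_gt_0_iff)
  have "p ^ card (cyc_edges xs) \<le> n * D ^ m * (1 / real n ^ card (set xs))"
    if "length xs = 2 * m" for xs :: "'a list"
  proof -
    define e where "e = card (cyc_edges xs)"
    have "real n ^ card (set xs) * p ^ e \<le> n * D ^ m"
    proof (cases "e \<le> m")
      case True
      have "card (set xs) \<le> Suc e" using card_set_le_Suc_cyc_edges[of xs] by (simp add: e_def)
      then have "real n ^ card (set xs) * p ^ e \<le> real n ^ Suc e * p ^ e"
        using n assms by (intro mult_right_mono power_increasing) auto
      also have "\<dots> = n * D ^ e" using assms by (simp add: n_def power_mult_distrib)
      also have "\<dots> \<le> n * D ^ m" using True assms by (intro mult_left_mono power_increasing) auto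
      finally show ?thesis .
    next
      case False
      then have "card (set xs) \<le> e"
        using card_set_le_cyc_edges[of xs] that by (simp add: e_def)
      then have "real n ^ card (set xs) * p ^ e \<le> real n ^ e * p ^ e"
        using n assms by (intro mult_right_mono power_increasing) auto
      also have "\<dots> = D ^ e" using assms by (simp add: n_def power_mult_distrib)
      also have "e \<le> 2 * m"
        unfolding e_def cyc_edges_def using that card_image_le[of "{..<length xs}" "cyc_edge xs"] by simp
      then have "D ^ e \<le> D ^ (2 * m)" using assms by (intro power_increasing) auto
      also have "\<dots> = D ^ m * D ^ m" by (simp add: mult_2 power_add)
      also have "\<dots> \<le> n * D ^ m" using assms by (intro mult_right_mono) (auto simp: n_def)
      finally show ?thesis .
    qed
    then show ?thesis using n by (simp add: divide_simps e_def mult.commute)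
  qed
  then have "(\<Sum>xs | set xs \<subseteq> V \<and> length xs = 2 * m. p ^ card (cyc_edges xs))
    \<le> (\<Sum>xs | set xs \<subseteq> V \<and> length xs = 2 * m. n * D ^ m * (1 / real n ^ card (set xs)))"
    by (intro sum_mono) auto
  also have "\<dots> = n * D ^ m * (\<Sum>xs | set xs \<subseteq> V \<and> length xs = 2 * m. 1 / real n ^ card (set xs))"
    by (simp add: sum_distrib_left)
  also have "\<dots> \<le> n * D ^ m * real ((2 * m + 1) * (2 * m) ^ (2 * m))"
    using assms sum_inverse_power_card_set[OF assms(1,2), of "2 * m"]
    by (intro mult_left_mono) (auto simp: n_def)
  finally show ?thesis by (simp add: n_def)
qed

lemma sum_short_cycle_weights:
  fixes p D :: real
  assumes "finite V" "0 \<le> p" "p \<le> 1" "D = card V * p" "1 \<le> D"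
  shows "(\<Sum>xs | distinct xs \<and> set xs \<subseteq> V \<and> length xs \<in> {3..M}. p ^ card (cyc_edges xs)) \<le> M * D ^ M"
proof -
  let ?A = "\<lambda>j. {xs. set xs \<subseteq> V \<and> length xs = j}"
  have finA: "finite (?A j)" for j using finite_lists_length_eq[OF assms(1)] by blast
  have "(\<Sum>xs | distinct xs \<and> set xs \<subseteq> V \<and> length xs \<in> {3..M}. p ^ card (cyc_edges xs))
      \<le> (\<Sum>xs | distinct xs \<and> set xs \<subseteq> V \<and> length xs \<in> {3..M}. p ^ length xs)"
    using assms card_cyc_edges_distinct by (intro sum_mono power_decreasing) auto
  also have "\<dots> \<le> (\<Sum>xs\<in>(\<Union>j\<in>{3..M}. ?A j). p ^ length xs)"
    using finA assms by (intro sum_mono2) auto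
  also have "\<dots> = (\<Sum>j\<in>{3..M}. \<Sum>xs\<in>?A j. p ^ length xs)"
    using finA by (intro sum.UNION_disjoint) auto
  also have "\<dots> = (\<Sum>j\<in>{3..M}. D ^ j)"
    using card_lists_length_eq[OF assms(1)] by (intro sum.cong) (auto simp: assms(4) power_mult_distrib)
  also have "\<dots> \<le> (\<Sum>j\<in>{3..M}. D ^ M)"
    using assms(5) by (intro sum_mono power_increasing) auto
  also have "\<dots> \<le> M * D ^ M"
    using assms(5) by (auto intro!: mult_right_mono)
  finally show ?thesis .
qed

subsection \<open>Counting walks\<close>

fun walk :: "'a set set \<Rightarrow> 'a \<Rightarrow> 'a list \<Rightarrow> 'a \<Rightarrow> bool" where
  "walk F x [] y \<longleftrightarrow> x = y"
| "walk F x (z # zs) y \<longleftrightarrow> {x, z} \<in> F \<and> walk F z zs y"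

text \<open>An entry of the \<open>j\<close>-th power of the adjacency matrix of \<open>F\<close> on
  \<open>V\<close>; being real-valued, it can be fed to Cauchy--Schwarz directly. Its meaning as a
  number of walks is \<open>nwalks_eq_card\<close>.\<close>

fun nwalks :: "'a set \<Rightarrow> 'a set set \<Rightarrow> nat \<Rightarrow> 'a \<Rightarrow> 'a \<Rightarrow> real" where
  "nwalks V F 0 x y = of_bool (x = y)"
| "nwalks V F (Suc j) x y = (\<Sum>z\<in>V. of_bool ({x, z} \<in> F) * nwalks V F j z y)"

lemma nwalks_nonneg [simp]: "0 \<le> nwalks V F j x y"
  by (induction j arbitrary: x) (auto intro!: sum_nonneg)

lemma nwalks_mono: "F \<subseteq> F' \<Longrightarrow> nwalks V F j x y \<le> nwalks V F' j x y"
  by (induction j arbitrary: x) (auto intro!: sum_mono mult_mono)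

lemma nwalks_add:
  assumes "finite V" "x \<in> V"
  shows "nwalks V F (i + j) x y = (\<Sum>z\<in>V. nwalks V F i x z * nwalks V F j z y)"
  using assms(2)
proof (induction i arbitrary: x)
  case 0
  have "(\<Sum>z\<in>V. of_bool (x = z) * nwalks V F j z y) = (\<Sum>z\<in>V. if z = x then nwalks V F j x y else 0)"
    by (intro sum.cong) auto
  then show ?case using 0 assms(1) by simp
next
  case (Suc i)
  have "nwalks V F (Suc i + j) x y
      = (\<Sum>w\<in>V. \<Sum>z\<in>V. of_bool ({x, w} \<in> F) * nwalks V F i w z * nwalks V F j z y)"
    using Suc.IH by (simp add: sum_distrib_left mult.assoc)
  also have "\<dots> = (\<Sum>z\<in>V. \<Sum>w\<in>V. of_bool ({x, w} \<in> F) * nwalks V F i w z * nwalks V F j z y)"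
    by (rule sum.swap)
  finally show ?case by (simp add: sum_distrib_right)
qed

lemma nwalks_sym:
  assumes "finite V" "x \<in> V" "y \<in> V"
  shows "nwalks V F j x y = nwalks V F j y x"
  using assms(2,3)
proof (induction j arbitrary: x y)
  case (Suc j)
  have 1: "nwalks V F 1 z x = of_bool ({x, z} \<in> F)" for z
  proof -
    have "nwalks V F 1 z x = (\<Sum>w\<in>V. if w = x then of_bool ({x, z} \<in> F) else 0)"
      unfolding One_nat_def nwalks.simps by (intro sum.cong) (auto simp: insert_commute)
    then show ?thesis using Suc assms by simp
  qed
  have "nwalks V F (Suc j) y x = (\<Sum>z\<in>V. nwalks V F j y z * nwalks V F 1 z x)"
    using nwalks_add[OF assms(1) Suc.prems(2), of F j 1 x] by simp
  also have "\<dots> = (\<Sum>z\<in>V. of_bool ({x, z} \<in> F) * nwalks V F j z y)"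
    unfolding 1 using Suc by (intro sum.cong) (auto simp: mult.commute)
  finally show ?case by simp
qed auto

text \<open>The squared Frobenius norm of a symmetric matrix is the trace of its square.\<close>

lemma sum_square_nwalks:
  assumes "finite V"
  shows "(\<Sum>x\<in>V. \<Sum>y\<in>V. (nwalks V F j x y)\<^sup>2) = (\<Sum>x\<in>V. nwalks V F (2 * j) x x)"
proof (intro sum.cong refl)
  fix x assume "x \<in> V"
  then have "nwalks V F (2 * j) x x = (\<Sum>y\<in>V. nwalks V F j x y * nwalks V F j y x)"
    using nwalks_add[OF assms, of x F j j x] by (simp add: mult_2)
  also have "\<dots> = (\<Sum>y\<in>V. (nwalks V F j x y)\<^sup>2)"
    using nwalks_sym[OF assms \<open>x \<in> V\<close>] by (intro sum.cong) (auto simp: power2_eq_square)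
  finally show "(\<Sum>y\<in>V. (nwalks V F j x y)\<^sup>2) = nwalks V F (2 * j) x x" ..
qed

lemma nwalks_eq_card:
  assumes "finite V"
  shows "nwalks V F j x y = card {zs. set zs \<subseteq> V \<and> length zs = j \<and> walk F x zs y}"
proof (induction j arbitrary: x)
  case 0
  have "{zs. set zs \<subseteq> V \<and> length zs = 0 \<and> walk F x zs y} = (if x = y then {[]} else {})"
    by (auto split: if_splits)
  then show ?case by simp
next
  case (Suc j)
  let ?W = "\<lambda>z. {zs. set zs \<subseteq> V \<and> length zs = j \<and> walk F z zs y}"
  have fin: "finite (?W z)" for z
    by (rule finite_subset[OF _ finite_lists_length_eq[OF assms, of j]]) auto
  have "{zs. set zs \<subseteq> V \<and> length zs = Suc j \<and> walk F x zs y}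
      = (\<Union>z\<in>{z \<in> V. {x, z} \<in> F}. (#) z ` ?W z)"
    by (auto simp: length_Suc_conv image_iff)
  also have "card \<dots> = (\<Sum>z\<in>{z \<in> V. {x, z} \<in> F}. card (?W z))"
    using assms fin by (subst card_UN_disjoint) (auto simp: card_image)
  also have "real \<dots> = (\<Sum>z\<in>V. if {x, z} \<in> F then real (card (?W z)) else 0)"
    unfolding of_nat_sum by (rule sum.inter_filter[OF assms])
  also have "\<dots> = nwalks V F (Suc j) x y"
    by (simp add: Suc) (intro sum.cong, auto)
  finally show ?case ..
qed

lemma ex_walk:
  assumes "finite V" "nwalks V F j x y \<noteq> 0"
  obtains zs where "set zs \<subseteq> V" "length zs = j" "walk F x zs y"
proof -
  have "{zs. set zs \<subseteq> V \<and> length zs = j \<and> walk F x zs y} \<noteq> {}"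
    using assms(2) unfolding nwalks_eq_card[OF assms(1)] by (metis card.empty of_nat_0)
  then show ?thesis using that by blast
qed

lemma walk_iff_path_edges: "walk F x zs y \<longleftrightarrow> last (x # zs) = y \<and> path_edges (x # zs) \<subseteq> F"
  by (induction zs arbitrary: x) (auto simp: path_edges_simps)

text \<open>In a closed walk the list \<open>zs\<close> omits the start \<open>x\<close> but ends in
  it. So \<open>zs\<close> determines \<open>x\<close>, and read cyclically it carries all the
  edges.\<close>

lemma sum_nwalks_closed_le:
  assumes "finite V" "j > 0"
  shows "(\<Sum>x\<in>V. nwalks V F j x x) \<le> card {xs. set xs \<subseteq> V \<and> length xs = j \<and> cyc_edges xs \<subseteq> F}"
proof -
  let ?W = "\<lambda>x. {zs. set zs \<subseteq> V \<and> length zs = j \<and> walk F x zs x}"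
  have fin: "finite {zs. set zs \<subseteq> V \<and> length zs = j}"
    using finite_lists_length_eq[OF assms(1), of j] by blast
  have last: "last zs = x" if "zs \<in> ?W x" for zs x
    using that assms(2) by (cases zs) (auto simp: walk_iff_path_edges)
  have "(\<Sum>x\<in>V. card (?W x)) = card (\<Union>x\<in>V. ?W x)"
  proof (rule card_UN_disjoint[symmetric])
    show "\<forall>x\<in>V. finite (?W x)" using fin by (auto intro: finite_subset[rotated])
    show "\<forall>x\<in>V. \<forall>y\<in>V. x \<noteq> y \<longrightarrow> ?W x \<inter> ?W y = {}" using last by blast
  qed fact
  also have "\<dots> \<le> card {xs. set xs \<subseteq> V \<and> length xs = j \<and> cyc_edges xs \<subseteq> F}"
  proof (intro card_mono)
    show "finite {xs. set xs \<subseteq> V \<and> length xs = j \<and> cyc_edges xs \<subseteq> F}"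
      using fin by (auto intro: finite_subset[rotated])
    have "cyc_edges zs \<subseteq> F" if zs: "zs \<in> ?W x" for zs x
    proof -
      have w: "{(x # zs) ! i, zs ! i} \<in> F" if "i < j" for i
        using zs that by (fastforce simp: walk_iff_path_edges path_edges_def)
      have "zs \<noteq> []" using zs assms by auto
      show ?thesis
      proof
        fix e assume "e \<in> cyc_edges zs"
        then obtain i where i: "i < j" "e = {zs ! i, zs ! (Suc i mod j)}"
          using zs by (auto simp: cyc_edges_def cyc_edge_def)
        show "e \<in> F"
        proof (cases "Suc i = j")
          \<comment> \<open>The wrap-around edge of \<open>zs\<close> is the first step of the walk
            out of \<open>x\<close>.\<close>
          case True
          then have "zs ! i = x"
            using last[OF zs] zs \<open>zs \<noteq> []\<close> by (auto simp: last_conv_nth)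
          then show ?thesis using w[of 0] i True by simp
        next
          case False
          then show ?thesis using w[of "Suc i"] i by simp
        qed
      qed
    qed
    then show "(\<Union>x\<in>V. ?W x) \<subseteq> {xs. set xs \<subseteq> V \<and> length xs = j \<and> cyc_edges xs \<subseteq> F}" by blast
  qed
  finally have "(\<Sum>x\<in>V. card (?W x)) \<le> card {xs. set xs \<subseteq> V \<and> length xs = j \<and> cyc_edges xs \<subseteq> F}" .
  then have "real (\<Sum>x\<in>V. card (?W x)) \<le> card {xs. set xs \<subseteq> V \<and> length xs = j \<and> cyc_edges xs \<subseteq> F}"
    by (rule of_nat_mono)
  then show ?thesis
    unfolding nwalks_eq_card[OF assms(1)] of_nat_sum .
qed

text \<open>The counted walks never leave \<open>W\<close>, so both ends lie in \<open>W\<close>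
  whatever the parity of \<open>j\<close>.\<close>

lemma min_degree_nwalks:
  fixes d :: real
  assumes "finite V" "W \<subseteq> V" "x \<in> W" "0 \<le> d"
    and "\<And>x. x \<in> W \<Longrightarrow> d \<le> real (card {y \<in> W. {x, y} \<in> F})"
  shows "d ^ j \<le> (\<Sum>y\<in>W. nwalks V F j x y)"
  using assms(3)
proof (induction j arbitrary: x)
  case 0
  have "finite W" by (rule finite_subset[OF assms(2,1)])
  then show ?case using 0 by (simp add: of_bool_def)
next
  case (Suc j)
  have "finite W" by (rule finite_subset[OF assms(2,1)])
  have "d ^ Suc j \<le> card {z \<in> W. {x, z} \<in> F} * d ^ j"
    using assms(4,5) Suc.prems by (auto intro: mult_right_mono)
  also have "\<dots> = (\<Sum>z\<in>W. of_bool ({x, z} \<in> F) * d ^ j)"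
    using \<open>finite W\<close> by (simp add: Int_def flip: sum_distrib_right)
  also have "\<dots> \<le> (\<Sum>z\<in>W. of_bool ({x, z} \<in> F) * (\<Sum>y\<in>W. nwalks V F j z y))"
    by (intro sum_mono mult_left_mono Suc.IH) auto
  also have "\<dots> \<le> (\<Sum>z\<in>V. of_bool ({x, z} \<in> F) * (\<Sum>y\<in>W. nwalks V F j z y))"
    using assms by (intro sum_mono2) (auto intro!: mult_nonneg_nonneg sum_nonneg)
  also have "\<dots> = (\<Sum>y\<in>W. nwalks V F (Suc j) x y)"
    by (simp add: sum_distrib_left) (rule sum.swap)
  finally show ?case .
qed

text \<open>The square of the number of walks is controlled by the number of closed walks of twice the
  length, so walks cannot concentrate on few pairs of endpoints.\<close>

lemma nwalks_pairs_bound: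
  fixes g :: nat
  assumes "finite V" "X \<subseteq> V" "0 < j" "F \<subseteq> H"
    and deg: "\<And>x. x \<in> X \<Longrightarrow> card {y \<in> X. x \<noteq> y \<and> nwalks V F j x y \<noteq> 0} < g"
  shows "(\<Sum>x\<in>X. \<Sum>y\<in>X. nwalks V F j x y)\<^sup>2
    \<le> card V * g * card {xs. set xs \<subseteq> V \<and> length xs = 2 * j \<and> cyc_edges xs \<subseteq> H}"
proof -
  have "finite X" by (rule finite_subset[OF assms(2,1)])
  let ?w = "\<lambda>q. nwalks V F j (fst q) (snd q)"
  let ?c = "card {xs. set xs \<subseteq> V \<and> length xs = 2 * j \<and> cyc_edges xs \<subseteq> H}"
  \<comment> \<open>Inserting the indicator of the support makes Cauchy--Schwarz charge only the
    pairs that are joined.\<close>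
  have "(\<Sum>x\<in>X. \<Sum>y\<in>X. nwalks V F j x y) = (\<Sum>q\<in>X \<times> X. of_bool (?w q \<noteq> 0) * ?w q)"
    unfolding sum.cartesian_product case_prod_unfold by (intro sum.cong) auto
  also have "\<dots>\<^sup>2 \<le> (\<Sum>q\<in>X \<times> X. (of_bool (?w q \<noteq> 0))\<^sup>2) * (\<Sum>q\<in>X \<times> X. (?w q)\<^sup>2)"
    by (rule Cauchy_Schwarz_ineq_sum)
  also have "\<dots> \<le> real (card V * g) * real ?c"
  proof (rule mult_mono)
    have "(\<Sum>q\<in>X \<times> X. (of_bool (?w q \<noteq> 0))\<^sup>2) = (\<Sum>x\<in>X. \<Sum>y\<in>X. of_bool (nwalks V F j x y \<noteq> 0) :: real)"
      unfolding sum.cartesian_product case_prod_unfold by (intro sum.cong) auto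
    also have "\<dots> \<le> (\<Sum>x\<in>X. real g)"
    proof (rule sum_mono)
      fix x assume x: "x \<in> X"
      \<comment> \<open>The diagonal pair, left out in \<open>deg\<close>, is paid for by the
        strictness of that bound.\<close>
      have "{y \<in> X. nwalks V F j x y \<noteq> 0} \<subseteq> insert x {y \<in> X. x \<noteq> y \<and> nwalks V F j x y \<noteq> 0}"
        by auto
      then have "card {y \<in> X. nwalks V F j x y \<noteq> 0} \<le> card (insert x {y \<in> X. x \<noteq> y \<and> nwalks V F j x y \<noteq> 0})"
        using \<open>finite X\<close> by (intro card_mono) auto
      also have "\<dots> \<le> g" using deg[OF x] \<open>finite X\<close> by (simp add: card_insert_if)
      finally show "(\<Sum>y\<in>X. of_bool (nwalks V F j x y \<noteq> 0)) \<le> real g"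
        using \<open>finite X\<close> by (simp add: Int_def)
    qed
    also have "\<dots> \<le> card V * g" using assms by (auto intro!: mult_right_mono card_mono)
    finally show "(\<Sum>q\<in>X \<times> X. (of_bool (?w q \<noteq> 0))\<^sup>2) \<le> real (card V * g)" by simp
    have "(\<Sum>q\<in>X \<times> X. (?w q)\<^sup>2) \<le> (\<Sum>q\<in>V \<times> V. (nwalks V H j (fst q) (snd q))\<^sup>2)"
    proof -
      have "(\<Sum>q\<in>X \<times> X. (?w q)\<^sup>2) \<le> (\<Sum>q\<in>V \<times> V. (?w q)\<^sup>2)"
        using assms by (intro sum_mono2) auto
      also have "\<dots> \<le> (\<Sum>q\<in>V \<times> V. (nwalks V H j (fst q) (snd q))\<^sup>2)"
        using assms by (intro sum_mono power_mono nwalks_mono) auto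
      finally show ?thesis .
    qed
    also have "\<dots> = (\<Sum>x\<in>V. nwalks V H (2 * j) x x)"
      using sum_square_nwalks[OF assms(1), of H j] by (simp add: sum.cartesian_product case_prod_unfold)
    also have "\<dots> \<le> ?c" using assms by (intro sum_nwalks_closed_le) auto
    finally show "(\<Sum>q\<in>X \<times> X. (?w q)\<^sup>2) \<le> ?c" .
  qed (auto intro: sum_nonneg)
  finally show ?thesis by simp
qed

text \<open>At least \<open>card X * d ^ h\<close> walks of length \<open>h\<close> start in
  \<open>X\<close>. By Cauchy--Schwarz over their endpoints many pairs of them meet, and two that
  meet form a walk of length \<open>2 * h\<close> from \<open>X\<close> to \<open>X\<close>. The
  inner vertices may lie outside \<open>X\<close>, so \<open>X\<close> itself may span no
  edge.\<close>

lemma even_walks_lower_bound: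
  fixes d :: real
  assumes "finite V" "X \<subseteq> W" "W \<subseteq> V" "0 \<le> d"
    and "\<And>x. x \<in> W \<Longrightarrow> d \<le> real (card {y \<in> W. {x, y} \<in> F})"
  shows "(card X * d ^ h)\<^sup>2 \<le> card V * (\<Sum>x\<in>X. \<Sum>y\<in>X. nwalks V F (2 * h) x y)"
proof -
  have "card X * d ^ h = (\<Sum>x\<in>X. d ^ h)" by simp
  also have "\<dots> \<le> (\<Sum>x\<in>X. \<Sum>z\<in>V. nwalks V F h x z)"
  proof (rule sum_mono)
    fix x assume "x \<in> X"
    then have "x \<in> W" using assms(2) by blast
    then have "d ^ h \<le> (\<Sum>z\<in>W. nwalks V F h x z)"
      by (rule min_degree_nwalks[OF assms(1,3) _ assms(4,5)])
    also have "\<dots> \<le> (\<Sum>z\<in>V. nwalks V F h x z)" using assms(1,3) by (intro sum_mono2) auto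
    finally show "d ^ h \<le> (\<Sum>z\<in>V. nwalks V F h x z)" .
  qed
  also have "\<dots> = (\<Sum>z\<in>V. 1 * (\<Sum>x\<in>X. nwalks V F h x z))" unfolding mult_1 by (rule sum.swap)
  finally have "(card X * d ^ h)\<^sup>2 \<le> (\<Sum>z\<in>V. 1 * (\<Sum>x\<in>X. nwalks V F h x z))\<^sup>2"
    using assms(4) by (intro power_mono) auto
  also have "\<dots> \<le> (\<Sum>z\<in>V. 1\<^sup>2) * (\<Sum>z\<in>V. (\<Sum>x\<in>X. nwalks V F h x z)\<^sup>2)"
    by (rule Cauchy_Schwarz_ineq_sum)
  also have "(\<Sum>z\<in>V. (\<Sum>x\<in>X. nwalks V F h x z)\<^sup>2)
      = (\<Sum>z\<in>V. \<Sum>x\<in>X. \<Sum>y\<in>X. nwalks V F h x z * nwalks V F h z y)"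
    unfolding power2_eq_square sum_product
  proof (intro sum.cong refl arg_cong2[where f = times])
    fix z y assume "z \<in> V" "y \<in> X"
    then show "nwalks V F h y z = nwalks V F h z y"
      using assms(2,3) by (intro nwalks_sym[OF assms(1)]) auto
  qed
  also have "\<dots> = (\<Sum>x\<in>X. \<Sum>z\<in>V. \<Sum>y\<in>X. nwalks V F h x z * nwalks V F h z y)"
    by (rule sum.swap)
  also have "\<dots> = (\<Sum>x\<in>X. \<Sum>y\<in>X. nwalks V F (2 * h) x y)"
  proof (rule sum.cong)
    fix x assume "x \<in> X"
    then have "x \<in> V" using assms(2,3) by blast
    show "(\<Sum>z\<in>V. \<Sum>y\<in>X. nwalks V F h x z * nwalks V F h z y) = (\<Sum>y\<in>X. nwalks V F (2 * h) x y)"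
      unfolding mult_2 nwalks_add[OF assms(1) \<open>x \<in> V\<close>] by (rule sum.swap)
  qed simp
  finally show ?thesis by simp
qed

subsection \<open>Containers for neighbourhoods in a colour class\<close>

lemma path_edges_Cons: "ys \<noteq> [] \<Longrightarrow> path_edges (x # ys) = insert {x, hd ys} (path_edges ys)"
  by (cases ys) (auto simp: path_edges_simps)

lemma path_edges_suffix: "path_edges ys \<subseteq> path_edges (xs @ ys)"
proof (induction xs)
  case (Cons x xs)
  show ?case
  proof (cases "xs @ ys = []")
    case False
    then show ?thesis using Cons path_edges_Cons[of "xs @ ys" x] by auto
  qed (simp add: path_edges_simps)
qed simp

lemma path_edges_snoc: "xs \<noteq> [] \<Longrightarrow> path_edges (xs @ [y]) = insert {last xs, y} (path_edges xs)"
proof (induction xs)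
  case (Cons x xs)
  then show ?case by (cases "xs = []") (auto simp: path_edges_simps path_edges_Cons)
qed simp

lemma ex_distinct_path:
  assumes "xs \<noteq> []"
  shows "\<exists>ws. ws \<noteq> [] \<and> distinct ws \<and> hd ws = hd xs \<and> last ws = last xs \<and>
    path_edges ws \<subseteq> path_edges xs \<and> length ws \<le> length xs"
  using assms
proof (induction xs)
  case (Cons x ys)
  show ?case
  proof (cases "ys = []")
    case True
    then show ?thesis by (intro exI[of _ "[x]"]) (simp add: path_edges_simps)
  next
    case False
    then obtain ws where ws: "ws \<noteq> []" "distinct ws" "hd ws = hd ys" "last ws = last ys"
      "path_edges ws \<subseteq> path_edges ys" "length ws \<le> length ys" using Cons by blast
    show ?thesis
    proof (cases "x \<in> set ws")
      case True
      then obtain as bs where ab: "ws = as @ x # bs" by (auto simp: in_set_conv_decomp)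
      have "path_edges (x # bs) \<subseteq> path_edges (x # ys)"
        using path_edges_suffix[of "x # bs" as] ws(5) False by (auto simp: ab path_edges_Cons)
      then show ?thesis using ws ab False by (intro exI[of _ "x # bs"]) auto
    next
      case nin: False
      then show ?thesis using ws False by (intro exI[of _ "x # ws"]) (auto simp: path_edges_Cons)
    qed
  qed
qed simp

lemma cyc_edges_subset_path_edges:
  assumes "xs \<noteq> []"
  shows "cyc_edges xs \<subseteq> insert {last xs, hd xs} (path_edges xs)"
proof
  fix e assume "e \<in> cyc_edges xs"
  then obtain i where i: "i < length xs" "e = {xs ! i, xs ! (Suc i mod length xs)}"
    by (auto simp: cyc_edges_def cyc_edge_def)
  show "e \<in> insert {last xs, hd xs} (path_edges xs)"
  proof (cases "Suc i = length xs")
    case True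
    then have "i = length xs - 1" by simp
    then show ?thesis using i True assms by (simp add: last_conv_nth hd_conv_nth)
  next
    case False
    then show ?thesis using i by (auto simp: path_edges_def)
  qed
qed

text \<open>A walk of length \<open>m\<close> between two neighbours of \<open>v\<close> would close up to a cycle of length at most
  \<open>m + 2\<close>.\<close>

lemma nwalks_neighbours_eq_0:
  assumes "finite V" "F \<subseteq> G"
    and nocyc: "\<And>xs. distinct xs \<Longrightarrow> 3 \<le> length xs \<Longrightarrow> length xs \<le> m + 2 \<Longrightarrow> \<not> cyc_edges xs \<subseteq> G"
    and v: "{v, x} \<in> G - F" "{v, y} \<in> G - F" "x \<noteq> y" "v \<noteq> x"
  shows "nwalks V F m x y = 0"
proof (rule ccontr)
  assume "nwalks V F m x y \<noteq> 0"
  then obtain zs where zs: "length zs = m" "walk F x zs y"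
    using ex_walk[OF assms(1)] by metis
  then have w: "last (x # zs) = y" "path_edges (x # zs) \<subseteq> F" by (auto simp: walk_iff_path_edges)
  \<comment> \<open>The walk from \<open>x\<close> to \<open>y\<close> is prolonged to
    \<open>v\<close>. It avoids the edge \<open>{v, x}\<close>, which is therefore free to close a
    cycle.\<close>
  have "{y, v} \<in> G - {{v, x}}" using v by (auto simp: insert_commute doubleton_eq_iff)
  moreover have "path_edges (x # zs) \<subseteq> G - {{v, x}}" using w(2) v(1) assms(2) by blast
  ultimately have "path_edges ((x # zs) @ [v]) \<subseteq> G - {{v, x}}"
    unfolding path_edges_snoc[OF list.distinct(2)] w(1) by blast
  moreover obtain ws where ws: "ws \<noteq> []" "distinct ws" "hd ws = x" "last ws = v"
    "path_edges ws \<subseteq> path_edges ((x # zs) @ [v])" "length ws \<le> m + 2"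
    using ex_distinct_path[of "(x # zs) @ [v]"] zs by auto
  ultimately have sub: "path_edges ws \<subseteq> G - {{v, x}}" by blast
  obtain us where us: "ws = x # us" using ws by (cases ws) auto
  then have "us \<noteq> []" using ws v(4) by auto
  then obtain u us' where us': "us = u # us'" by (cases us) auto
  \<comment> \<open>A path on two vertices would be the edge \<open>{v, x}\<close> itself.\<close>
  have "us' \<noteq> []" using sub ws us us' by (auto simp: path_edges_simps insert_commute)
  then have "3 \<le> length ws" using us us' by (cases us') auto
  moreover have "cyc_edges ws \<subseteq> G"
    using cyc_edges_subset_path_edges[OF ws(1)] sub v ws by auto
  ultimately show False using nocyc ws by blast
qed

text \<open>The Kleitman--Winston algorithm: an independent set is recovered up to a set of small degree
  from a short fingerprint, since putting a vertex of degree at least \<open>g\<close> into the fingerprint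
  discards its at least \<open>g\<close> neighbours.\<close>

lemma ex_container_map:
  fixes R :: "'a \<Rightarrow> 'a \<Rightarrow> bool"
  assumes "finite A"
  shows "\<exists>K. \<forall>I\<subseteq>A. (\<forall>x\<in>I. \<forall>y\<in>I. x \<noteq> y \<longrightarrow> \<not> R x y) \<longrightarrow>
    (\<exists>T\<subseteq>I. card T * g \<le> card A \<and> I \<subseteq> T \<union> K T \<and> K T \<subseteq> A \<and>
      (\<forall>x\<in>K T. card {y \<in> K T. x \<noteq> y \<and> R x y} < g))"
proof -
  define sparse where "sparse C \<longleftrightarrow> (\<forall>x\<in>C. card {y \<in> C. x \<noteq> y \<and> R x y} < g)" for C
  define indep where "indep I \<longleftrightarrow> (\<forall>x\<in>I. \<forall>y\<in>I. x \<noteq> y \<longrightarrow> \<not> R x y)" for I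
  define enc where "enc A K I T \<longleftrightarrow>
    T \<subseteq> I \<and> card T * g \<le> card A \<and> I \<subseteq> T \<union> K T \<and> K T \<subseteq> A \<and> sparse (K T)" for A K I T
  have "\<exists>K. \<forall>I. I \<subseteq> A \<longrightarrow> indep I \<longrightarrow> (\<exists>T. enc A K I T)"
    using assms
  proof (induction A rule: finite_psubset_induct)
    case (psubset A)
    show ?case
    proof (cases "sparse A")
      case True
      then have "enc A (\<lambda>_. A) I {}" if "I \<subseteq> A" for I using that by (simp add: enc_def)
      then show ?thesis by blast
    next
      case False
      define N where "N x = {y \<in> A. x \<noteq> y \<and> R x y}" for x
      \<comment> \<open>The vertex is chosen from \<open>A\<close> without looking at the
        independent set, so the decoder makes the same choice and learns from
        \<open>x \<in> T\<close> which branch was taken.\<close>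
      from False obtain x where x: "x \<in> A" "g \<le> card (N x)" by (auto simp: N_def sparse_def not_less)
      define A0 A1 where "A0 = A - {x}" and "A1 = A - {x} - N x"
      have sub: "A0 \<subset> A" "A1 \<subset> A" using x by (auto simp: A0_def A1_def)
      obtain K0 where K0: "\<forall>I. I \<subseteq> A0 \<longrightarrow> indep I \<longrightarrow> (\<exists>T. enc A0 K0 I T)"
        using psubset.IH[OF sub(1)] ..
      obtain K1 where K1: "\<forall>I. I \<subseteq> A1 \<longrightarrow> indep I \<longrightarrow> (\<exists>T. enc A1 K1 I T)"
        using psubset.IH[OF sub(2)] ..
      define K where "K T = (if x \<in> T then K1 (T - {x}) else K0 T)" for T
      have "\<exists>T. enc A K I T" if I: "I \<subseteq> A" "indep I" for I
      proof (cases "x \<in> I")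
        case False
        then have "I \<subseteq> A0" using I by (auto simp: A0_def)
        then obtain T where T: "enc A0 K0 I T" using K0 I by blast
        moreover have "card A0 \<le> card A" using sub psubset by (intro card_mono) auto
        moreover have "K T = K0 T" using False T by (auto simp: K_def enc_def)
        ultimately have "enc A K I T" using sub by (auto simp: enc_def)
        then show ?thesis ..
      next
        case True
        have "I - {x} \<subseteq> A1" "indep (I - {x})" using I True by (auto simp: A1_def N_def indep_def)
        then obtain T where T: "enc A1 K1 (I - {x}) T" using K1 by blast
        then have "T \<subseteq> A" "x \<notin> T" using I by (auto simp: enc_def)
        then have "finite T" "K (insert x T) = K1 T" using psubset finite_subset by (auto simp: K_def)
        have "finite A1" "finite (N x)" using psubset(1) by (auto simp: A1_def N_def)
        then have "card A1 + card (N x) = card (A1 \<union> N x)"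
          by (intro card_Un_disjoint[symmetric]) (auto simp: A1_def)
        also have "\<dots> \<le> card A" using psubset(1) by (intro card_mono) (auto simp: A1_def N_def)
        finally have "card (insert x T) * g \<le> card A"
          using T x(2) \<open>finite T\<close> \<open>x \<notin> T\<close> by (simp add: enc_def)
        then have "enc A K I (insert x T)"
          using T True sub \<open>K (insert x T) = K1 T\<close> by (auto simp: enc_def)
        then show ?thesis ..
      qed
      then show ?thesis by blast
    qed
  qed
  then show ?thesis unfolding enc_def indep_def sparse_def .
qed

text \<open>One decoding map is fixed for each \<open>F\<close>. A container is thus a function of
  \<open>F\<close> and a fingerprint alone and does not see the rest of the colour class, so a union
  bound need only count these two arguments. For a set that is not a fingerprint the value is
  unspecified.\<close>

definition containers :: "'a set \<Rightarrow> nat \<Rightarrow> nat \<Rightarrow> 'a set set \<Rightarrow> 'a set \<Rightarrow> 'a set" where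
  "containers V m g F = (SOME K. \<forall>I\<subseteq>V. (\<forall>x\<in>I. \<forall>y\<in>I. x \<noteq> y \<longrightarrow> \<not> nwalks V F m x y \<noteq> 0) \<longrightarrow>
    (\<exists>T\<subseteq>I. card T * g \<le> card V \<and> I \<subseteq> T \<union> K T \<and> K T \<subseteq> V \<and>
      (\<forall>x\<in>K T. card {y \<in> K T. x \<noteq> y \<and> nwalks V F m x y \<noteq> 0} < g)))"

definition pairs :: "'a set \<Rightarrow> 'a set set" where
  "pairs V = {e. e \<subseteq> V \<and> card e = 2}"

lemma finite_pairs [simp]: "finite V \<Longrightarrow> finite (pairs V)"
  unfolding pairs_def by (rule finite_subset[of _ "Pow V"]) auto

lemma doubleton_in_pairs [simp]: "{x, y} \<in> pairs V \<longleftrightarrow> x \<in> V \<and> y \<in> V \<and> x \<noteq> y"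
  by (auto simp: pairs_def card_insert_if)

lemma neighbourhood_container:
  assumes "finite V" "F \<subseteq> G" "G \<subseteq> pairs V"
    and nocyc: "\<And>xs. distinct xs \<Longrightarrow> 3 \<le> length xs \<Longrightarrow> length xs \<le> m + 2 \<Longrightarrow> \<not> cyc_edges xs \<subseteq> G"
  shows "\<exists>T\<subseteq>V. card T * g \<le> card V \<and> (\<forall>x. {v, x} \<in> G - F \<longrightarrow> x \<in> T \<union> containers V m g F T) \<and>
    containers V m g F T \<subseteq> V \<and>
    (\<forall>x\<in>containers V m g F T. card {y \<in> containers V m g F T. x \<noteq> y \<and> nwalks V F m x y \<noteq> 0} < g)"
proof -
  let ?I = "{x. {v, x} \<in> G - F}"
  have I: "?I \<subseteq> V" using assms(3) by (auto simp: subset_iff)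
  have K: "\<forall>I\<subseteq>V. (\<forall>x\<in>I. \<forall>y\<in>I. x \<noteq> y \<longrightarrow> \<not> nwalks V F m x y \<noteq> 0) \<longrightarrow>
    (\<exists>T\<subseteq>I. card T * g \<le> card V \<and> I \<subseteq> T \<union> containers V m g F T \<and> containers V m g F T \<subseteq> V \<and>
      (\<forall>x\<in>containers V m g F T. card {y \<in> containers V m g F T. x \<noteq> y \<and> nwalks V F m x y \<noteq> 0} < g))"
    using someI_ex[OF ex_container_map[OF assms(1), of "\<lambda>x y. nwalks V F m x y \<noteq> 0" g]]
    unfolding containers_def .
  have ind: "\<forall>x\<in>?I. \<forall>y\<in>?I. x \<noteq> y \<longrightarrow> \<not> nwalks V F m x y \<noteq> 0"
  proof (intro ballI impI, simp only: not_not)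
    fix x y assume xy: "x \<in> ?I" "y \<in> ?I" "x \<noteq> y"
    then have "{v, x} \<in> pairs V" using assms(3) by blast
    then have "v \<noteq> x" by simp
    then show "nwalks V F m x y = 0"
      using nwalks_neighbours_eq_0[OF assms(1,2) nocyc] xy by blast
  qed
  from K[THEN spec, THEN mp, OF I, THEN mp, OF ind] obtain T where
    "T \<subseteq> ?I \<and> card T * g \<le> card V \<and> ?I \<subseteq> T \<union> containers V m g F T \<and> containers V m g F T \<subseteq> V \<and>
      (\<forall>x\<in>containers V m g F T. card {y \<in> containers V m g F T. x \<noteq> y \<and> nwalks V F m x y \<noteq> 0} < g)" ..
  then show ?thesis using I by (intro exI[of _ T] conjI) blast+
qed

section \<open>Subgraphs of large minimum degree\<close>

lemma ex_min_degree_subset: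
  assumes "finite W0" "F \<subseteq> pairs U"
  shows "\<exists>W\<subseteq>W0. (\<forall>x\<in>W. d \<le> card {y \<in> W. {x, y} \<in> F}) \<and>
    card {e \<in> F. e \<subseteq> W0} \<le> card {e \<in> F. e \<subseteq> W} + d * card W0"
  using assms(1)
proof (induction W0 rule: finite_psubset_induct)
  case (psubset W0)
  show ?case
  proof (cases "\<forall>x\<in>W0. d \<le> card {y \<in> W0. {x, y} \<in> F}")
    case True
    then show ?thesis by (intro exI[of _ W0]) auto
  next
    case False
    then obtain x where x: "x \<in> W0" "card {y \<in> W0. {x, y} \<in> F} < d" by (auto simp: not_le)
    have "W0 - {x} \<subset> W0" using x by auto
    from psubset.IH[OF this] obtain W where W: "W \<subseteq> W0 - {x}" "\<forall>x\<in>W. d \<le> card {y \<in> W. {x, y} \<in> F}"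
      "card {e \<in> F. e \<subseteq> W0 - {x}} \<le> card {e \<in> F. e \<subseteq> W} + d * card (W0 - {x})" by blast
    have fin: "finite {e \<in> F. e \<subseteq> W0 - {x}}"
      using psubset(1) by (auto intro: finite_subset[of _ "Pow W0"])
    have "{e \<in> F. e \<subseteq> W0} \<subseteq> {e \<in> F. e \<subseteq> W0 - {x}} \<union> (\<lambda>y. {x, y}) ` {y \<in> W0. {x, y} \<in> F}"
    proof
      fix e assume e: "e \<in> {e \<in> F. e \<subseteq> W0}"
      show "e \<in> {e \<in> F. e \<subseteq> W0 - {x}} \<union> (\<lambda>y. {x, y}) ` {y \<in> W0. {x, y} \<in> F}"
      proof (cases "x \<in> e")
        case True
        moreover have "card e = 2" using e assms(2) by (auto simp: pairs_def)
        ultimately obtain y where "e = {x, y}" by (auto simp: card_2_iff)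
        then show ?thesis using e by auto
      qed (use e in auto)
    qed
    then have "card {e \<in> F. e \<subseteq> W0} \<le> card ({e \<in> F. e \<subseteq> W0 - {x}} \<union> (\<lambda>y. {x, y}) ` {y \<in> W0. {x, y} \<in> F})"
      using fin psubset(1) by (intro card_mono) auto
    also have "\<dots> \<le> card {e \<in> F. e \<subseteq> W0 - {x}} + card {y \<in> W0. {x, y} \<in> F}"
      using psubset(1) by (intro order_trans[OF card_Un_le] add_left_mono card_image_le) auto
    also have "\<dots> \<le> card {e \<in> F. e \<subseteq> W} + d * card (W0 - {x}) + d"
      using W(3) x(2) by linarith
    also have "\<dots> = card {e \<in> F. e \<subseteq> W} + d * card W0"
      using card.remove[OF psubset(1) x(1)] by simp
    finally have "card {e \<in> F. e \<subseteq> W0} \<le> card {e \<in> F. e \<subseteq> W} + d * card W0" .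
    then show ?thesis using W(1,2) by blast
  qed
qed

lemma card_edges_le_degree:
  assumes "finite W" "F \<subseteq> pairs U" "\<And>x. x \<in> W \<Longrightarrow> card {y \<in> W. {x, y} \<in> F} \<le> \<Delta>"
  shows "card {e \<in> F. e \<subseteq> W} \<le> card W * \<Delta>"
proof -
  have "{e \<in> F. e \<subseteq> W} \<subseteq> (\<Union>x\<in>W. (\<lambda>y. {x, y}) ` {y \<in> W. {x, y} \<in> F})"
  proof
    fix e assume e: "e \<in> {e \<in> F. e \<subseteq> W}"
    then have "card e = 2" using assms(2) by (auto simp: pairs_def)
    then obtain x y where "e = {x, y}" by (auto simp: card_2_iff)
    then show "e \<in> (\<Union>x\<in>W. (\<lambda>y. {x, y}) ` {y \<in> W. {x, y} \<in> F})" using e by auto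
  qed
  then have "card {e \<in> F. e \<subseteq> W} \<le> card (\<Union>x\<in>W. (\<lambda>y. {x, y}) ` {y \<in> W. {x, y} \<in> F})"
    using assms(1) by (intro card_mono) auto
  also have "\<dots> \<le> (\<Sum>x\<in>W. card ((\<lambda>y. {x, y}) ` {y \<in> W. {x, y} \<in> F}))"
    using assms(1) by (rule card_UN_le)
  also have "\<dots> \<le> (\<Sum>x\<in>W. \<Delta>)"
    using assms(1,3) by (intro sum_mono order_trans[OF card_image_le]) auto
  finally show ?thesis by simp
qed

subsection \<open>The random host graph\<close>

lemma expect_subset_le:
  assumes "finite E" "0 \<le> p"
  shows "expect p E (\<lambda>H. of_bool (F \<subseteq> H)) \<le> p ^ card F"
proof (cases "F \<subseteq> E")
  case True
  then show ?thesis using expect_subset[OF assms(1)] by simp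
next
  case False
  then have "expect p E (\<lambda>H. of_bool (F \<subseteq> H)) = expect p E (\<lambda>_. 0)"
    by (intro expect_cong) auto
  then show ?thesis using assms expect_const[OF assms(1), of p 0] by simp
qed

lemma cyc_edges_subset_pairs:
  assumes "cyc_edges xs \<subseteq> pairs V"
  shows "set xs \<subseteq> V"
proof
  fix x assume "x \<in> set xs"
  then obtain i where "i < length xs" "x = xs ! i" by (auto simp: in_set_conv_nth)
  then have "cyc_edge xs i \<in> cyc_edges xs" "x \<in> cyc_edge xs i"
    by (auto simp: cyc_edges_def cyc_edge_def)
  then have "cyc_edge xs i \<in> pairs V" "x \<in> cyc_edge xs i" using assms by auto
  then show "x \<in> V" by (auto simp: pairs_def)
qed

lemma card_cyc_edges_le: "card (cyc_edges xs) \<le> length xs"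
  unfolding cyc_edges_def using card_image_le[of "{..<length xs}" "cyc_edge xs"] by simp

definition walk_const :: "nat \<Rightarrow> nat" where
  "walk_const m = (2 * m + 1) * (2 * m) ^ (2 * m)"

text \<open>Each of the four kinds of requirement is a nonnegative penalty that reaches 1 when one
  of them fails. The penalties are averaged together, so a total mean below 1 yields one
  \<open>H\<close> that meets them all. Deleting the edges on short cycles keeps every upper bound
  and weakens the lower bounds by the number of deleted edges.\<close>

lemma host_graph_exists:
  fixes p D a l :: real and m :: nat and V :: "'a set" and s :: "'a set set \<Rightarrow> real"
  assumes V: "finite V" "V \<noteq> {}" and p: "0 \<le> p" "p \<le> 1"
    and D: "D = card V * p" "1 \<le> D" "D ^ m \<le> card V" and m: "0 < m"
    and L: "finite \<L>" "\<And>P. P \<in> \<L> \<Longrightarrow> P \<subseteq> pairs V \<and> l \<le> card P"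
    and U: "finite \<U>" "\<And>P. P \<in> \<U> \<Longrightarrow> P \<subseteq> pairs V"
    and small: "card \<L> * exp (a - p * l / 2) + (\<Sum>P\<in>\<U>. exp (2 * p * card P - s P)) < 1 / 2"
  obtains G where "G \<subseteq> pairs V"
    "\<And>xs. distinct xs \<Longrightarrow> 3 \<le> length xs \<Longrightarrow> length xs \<le> m + 1 \<Longrightarrow> \<not> cyc_edges xs \<subseteq> G"
    "\<And>P. P \<in> \<L> \<Longrightarrow> a < card (G \<inter> P) + real (4 * (m + 1)\<^sup>2) * D ^ (m + 1)"
    "\<And>P. P \<in> \<U> \<Longrightarrow> card (G \<inter> P) < s P"
    "card {xs. set xs \<subseteq> V \<and> length xs = 2 * m \<and> cyc_edges xs \<subseteq> G} \<le> real (4 * walk_const m * card V) * D ^ m"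
proof -
  define E where "E = pairs V"
  have fE: "finite E" using V by (simp add: E_def)
  define \<Omega>1 where "\<Omega>1 = {xs. distinct xs \<and> set xs \<subseteq> V \<and> length xs \<in> {3..m+1}}"
  define \<Omega>2 where "\<Omega>2 = {xs. set xs \<subseteq> V \<and> length xs = 2 * m}"
  have f1: "finite \<Omega>1"
    unfolding \<Omega>1_def by (rule finite_subset[OF _ finite_lists_length_le[OF V(1), of "m + 1"]]) auto
  have f2: "finite \<Omega>2" unfolding \<Omega>2_def by (rule finite_lists_length_eq[OF V(1)])
  \<comment> \<open>Bounds for the expected numbers of short cycles and of closed walks. Dividing by
    4 times these leaves a mean of \<open>1/4\<close> each, next to the \<open>1/2\<close> allowed
    by \<open>small\<close>.\<close>
  define A B where "A = (m + 1) * D ^ (m + 1)" and "B = walk_const m * card V * D ^ m"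
  have "0 < card V" using V by (simp add: card_gt_0_iff)
  have "0 < walk_const m" using m by (simp add: walk_const_def)
  then have Apos: "0 < A" and Bpos: "0 < B"
    using D(2) \<open>0 < card V\<close> by (auto simp: A_def B_def)
  define f1' where "f1' H = (\<Sum>P\<in>\<L>. exp a * (1/2) ^ card (H \<inter> P))" for H
  define f2' where "f2' H = (\<Sum>P\<in>\<U>. exp (- s P) * exp (card (H \<inter> P)))" for H
  define f3' where "f3' H = 1 / (4 * A) * (\<Sum>xs\<in>\<Omega>1. of_bool (cyc_edges xs \<subseteq> H))" for H
  define f4' where "f4' H = 1 / (4 * B) * (\<Sum>xs\<in>\<Omega>2. of_bool (cyc_edges xs \<subseteq> H))" for H
  have "expect p E f1' \<le> (\<Sum>P\<in>\<L>. exp (a - p * l / 2))"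
    unfolding f1'_def expect_sum expect_cmult
  proof (rule sum_mono)
    fix P assume P: "P \<in> \<L>"
    have "expect p E (\<lambda>H. (1/2) ^ card (H \<inter> P)) \<le> exp (- (p * card P / 2))"
      using L(2)[OF P] p by (intro expect_lower_tail[OF fE]) (auto simp: E_def)
    also have "\<dots> \<le> exp (- (p * l / 2))" using L(2)[OF P] p by (auto intro: mult_left_mono)
    finally have "exp a * expect p E (\<lambda>H. (1/2) ^ card (H \<inter> P)) \<le> exp a * exp (- (p * l / 2))"
      by simp
    then show "exp a * expect p E (\<lambda>H. (1/2) ^ card (H \<inter> P)) \<le> exp (a - p * l / 2)"
      by (simp flip: exp_add)
  qed
  moreover have "expect p E f2' \<le> (\<Sum>P\<in>\<U>. exp (2 * p * card P - s P))"
    unfolding f2'_def expect_sum expect_cmult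
  proof (rule sum_mono)
    fix P assume P: "P \<in> \<U>"
    have "expect p E (\<lambda>H. exp (card (H \<inter> P))) \<le> exp (2 * p * card P)"
      using U(2)[OF P] p by (intro expect_upper_tail[OF fE]) (auto simp: E_def)
    then have "exp (- s P) * expect p E (\<lambda>H. exp (card (H \<inter> P))) \<le> exp (- s P) * exp (2 * p * card P)"
      by simp
    then show "exp (- s P) * expect p E (\<lambda>H. exp (card (H \<inter> P))) \<le> exp (2 * p * card P - s P)"
      by (simp flip: exp_add)
  qed
  moreover have "expect p E f3' \<le> 1 / 4"
  proof -
    have "(\<Sum>xs\<in>\<Omega>1. expect p E (\<lambda>H. of_bool (cyc_edges xs \<subseteq> H))) \<le> (\<Sum>xs\<in>\<Omega>1. p ^ card (cyc_edges xs))"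
      using fE p by (intro sum_mono expect_subset_le) auto
    also have "\<dots> \<le> A"
      using sum_short_cycle_weights[OF V(1) p D(1,2), of "m + 1"] by (simp add: \<Omega>1_def A_def)
    finally show ?thesis
      unfolding f3'_def expect_sum expect_cmult using Apos by (simp add: divide_simps)
  qed
  moreover have "expect p E f4' \<le> 1 / 4"
  proof -
    have "(\<Sum>xs\<in>\<Omega>2. expect p E (\<lambda>H. of_bool (cyc_edges xs \<subseteq> H))) \<le> (\<Sum>xs\<in>\<Omega>2. p ^ card (cyc_edges xs))"
      using fE p by (intro sum_mono expect_subset_le) auto
    also have "\<dots> \<le> B"
      using sum_closed_walk_weights[OF V p(1) D] by (simp add: \<Omega>2_def B_def walk_const_def mult_ac)
    finally show ?thesis
      unfolding f4'_def expect_sum expect_cmult using Bpos by (simp add: divide_simps)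
  qed
  ultimately have "expect p E (\<lambda>H. f1' H + (f2' H + (f3' H + f4' H))) < 1"
    using small unfolding expect_add by simp
  then obtain H where H: "H \<subseteq> E" "f1' H + (f2' H + (f3' H + f4' H)) < 1"
    using expect_less_imp_ex[OF fE p] by blast
  have fH: "finite H" using H(1) fE finite_subset by blast
  have "0 \<le> f1' H" "0 \<le> f2' H" "0 \<le> f3' H" "0 \<le> f4' H"
    using Apos Bpos by (auto simp: f1'_def f2'_def f3'_def f4'_def intro!: sum_nonneg divide_nonneg_pos)
  with H(2) have lt: "f1' H < 1" "f2' H < 1" "f3' H < 1" "f4' H < 1" by linarith+
  define R where "R = {xs \<in> \<Omega>1. cyc_edges xs \<subseteq> H}"
  have fR: "finite R" using f1 by (simp add: R_def)
  \<comment> \<open>Deleting all edges of a cycle instead of one avoids a choice and costs a factor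
    of at most \<open>m + 1\<close>.\<close>
  define G where "G = H - (\<Union>xs\<in>R. cyc_edges xs)"
  have GH: "G \<subseteq> H" by (auto simp: G_def)
  have cR: "card R < 4 * A"
    using lt(3) f1 Apos by (simp add: f3'_def R_def divide_simps Int_def split: if_splits)
  have del: "card (\<Union>xs\<in>R. cyc_edges xs) \<le> real (4 * (m + 1)\<^sup>2) * D ^ (m + 1)"
  proof -
    have "card (\<Union>xs\<in>R. cyc_edges xs) \<le> (\<Sum>xs\<in>R. card (cyc_edges xs))"
      using fR by (rule card_UN_le)
    also have "\<dots> \<le> (\<Sum>xs\<in>R. m + 1)"
      using card_cyc_edges_le by (intro sum_mono) (auto simp: R_def \<Omega>1_def intro: order_trans)
    also have "\<dots> = card R * (m + 1)" by simp
    finally have "real (card (\<Union>xs\<in>R. cyc_edges xs)) \<le> real (card R) * (m + 1)"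
      by (metis of_nat_mono of_nat_mult)
    also have "\<dots> \<le> 4 * A * (m + 1)" using cR by (intro mult_right_mono) auto
    finally show ?thesis by (simp add: A_def power2_eq_square algebra_simps)
  qed
  show ?thesis
  proof
    show "G \<subseteq> pairs V" using GH H by (auto simp: E_def)
  next
    fix xs :: "'a list" assume xs: "distinct xs" "3 \<le> length xs" "length xs \<le> m + 1"
    show "\<not> cyc_edges xs \<subseteq> G"
    proof
      assume sub: "cyc_edges xs \<subseteq> G"
      then have "set xs \<subseteq> V" using GH H(1) by (intro cyc_edges_subset_pairs) (auto simp: E_def)
      then have "xs \<in> R" using xs sub GH by (auto simp: R_def \<Omega>1_def)
      moreover have "cyc_edge xs 0 \<in> cyc_edges xs"
        unfolding cyc_edges_def using xs(2) by (intro imageI) auto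
      ultimately show False using sub by (auto simp: G_def)
    qed
  next
    fix P assume P: "P \<in> \<L>"
    have "exp a * (1/2) ^ card (H \<inter> P) \<le> f1' H"
      unfolding f1'_def using P L by (intro member_le_sum) auto
    then have "exp a * (1/2) ^ card (H \<inter> P) < 1" using lt by linarith
    then have "exp a < 2 ^ card (H \<inter> P)" by (simp add: power_one_over divide_simps)
    also have "(2::real) ^ card (H \<inter> P) \<le> exp 1 ^ card (H \<inter> P)"
      using exp_ge_add_one_self[of 1] by (intro power_mono) auto
    finally have "a < card (H \<inter> P)" by (simp flip: exp_of_nat_mult)
    moreover have "card (H \<inter> P) \<le> card (G \<inter> P) + card (\<Union>xs\<in>R. cyc_edges xs)"
    proof -
      have "card (H \<inter> P) \<le> card ((G \<inter> P) \<union> (\<Union>xs\<in>R. cyc_edges xs))"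
        using fH fR GH by (intro card_mono) (auto simp: G_def)
      then show ?thesis using card_Un_le order_trans by blast
    qed
    ultimately show "a < card (G \<inter> P) + real (4 * (m + 1)\<^sup>2) * D ^ (m + 1)" using del by linarith
  next
    fix P assume P: "P \<in> \<U>"
    have "exp (- s P) * exp (card (H \<inter> P)) \<le> f2' H"
      unfolding f2'_def using P U by (intro member_le_sum) auto
    also note lt(2)
    finally have "exp (card (H \<inter> P) - s P) < 1" by (simp flip: exp_add)
    then have "card (H \<inter> P) < s P" by simp
    moreover have "card (G \<inter> P) \<le> card (H \<inter> P)" using fH GH by (intro card_mono) auto
    ultimately show "card (G \<inter> P) < s P" by linarith
  next
    have "card {xs \<in> \<Omega>2. cyc_edges xs \<subseteq> H} < 4 * B"
      using lt(4) f2 Bpos by (simp add: f4'_def divide_simps Int_def split: if_splits)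
    moreover have "card {xs. set xs \<subseteq> V \<and> length xs = 2 * m \<and> cyc_edges xs \<subseteq> G} \<le> card {xs \<in> \<Omega>2. cyc_edges xs \<subseteq> H}"
      using GH by (intro card_mono finite_subset[OF _ f2]) (auto simp: \<Omega>2_def)
    ultimately show "card {xs. set xs \<subseteq> V \<and> length xs = 2 * m \<and> cyc_edges xs \<subseteq> G} \<le> real (4 * walk_const m * card V) * D ^ m"
      by (simp add: B_def mult_ac)
  qed
qed

subsection \<open>Choice of parameters\<close>

lemma card_subsets_le:
  assumes "finite S"
  shows "card {F. F \<subseteq> S \<and> card F \<le> a} \<le> (card S + 1) ^ a"
proof -
  have "{F. F \<subseteq> S \<and> card F \<le> a} = (\<Union>j\<in>{..a}. {F. F \<subseteq> S \<and> card F = j})" by auto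
  then have "card {F. F \<subseteq> S \<and> card F \<le> a} \<le> (\<Sum>j\<le>a. card {F. F \<subseteq> S \<and> card F = j})"
    by (simp add: card_UN_le)
  also have "\<dots> \<le> (\<Sum>j\<le>a. (a choose j) * card S ^ j)"
  proof (rule sum_mono)
    fix j assume "j \<in> {..a}"
    have "card {F. F \<subseteq> S \<and> card F = j} = card S choose j" by (rule n_subsets[OF assms])
    also have "\<dots> \<le> card S ^ j"
      by (cases "j \<le> card S") (simp_all add: binomial_le_pow binomial_eq_0)
    also have "\<dots> \<le> (a choose j) * card S ^ j"
      using \<open>j \<in> {..a}\<close> zero_less_binomial[of j a] by (simp add: Suc_le_eq del: zero_less_binomial_iff)
    finally show "card {F. F \<subseteq> S \<and> card F = j} \<le> (a choose j) * card S ^ j" .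
  qed
  also have "\<dots> = (card S + 1) ^ a"
    using binomial_ring[of "card S" 1 a] by simp
  finally show ?thesis .
qed

lemma card_pairs: "finite V \<Longrightarrow> card (pairs V) = card V choose 2"
  by (simp add: pairs_def n_subsets)

text \<open>The exponent of \<open>B\<close> in the number of vertices \<open>D ^ m * b ^ 3\<close>,
  where \<open>D = b ^ (6 * m + 12)\<close>; the factor 2 is due to
  \<open>b = B\<^sup>2\<close>.\<close>

definition expo :: "nat \<Rightarrow> nat" where
  "expo m = 2 * (m * (6 * m + 12) + 3)"

text \<open>The sum dominates each of the three quantities that \<open>B\<close> has to beat, and
  1000 absorbs all numerical constants.\<close>

definition base_factor :: "nat \<Rightarrow> nat" where
  "base_factor m = 1000 * (expo m + walk_const m + (m + 1)\<^sup>2)"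

text \<open>The host graph has \<open>n\<close> vertices and average degree about \<open>D\<close>, where \<open>D ^ m = n / b ^ 3\<close> makes
  the cycles of length at most \<open>m + 1\<close> rare and \<open>D ^ (m + 1) \<ge> n * b ^ (6 * m)\<close> leaves room for
  fingerprints of size \<open>t = D / b\<^sup>2 = n / g\<close> at every vertex. Taking \<open>b\<close> to be the square of \<open>B\<close>
  makes \<open>ln n\<close> at most a constant times \<open>B\<close>.\<close>

locale host_parameters =
  fixes m r B :: nat
  assumes m_pos: "1 \<le> m" and r_pos: "1 \<le> r" and B_large: "base_factor m * r \<le> B"
begin

definition b :: nat where "b = B\<^sup>2"
text \<open>The exponent is the smallest one for which \<open>container_sparse\<close> works. With
  degrees \<open>d = D / b ^ 3\<close> it asks for
  \<open>b ^ 7 * g * D ^ m \<le> d ^ (2 * m)\<close>, and since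
  \<open>g * D ^ m = D ^ (2 * m - 1) * b ^ 5\<close> this means
  \<open>b ^ (6 * m + 12) \<le> D\<close>.\<close>

definition D :: nat where "D = b ^ (6 * m + 12)"
text \<open>The factor \<open>b ^ 3\<close> makes \<open>D ^ (m + 1)\<close>, the order of the
  number of deleted edges, smaller than \<open>n * t\<close> by a factor \<open>b\<close>; see
  \<open>D_power_Suc\<close>.\<close>

definition n :: nat where "n = D ^ m * b ^ 3"
definition g :: nat where "g = D ^ (m - 1) * b ^ 5"
definition t :: nat where "t = b ^ (6 * m + 10)"
definition V :: "nat set" where "V = {..<n}"

lemma finite_V [simp]: "finite V" and card_V [simp]: "card V = n"
  by (simp_all add: V_def)

lemma B_ge: "1000 * r \<le> B" "1000 * expo m * r \<le> B" "1000 * walk_const m * r \<le> B"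
  "1000 * (m + 1)\<^sup>2 * r \<le> B" "1000 \<le> B"
proof -
  have *: "1000 * x * r \<le> B" if "x \<le> expo m + walk_const m + (m + 1)\<^sup>2" for x
  proof -
    have "1000 * x * r \<le> base_factor m * r"
      unfolding base_factor_def by (intro mult_right_mono mult_left_mono that) auto
    then show ?thesis using B_large by linarith
  qed
  moreover have "1 \<le> expo m + walk_const m + (m + 1)\<^sup>2" by (simp add: power2_eq_square)
  ultimately show "1000 * r \<le> B" by (metis mult.right_neutral)
  from *[of "expo m"] *[of "walk_const m"] *[of "(m + 1)\<^sup>2"]
  show "1000 * expo m * r \<le> B" "1000 * walk_const m * r \<le> B" "1000 * (m + 1)\<^sup>2 * r \<le> B"
    by auto
  show "1000 \<le> B" using \<open>1000 * r \<le> B\<close> r_pos by linarith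
qed

lemma B_le_b: "B \<le> b"
  using B_ge(5) by (simp add: b_def power2_eq_square)

lemma b_pos: "0 < b" using B_le_b B_ge(5) by linarith

lemma D_eq: "D = t * b\<^sup>2"
  by (simp only: D_def t_def power_add[symmetric] add.assoc) simp

lemma n_eq: "n = g * t"
proof -
  have "D ^ m = D ^ (m - 1) * D" using m_pos by (cases m) auto
  then have "n = D ^ (m - 1) * b ^ (6 * m + 15)"
    by (simp only: n_def D_def mult.assoc power_add[symmetric] add.assoc) simp
  also have "\<dots> = g * t"
    by (simp only: g_def t_def mult.assoc power_add[symmetric]) (simp add: algebra_simps)
  finally show ?thesis .
qed

lemma D_pos: "0 < D" and n_pos: "0 < n" and t_pos: "0 < t" and g_pos: "0 < g"
  using b_pos by (simp_all add: D_def n_def t_def g_def)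

lemma b_le_t: "b \<le> t"
  unfolding t_def using b_pos by (intro self_le_power) auto

lemma n_power: "n = B ^ expo m"
  by (simp add: n_def D_def b_def expo_def flip: power_mult power_add) (simp add: algebra_simps)

lemma D_power_Suc: "D ^ (m + 1) * b = n * t"
  by (simp add: n_def D_eq power2_eq_square power3_eq_cube)

lemma D_le_n: "D \<le> n"
proof -
  have "D \<le> D ^ m" using D_pos m_pos by (intro self_le_power) auto
  also have "\<dots> \<le> n" using b_pos by (simp add: n_def)
  finally show ?thesis .
qed

lemma n_large: "1000 \<le> n" "1000 \<le> D" "1000 \<le> t"
proof -
  show t: "1000 \<le> t" using b_le_t B_le_b B_ge(5) by linarith
  have "t \<le> D" using b_pos by (simp add: D_eq)
  with t show "1000 \<le> D" by linarith
  then show "1000 \<le> n" using D_le_n by linarith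
qed

text \<open>The crude bound \<open>B \<le> exp B\<close> suffices: as \<open>b = B\<^sup>2\<close>,
  a logarithm of order \<open>B\<close> costs only a square root of \<open>b\<close>.\<close>

lemma n_le_exp: "real n \<le> exp (expo m * B)"
proof -
  have "real B ^ expo m \<le> exp B ^ expo m"
    using exp_ge_add_one_self[of "real B"] by (intro power_mono) linarith+
  then show ?thesis by (simp add: n_power flip: exp_of_nat_mult)
qed

section \<open>Number of choices for the sparse graphs and the fingerprints\<close>

definition few_edges :: "nat \<Rightarrow> nat set set set" where
  "few_edges a = {F. F \<subseteq> pairs V \<and> card F \<le> a}"

definition fingerprints :: "nat set set" where
  "fingerprints = {T. T \<subseteq> V \<and> card T \<le> t}"

lemma finite_few_edges [simp]: "finite (few_edges a)"
  and finite_fingerprints [simp]: "finite fingerprints"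
  unfolding few_edges_def fingerprints_def
  by (auto intro: finite_subset[of _ "Pow (pairs V)"] finite_subset[of _ "Pow V"])

lemma Suc_power_le_exp:
  assumes "N + 1 \<le> n\<^sup>2"
  shows "real ((N + 1) ^ a) \<le> exp (2 * expo m * B * a)"
proof -
  have "real ((N + 1) ^ a) \<le> real (n\<^sup>2) ^ a"
    using assms by (metis of_nat_le_iff of_nat_power power_mono zero_le)
  also have "\<dots> \<le> ((exp (expo m * B))\<^sup>2) ^ a"
    using n_le_exp by (intro power_mono) (auto intro: power_mono)
  also have "\<dots> = exp (2 * expo m * B * a)"
    by (simp flip: exp_of_nat_mult add: mult_ac)
  finally show ?thesis .
qed

lemma card_few_edges: "card (few_edges a) \<le> exp (2 * expo m * B * a)"
proof -
  have "card (pairs V) + 1 \<le> n\<^sup>2"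
  proof -
    have "n choose 2 \<le> n * (n - 1)" by (simp add: choose_two)
    also have "\<dots> + n = n\<^sup>2" using n_pos by (cases n) (auto simp: power2_eq_square)
    finally show ?thesis using n_large by (simp add: card_pairs)
  qed
  moreover have "card (few_edges a) \<le> (card (pairs V) + 1) ^ a"
    unfolding few_edges_def by (rule card_subsets_le) simp
  ultimately show ?thesis using Suc_power_le_exp[of "card (pairs V)" a] by (meson of_nat_mono order_trans)
qed

lemma card_fingerprints: "card fingerprints \<le> exp (2 * expo m * B * t)"
proof -
  have "n + 1 \<le> n\<^sup>2" using n_large(1) by (cases n) (auto simp: power2_eq_square)
  moreover have "card fingerprints \<le> (n + 1) ^ t"
    unfolding fingerprints_def using card_subsets_le[OF finite_V, of t] by simp
  ultimately show ?thesis using Suc_power_le_exp[of n t] by (meson of_nat_mono order_trans)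
qed

abbreviation "cont \<equiv> containers V m g"

lemma colour_class_containers:
  assumes "F \<subseteq> C" "C \<subseteq> pairs V"
    and nocyc: "\<And>xs. distinct xs \<Longrightarrow> 3 \<le> length xs \<Longrightarrow> length xs \<le> m + 2 \<Longrightarrow> \<not> cyc_edges xs \<subseteq> C"
  obtains T where "\<And>v. T v \<in> fingerprints"
    "\<And>v x. {v, x} \<in> C - F \<Longrightarrow> x \<in> T v \<union> cont F (T v)"
    "\<And>v. cont F (T v) \<subseteq> V"
    "\<And>v x. x \<in> cont F (T v) \<Longrightarrow> card {y \<in> cont F (T v). x \<noteq> y \<and> nwalks V F m x y \<noteq> 0} < g"
proof -
  have "\<forall>v. \<exists>T\<subseteq>V. card T * g \<le> card V \<and> (\<forall>x. {v, x} \<in> C - F \<longrightarrow> x \<in> T \<union> cont F T) \<and>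
    cont F T \<subseteq> V \<and> (\<forall>x\<in>cont F T. card {y \<in> cont F T. x \<noteq> y \<and> nwalks V F m x y \<noteq> 0} < g)"
    by (intro allI neighbourhood_container[OF finite_V assms])
  from choice[OF this] obtain T where T: "\<forall>v. T v \<subseteq> V \<and> card (T v) * g \<le> card V \<and>
    (\<forall>x. {v, x} \<in> C - F \<longrightarrow> x \<in> T v \<union> cont F (T v)) \<and> cont F (T v) \<subseteq> V \<and>
    (\<forall>x\<in>cont F (T v). card {y \<in> cont F (T v). x \<noteq> y \<and> nwalks V F m x y \<noteq> 0} < g)" ..
  show ?thesis
  proof
    \<comment> \<open>By \<open>n = g * t\<close>, the bound \<open>card (T v) * g \<le> n\<close>
      says that \<open>T v\<close> has at most \<open>t\<close> elements.\<close>
    show "T v \<in> fingerprints" for v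
      using T[THEN spec, of v] g_pos by (simp add: fingerprints_def n_eq mult.commute[of g])
    show "x \<in> T v \<union> cont F (T v)" if "{v, x} \<in> C - F" for v x
      using T[THEN spec, of v] that by blast
    show "cont F (T v) \<subseteq> V" for v
      using T[THEN spec, of v] by blast
    show "card {y \<in> cont F (T v). x \<noteq> y \<and> nwalks V F m x y \<noteq> 0} < g" if "x \<in> cont F (T v)" for v x
      using T[THEN spec, of v] that by blast
  qed
qed

lemma sparse_walks_bound:
  assumes "K \<subseteq> V" "X \<subseteq> K" "F \<subseteq> G"
    and deg: "\<And>x. x \<in> K \<Longrightarrow> card {y \<in> K. x \<noteq> y \<and> nwalks V F m x y \<noteq> 0} < g"
    and closed: "card {xs. set xs \<subseteq> V \<and> length xs = 2 * m \<and> cyc_edges xs \<subseteq> G}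
      \<le> real (4 * walk_const m * card V) * real D ^ m"
  shows "(\<Sum>x\<in>X. \<Sum>y\<in>X. nwalks V F m x y)\<^sup>2 \<le> real (4 * walk_const m * g * D ^ m) * real n ^ 2"
proof -
  have "finite K" using assms(1) finite_V finite_subset by blast
  have "card {y \<in> X. x \<noteq> y \<and> nwalks V F m x y \<noteq> 0} < g" if "x \<in> X" for x
  proof -
    have "card {y \<in> X. x \<noteq> y \<and> nwalks V F m x y \<noteq> 0} \<le> card {y \<in> K. x \<noteq> y \<and> nwalks V F m x y \<noteq> 0}"
      using \<open>finite K\<close> assms(2) by (intro card_mono) auto
    then show ?thesis using deg[of x] that assms(2) by force
  qed
  then have "(\<Sum>x\<in>X. \<Sum>y\<in>X. nwalks V F m x y)\<^sup>2 \<le> card V * g *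
      card {xs. set xs \<subseteq> V \<and> length xs = 2 * m \<and> cyc_edges xs \<subseteq> G}"
    using assms m_pos by (intro nwalks_pairs_bound) auto
  also have "\<dots> = real (n * g) * real (card {xs. set xs \<subseteq> V \<and> length xs = 2 * m \<and> cyc_edges xs \<subseteq> G})"
    by simp
  also have "\<dots> \<le> real (n * g) * (real (4 * walk_const m * card V) * real D ^ m)"
    by (intro mult_left_mono closed) simp
  also have "\<dots> = real (4 * walk_const m * g * D ^ m) * real n ^ 2"
    by (simp add: power2_eq_square)
  finally show ?thesis .
qed

lemma walk_const_less_b: "4 * walk_const m < b"
proof -
  have "1000 * walk_const m * 1 \<le> 1000 * walk_const m * r"
    using r_pos by (intro mult_le_mono2)
  then have "1000 * walk_const m \<le> b" using B_ge(3) B_le_b by linarith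
  then show ?thesis using b_pos by linarith
qed

text \<open>With everything a power of \<open>b\<close>, the final walk estimates reduce to
  comparing exponents. The subtraction is genuine because \<open>1 \<le> m\<close>.\<close>

lemma g_D_power: "g * D ^ m = b ^ (12 * m\<^sup>2 + 18 * m - 7)"
proof -
  have "g * D ^ m = b ^ (5 + (6 * m + 12) * (m - 1) + (6 * m + 12) * m)"
    by (simp add: g_def D_def flip: power_mult power_add) (simp add: add_ac)
  also have "5 + (6 * m + 12) * (m - 1) + (6 * m + 12) * m = 12 * m\<^sup>2 + 18 * m - 7"
    using m_pos by (cases m) (auto simp: power2_eq_square algebra_simps)
  finally show ?thesis .
qed

end

subsection \<open>Even cycles\<close>

definition cycle_ramsey_host :: "'a set \<Rightarrow> nat \<Rightarrow> nat \<Rightarrow> 'a set set \<Rightarrow> bool" where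
  "cycle_ramsey_host V k r G \<longleftrightarrow> G \<subseteq> pairs V \<and>
    (\<forall>xs. distinct xs \<and> 3 \<le> length xs \<and> length xs < k \<longrightarrow> \<not> cyc_edges xs \<subseteq> G) \<and>
    (\<forall>c. (\<forall>e\<in>G. c e < r) \<longrightarrow>
      (\<exists>i<r. \<exists>xs. distinct xs \<and> length xs = k \<and> cyc_edges xs \<subseteq> {e \<in> G. c e = i}))"

lemma card_doubletons_le:
  assumes "finite X" "\<And>v. v \<in> X \<Longrightarrow> finite (Y v) \<and> card (Y v) \<le> k"
  shows "card {{v, x} | v x. v \<in> X \<and> x \<in> Y v} \<le> card X * k"
proof -
  have eq: "{{v, x} | v x. v \<in> X \<and> x \<in> Y v} = (\<Union>v\<in>X. (\<lambda>x. {v, x}) ` Y v)" by auto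
  have "card (\<Union>v\<in>X. (\<lambda>x. {v, x}) ` Y v) \<le> (\<Sum>v\<in>X. card ((\<lambda>x. {v, x}) ` Y v))"
    using assms(1) by (rule card_UN_le)
  also have "\<dots> \<le> (\<Sum>v\<in>X. k)"
    using assms(2) by (intro sum_mono order_trans[OF card_image_le]) auto
  finally show ?thesis unfolding eq by simp
qed

lemma finite_doubletons:
  assumes "finite X" "\<And>v. v \<in> X \<Longrightarrow> finite (Y v)"
  shows "finite {{v, x} | v x. v \<in> X \<and> x \<in> Y v}"
proof -
  have "{{v, x} | v x. v \<in> X \<and> x \<in> Y v} = (\<Union>v\<in>X. (\<lambda>x. {v, x}) ` Y v)" by auto
  then show ?thesis using assms by auto
qed

lemma exp_le_quarter: "(x::real) \<le> -4 \<Longrightarrow> exp x < 1 / 4"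
proof -
  assume "x \<le> -4"
  then have "exp x \<le> exp (-4)" by simp
  moreover have "(4::real) < exp 4" using exp_ge_add_one_self[of "4::real"] by linarith
  then have "exp (-4) < (1 / 4 :: real)" by (simp add: exp_minus divide_simps)
  ultimately show ?thesis by linarith
qed

context host_parameters
begin

text \<open>The unit for counting edges: it bounds the number of all fingerprint edges of one
  colour, while the host has \<open>U * B ^ 4\<close> edges up to a constant factor.\<close>

definition U :: real where "U = real (n * t)"

lemma nD_eq: "real n * real D = U * real B ^ 4"
  by (simp add: U_def D_eq b_def flip: power_mult)

lemma U_ge: "real n \<le> U" "1000 \<le> U" "0 < U"
proof -
  have "real n * 1 \<le> real n * real t" using t_pos by (intro mult_left_mono) auto
  then show "real n \<le> U" by (simp add: U_def)
  then show "1000 \<le> U" using n_large(1) by linarith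
  then show "0 < U" by linarith
qed

lemma B_ge_real: "1000 * real r \<le> B" "1000 * real (expo m) * r \<le> B"
  "1000 * real ((m + 1)\<^sup>2) * r \<le> B" "1000 \<le> real B" "1 \<le> real r" "6 \<le> real (expo m)"
proof -
  show "1000 * real r \<le> B" "1000 * real (expo m) * r \<le> B" "1000 * real ((m + 1)\<^sup>2) * r \<le> B"
    using of_nat_mono[OF B_ge(1), where ?'a = real] of_nat_mono[OF B_ge(2), where ?'a = real]
      of_nat_mono[OF B_ge(4), where ?'a = real] by simp_all
  show "1000 \<le> real B" "1 \<le> real r" using B_ge(5) r_pos by auto
  show "6 \<le> real (expo m)" by (simp add: expo_def)
qed

lemma deleted_le: "real (4 * (m + 1)\<^sup>2) * real D ^ (m + 1) \<le> U"
proof -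
  have "real (4 * (m + 1)\<^sup>2) \<le> real b"
  proof -
    have "1000 * real ((m + 1)\<^sup>2) * 1 \<le> 1000 * real ((m + 1)\<^sup>2) * r"
      using B_ge_real(5) by (intro mult_left_mono) auto
    moreover have "real (4 * (m + 1)\<^sup>2) = 4 * real ((m + 1)\<^sup>2)" by (simp only: of_nat_mult of_nat_numeral)
    moreover have "0 \<le> real ((m + 1)\<^sup>2)" by (rule of_nat_0_le_iff)
    ultimately have "real (4 * (m + 1)\<^sup>2) \<le> B" using B_ge_real(3) by linarith
    then show ?thesis using B_le_b by linarith
  qed
  then have "real (4 * (m + 1)\<^sup>2) * real D ^ (m + 1) \<le> real b * real D ^ (m + 1)"
    by (intro mult_right_mono) auto
  also have "\<dots> = U"
    using arg_cong[OF D_power_Suc, of real] by (simp add: U_def mult_ac)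
  finally show ?thesis .
qed

definition p :: real where "p = real D / real n"

lemma p: "0 \<le> p" "p \<le> 1" "real D = card V * p" "1 \<le> real D" "real D ^ m \<le> card V"
proof -
  show "0 \<le> p" "p \<le> 1" "real D = card V * p"
    using n_pos D_le_n by (auto simp: p_def divide_simps)
  show "1 \<le> real D" using D_pos by linarith
  have "D ^ m \<le> n" using b_pos by (simp add: n_def)
  then have "real (D ^ m) \<le> real n" by (rule of_nat_mono)
  then show "real D ^ m \<le> card V" by simp
qed

lemma V_nonempty: "V \<noteq> {}"
  using n_pos by (auto simp: V_def)

lemma two_power_le_exp: "(2::real) ^ j \<le> exp (real j)"
proof -
  have "(2::real) ^ j \<le> exp 1 ^ j"
    using exp_ge_add_one_self[of "1::real"] by (intro power_mono) auto
  then show ?thesis by (simp flip: exp_of_nat_mult)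
qed

text \<open>The pairs inside \<open>W\<close> that the containers permit. They are determined by
  \<open>W\<close>, \<open>F\<close> and \<open>T\<close>, hence known before the random graph is
  drawn.\<close>

definition covered :: "nat set \<Rightarrow> nat set set \<Rightarrow> (nat \<Rightarrow> nat set) \<Rightarrow> nat set set" where
  "covered W F T = {{v, x} | v x. v \<in> W \<and> x \<in> cont F (T v) \<inter> W - {v}}"

lemma even_host_graph:
  obtains G where "G \<subseteq> pairs V"
    "\<And>xs. distinct xs \<Longrightarrow> 3 \<le> length xs \<Longrightarrow> length xs \<le> m + 1 \<Longrightarrow> \<not> cyc_edges xs \<subseteq> G"
    "U * real B ^ 4 / 16 \<le> card G"
    "\<And>W F T. W \<subseteq> V \<Longrightarrow> F \<in> few_edges (n * t) \<Longrightarrow> (\<And>v. T v \<in> fingerprints) \<Longrightarrow>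
      b\<^sup>2 * card (covered W F T) \<le> n\<^sup>2 \<Longrightarrow> card (G \<inter> covered W F T) < U * real B ^ 4 / (64 * r)"
    "card {xs. set xs \<subseteq> V \<and> length xs = 2 * m \<and> cyc_edges xs \<subseteq> G} \<le> real (4 * walk_const m * card V) * real D ^ m"
proof -
  define I where "I = Pow V \<times> few_edges (n * t) \<times> (V \<rightarrow>\<^sub>E fingerprints)"
  define \<U> where "\<U> = {P \<in> (\<lambda>(W, F, T). covered W F T) ` I. b\<^sup>2 * card P \<le> n\<^sup>2}"
  define s where "s = U * real B ^ 4 / (64 * r)"
  define a where "a = U * real B ^ 4 / 8"
  define l where "l = real (card (pairs V))"
  have "finite I" unfolding I_def by (intro finite_cartesian_product finite_PiE) auto
  then have finU: "finite \<U>" by (simp add: \<U>_def)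
  have sub: "covered W F T \<subseteq> pairs V" if "W \<subseteq> V" for W F T
    using that by (auto simp: covered_def)
  have subU: "P \<subseteq> pairs V" if P: "P \<in> \<U>" for P
  proof -
    obtain W F T where "P = covered W F T" "W \<subseteq> V" using P by (auto simp: \<U>_def I_def)
    then show ?thesis using sub by simp
  qed
  have "card \<U> \<le> card ((\<lambda>(W, F, T). covered W F T) ` I)"
    unfolding \<U>_def using \<open>finite I\<close> by (intro card_mono) auto
  also have "\<dots> \<le> card I" using \<open>finite I\<close> by (rule card_image_le)
  also have "real (card I) = 2 ^ n * (real (card (few_edges (n * t))) * real (card fingerprints) ^ n)"
    by (simp add: I_def card_cartesian_product card_Pow card_PiE)
  also have "\<dots> \<le> exp n * (exp (2 * expo m * B * (n * t)) * exp (2 * expo m * B * t) ^ n)"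
    using card_few_edges[of "n * t"] card_fingerprints
    by (intro mult_mono power_mono two_power_le_exp) (auto intro!: mult_nonneg_nonneg)
  \<comment> \<open>The choice of \<open>F\<close> and the choice of \<open>n\<close> fingerprints
    contribute \<open>2 * expo m * B * U\<close> each.\<close>
  also have "\<dots> = exp (n + 4 * expo m * B * U)"
    by (simp add: U_def algebra_simps flip: exp_add exp_of_nat_mult)
  finally have cU: "real (card \<U>) \<le> exp (n + 4 * expo m * B * U)" by simp
  have big: "4 * real (expo m) * real B + 4 \<le> real B ^ 4 / (64 * real r)"
  proof -
    have "64 * real r * (4 * real (expo m) * real B + 4) \<le> real B * real B ^ 3"
    proof (rule mult_mono)
      show "64 * real r \<le> B" using B_ge_real by linarith
      have "4 * real (expo m) * B + 4 \<le> 1000 * real (expo m) * real r * real B"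
      proof -
        have "4 * real (expo m) * B + 4 \<le> 1000 * real (expo m) * 1 * real B"
          using B_ge_real(4,6) mult_mono[of 6 "real (expo m)" 1000 "real B"] by (simp add: algebra_simps)
        also have "\<dots> \<le> 1000 * real (expo m) * real r * real B"
          using B_ge_real(5) by (intro mult_right_mono mult_left_mono) auto
        finally show ?thesis .
      qed
      also have "\<dots> \<le> real B * real B" using B_ge_real(2) by (intro mult_right_mono) auto
      also have "\<dots> \<le> real B ^ 3" using B_ge_real(4) by (simp add: power3_eq_cube)
      finally show "4 * real (expo m) * B + 4 \<le> real B ^ 3" .
    qed auto
    then show ?thesis using B_ge_real(5) by (simp add: divide_simps power_eq_if mult_ac)
  qed
  have "(\<Sum>P\<in>\<U>. exp (2 * p * card P - s)) \<le> (\<Sum>P\<in>\<U>. exp (2 * U - s))"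
  proof (rule sum_mono)
    fix P assume "P \<in> \<U>"
    then have "real (b\<^sup>2 * card P) \<le> real (n\<^sup>2)" by (intro of_nat_mono) (simp add: \<U>_def)
    \<comment> \<open>The size condition brings the expected number of edges in \<open>P\<close>
      down to \<open>U\<close>, far below the threshold \<open>s\<close>.\<close>
    then have "real D / real n * card P \<le> real n * t"
      using n_pos b_pos mult_left_mono[of "real (b\<^sup>2 * card P)" "real (n\<^sup>2)" "real t"]
      by (simp add: D_eq divide_simps power2_eq_square mult_ac)
    then show "exp (2 * p * card P - s) \<le> exp (2 * U - s)"
      by (simp add: p_def U_def)
  qed
  also have "\<dots> = card \<U> * exp (2 * U - s)" by simp
  also have "\<dots> \<le> exp (n + 4 * expo m * B * U) * exp (2 * U - s)"
    using cU by (intro mult_right_mono) auto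
  also have "\<dots> = exp (n + 4 * expo m * B * U + 2 * U - s)" by (simp flip: exp_add)
  also have "\<dots> < 1 / 4"
  proof (rule exp_le_quarter)
    have "U * (4 * real (expo m) * real B + 4) \<le> s"
      unfolding s_def using mult_left_mono[OF big, of U] U_ge by simp
    then show "n + 4 * expo m * B * U + 2 * U - s \<le> -4"
      using U_ge by (simp add: algebra_simps)
  qed
  finally have upper: "(\<Sum>P\<in>\<U>. exp (2 * p * card P - s)) < 1 / 4" .
  have l_eq: "l = real n * (real n - 1) / 2"
    using n_pos by (simp add: l_def card_pairs choose_two of_nat_diff real_of_nat_div)
  have "a - p * l / 2 = - (real D * (real n - 2) / 8)"
    unfolding a_def l_eq p_def nD_eq[symmetric] using n_pos by (simp add: field_simps)
  moreover have "4 * 8 \<le> real D * (real n - 2)"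
    using n_large by (intro mult_mono) auto
  ultimately have lower: "real (card {pairs V}) * exp (a - p * l / 2) < 1 / 4"
    using exp_le_quarter[of "a - p * l / 2"] by simp
  obtain G where G: "G \<subseteq> pairs V"
    "\<And>xs. distinct xs \<Longrightarrow> 3 \<le> length xs \<Longrightarrow> length xs \<le> m + 1 \<Longrightarrow> \<not> cyc_edges xs \<subseteq> G"
    "\<And>P. P \<in> {pairs V} \<Longrightarrow> a < card (G \<inter> P) + real (4 * (m + 1)\<^sup>2) * real D ^ (m + 1)"
    "\<And>P. P \<in> \<U> \<Longrightarrow> card (G \<inter> P) < s"
    "card {xs. set xs \<subseteq> V \<and> length xs = 2 * m \<and> cyc_edges xs \<subseteq> G} \<le> real (4 * walk_const m * card V) * real D ^ m"
  proof (rule host_graph_exists[OF finite_V V_nonempty p, of "{pairs V}" l \<U> a "\<lambda>_. s"])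
    show "real (card {pairs V}) * exp (a - p * l / 2) + (\<Sum>P\<in>\<U>. exp (2 * p * real (card P) - s)) < 1 / 2"
      using upper lower by linarith
  qed (use m_pos subU finU in \<open>auto simp: l_def\<close>)
  show ?thesis
  proof
    have "G \<inter> pairs V = G" using G(1) by blast
    then have "a < card G + U" using G(3)[of "pairs V"] deleted_le by simp
    moreover have "U \<le> U * real B ^ 4 / 16"
    proof -
      have "16 \<le> real B ^ 4" using B_ge_real(4) power_mono[of 2 "real B" 4] by simp
      then have "U * 16 \<le> U * real B ^ 4" using U_ge by (intro mult_left_mono) auto
      then show ?thesis by simp
    qed
    ultimately show "U * real B ^ 4 / 16 \<le> card G" by (simp add: a_def)
  next
    fix W F T assume WFT: "W \<subseteq> V" "F \<in> few_edges (n * t)" "\<And>v. T v \<in> fingerprints"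
      "b\<^sup>2 * card (covered W F T) \<le> n\<^sup>2"
    \<comment> \<open>Only finitely many \<open>T\<close> are counted by fixing the values outside
      \<open>V\<close>; \<open>covered\<close> reads \<open>T\<close> on \<open>W\<close>
      only.\<close>
    have "covered W F (restrict T V) = covered W F T"
      unfolding covered_def using WFT(1) by (auto 0 4 simp: subset_iff)
    moreover have "(W, F, restrict T V) \<in> I" using WFT by (auto simp: I_def)
    ultimately have "covered W F T \<in> (\<lambda>(W, F, T). covered W F T) ` I"
      by (intro image_eqI[of _ _ "(W, F, restrict T V)"]) auto
    then have "covered W F T \<in> \<U>" using WFT(4) by (simp add: \<U>_def)
    then show "card (G \<inter> covered W F T) < U * real B ^ 4 / (64 * r)" using G(4) by (simp add: s_def)
  qed (use G in auto)
qed

text \<open>In exponents of \<open>b\<close>, this compares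
  \<open>12 * m\<^sup>2 + 18 * m + 2\<close> with \<open>12 * m\<^sup>2 + 20 * m\<close>.\<close>

lemma even_walk_numbers: "4 * walk_const m * b ^ 8 * (g * D ^ m) < t ^ (2 * m)"
proof -
  have "4 * walk_const m * b ^ 8 * (g * D ^ m) < b * b ^ 8 * (g * D ^ m)"
    using walk_const_less_b b_pos g_pos D_pos by simp
  also have "\<dots> = b ^ (1 + 8 + (12 * m\<^sup>2 + 18 * m - 7))"
    unfolding g_D_power by (simp only: power_add power_one_right)
  also have "\<dots> \<le> b ^ ((6 * m + 10) * (2 * m))"
  proof (rule power_increasing)
    have "(6 * m + 10) * (2 * m) = 12 * m\<^sup>2 + 18 * m + 2 * m"
      by (simp add: power2_eq_square algebra_simps)
    then show "1 + 8 + (12 * m\<^sup>2 + 18 * m - 7) \<le> (6 * m + 10) * (2 * m)" using m_pos by linarith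
  qed (use b_pos in simp)
  also have "\<dots> = t ^ (2 * m)" by (simp add: t_def flip: power_mult)
  finally show ?thesis .
qed

text \<open>If \<open>X\<close> were larger than \<open>n / b\<^sup>2\<close>, Cauchy--Schwarz over
  midpoints would give many walks between its vertices, while the container property allows few.
  Eliminating the number \<open>S\<close> of walks leaves \<open>t ^ (2 * m)\<close> against
  \<open>g * D ^ m\<close> times \<open>b ^ 8\<close>, the fourth power of
  \<open>b\<^sup>2\<close>.\<close>

lemma even_container_small:
  assumes "even m" "W \<subseteq> V" "X \<subseteq> W" "K \<subseteq> V" "X \<subseteq> K" "F \<subseteq> G"
    and deg: "\<And>x. x \<in> K \<Longrightarrow> card {y \<in> K. x \<noteq> y \<and> nwalks V F m x y \<noteq> 0} < g"
    and closed: "card {xs. set xs \<subseteq> V \<and> length xs = 2 * m \<and> cyc_edges xs \<subseteq> G}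
      \<le> real (4 * walk_const m * card V) * real D ^ m"
    and W: "\<And>x. x \<in> W \<Longrightarrow> t \<le> card {y \<in> W. {x, y} \<in> F}"
  shows "b\<^sup>2 * card X \<le> n"
proof (rule ccontr)
  assume "\<not> b\<^sup>2 * card X \<le> n"
  then have less: "n ^ 4 \<le> (b\<^sup>2 * card X) ^ 4" by (intro power_mono) auto
  define h where "h = m div 2"
  have h: "2 * h = m" using assms(1) by (simp add: h_def)
  define S where "S = (\<Sum>x\<in>X. \<Sum>y\<in>X. nwalks V F m x y)"
  have "0 \<le> S" unfolding S_def by (intro sum_nonneg) auto
  have "(card X * real t ^ h)\<^sup>2 \<le> n * S"
    using even_walks_lower_bound[OF finite_V assms(3,2), of "real t" F h] W by (simp add: S_def h del: mult_2)
  then have "((card X * real t ^ h)\<^sup>2)\<^sup>2 \<le> (n * S)\<^sup>2" by (intro power_mono) auto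
  also have "\<dots> = (real n)\<^sup>2 * S\<^sup>2" by (simp add: power_mult_distrib)
  also have "\<dots> \<le> (real n)\<^sup>2 * (real (4 * walk_const m * g * D ^ m) * real n ^ 2)"
    unfolding S_def using assms(4,5,6) deg closed by (intro mult_left_mono sparse_walks_bound) auto
  also have "\<dots> = real (n ^ 4 * (4 * walk_const m * (g * D ^ m)))"
    by (simp add: power2_eq_square power4_eq_xxxx)
  also have "((card X * real t ^ h)\<^sup>2)\<^sup>2 = real (card X ^ 4 * t ^ (2 * m))"
    by (simp add: power_mult_distrib mult.commute flip: power_mult h)
  finally have "card X ^ 4 * t ^ (2 * m) \<le> n ^ 4 * (4 * walk_const m * (g * D ^ m))"
    by (simp only: of_nat_le_iff)
  also have "\<dots> \<le> (b\<^sup>2 * card X) ^ 4 * (4 * walk_const m * (g * D ^ m))"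
    using less by (rule mult_right_mono) simp
  also have "\<dots> = card X ^ 4 * (4 * walk_const m * b ^ 8 * (g * D ^ m))"
    by (simp add: power_mult_distrib flip: power_mult)
  finally have "card X ^ 4 * t ^ (2 * m) \<le> card X ^ 4 * (4 * walk_const m * b ^ 8 * (g * D ^ m))" .
  moreover have "0 < card X" using less n_pos by (cases "card X") auto
  ultimately have "t ^ (2 * m) \<le> 4 * walk_const m * b ^ 8 * (g * D ^ m)" by simp
  then show False using even_walk_numbers by linarith
qed

lemma even_cycle_ramsey_host:
  assumes "even m"
  shows "\<exists>G. cycle_ramsey_host V (m + 2) r G"
proof -
  obtain G where G: "G \<subseteq> pairs V"
    "\<And>xs. distinct xs \<Longrightarrow> 3 \<le> length xs \<Longrightarrow> length xs \<le> m + 1 \<Longrightarrow> \<not> cyc_edges xs \<subseteq> G"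
    "U * real B ^ 4 / 16 \<le> card G"
    "\<And>W F T. W \<subseteq> V \<Longrightarrow> F \<in> few_edges (n * t) \<Longrightarrow> (\<And>v. T v \<in> fingerprints) \<Longrightarrow>
      b\<^sup>2 * card (covered W F T) \<le> n\<^sup>2 \<Longrightarrow> card (G \<inter> covered W F T) < U * real B ^ 4 / (64 * r)"
    and closed: "card {xs. set xs \<subseteq> V \<and> length xs = 2 * m \<and> cyc_edges xs \<subseteq> G}
      \<le> real (4 * walk_const m * card V) * real D ^ m"
    by (fact even_host_graph)
  have finG: "finite G" using G(1) finite_pairs[OF finite_V] finite_subset by blast
  have "\<exists>i<r. \<exists>xs. distinct xs \<and> length xs = m + 2 \<and> cyc_edges xs \<subseteq> {e \<in> G. c e = i}"
    if c: "\<forall>e\<in>G. c e < r" for c :: "nat set \<Rightarrow> nat"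
  proof (rule ccontr)
    assume no: "\<not> ?thesis"
    define C where "C i = {e \<in> G. c e = i}" for i
    have "card G = card (\<Union>i\<in>{..<r}. C i)"
      using c by (intro arg_cong[of _ _ card]) (auto simp: C_def)
    also have "\<dots> = (\<Sum>i<r. card (C i))"
      using finG by (intro card_UN_disjoint) (auto simp: C_def)
    finally have sumC: "card G = (\<Sum>i<r. card (C i))" .
    have "\<exists>i<r. card G \<le> r * card (C i)"
    proof (rule ccontr)
      assume "\<not> ?thesis"
      then have "(\<Sum>i<r. r * card (C i)) < (\<Sum>i<r. card G)"
        using r_pos by (intro sum_strict_mono) (auto simp: not_le lessThan_empty_iff)
      then show False using sumC by (simp flip: sum_distrib_left)
    qed
    then obtain i where i: "i < r" "card G \<le> r * card (C i)" by blast
    have CG: "C i \<subseteq> G" by (auto simp: C_def)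
    have CV: "C i \<subseteq> pairs V" using CG G(1) by blast
    have nocyc: "\<not> cyc_edges xs \<subseteq> C i" if xs: "distinct xs" "3 \<le> length xs" "length xs \<le> m + 2" for xs
    proof
      assume sub: "cyc_edges xs \<subseteq> C i"
      then have "\<not> length xs \<le> m + 1" using G(2) xs CG by blast
      then have "length xs = m + 2" using xs by linarith
      then show False using no i(1) xs(1) sub by (auto simp: C_def)
    qed
    \<comment> \<open>This gives large degrees within \<open>W\<close> at the price of at most
      \<open>t * b * n = U * B\<^sup>2\<close> edges.\<close>
    obtain W where W: "W \<subseteq> V" "\<forall>x\<in>W. t * b \<le> card {y \<in> W. {x, y} \<in> C i}"
      "card {e \<in> C i. e \<subseteq> V} \<le> card {e \<in> C i. e \<subseteq> W} + t * b * card V"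
      using ex_min_degree_subset[OF finite_V CV] by blast
    have finW: "finite W" using W(1) finite_V by (rule finite_subset)
    have "\<forall>w. \<exists>Y. w \<in> W \<longrightarrow> Y \<subseteq> {y \<in> W. {w, y} \<in> C i} \<and> card Y = t"
    proof
      fix w
      show "\<exists>Y. w \<in> W \<longrightarrow> Y \<subseteq> {y \<in> W. {w, y} \<in> C i} \<and> card Y = t"
      proof (cases "w \<in> W")
        case True
        have "t * 1 \<le> t * b" using b_pos by (intro mult_le_mono2) simp
        also have "t * b \<le> card {y \<in> W. {w, y} \<in> C i}" using W(2) True by blast
        finally have "t \<le> card {y \<in> W. {w, y} \<in> C i}" by simp
        then obtain Y where "Y \<subseteq> {y \<in> W. {w, y} \<in> C i}" "card Y = t"
          by (rule obtain_subset_with_card_n)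
        then show ?thesis by blast
      qed auto
    qed
    from choice[OF this] obtain Y where Y: "\<And>w. w \<in> W \<Longrightarrow> Y w \<subseteq> {y \<in> W. {w, y} \<in> C i} \<and> card (Y w) = t"
      by blast
    have finY: "finite (Y w)" if "w \<in> W" for w
      using Y[OF that] finW finite_subset[of "Y w" W] by blast
    \<comment> \<open>Keeping \<open>t\<close> edges per vertex leaves at most \<open>n * t\<close>
      edges in total, and yet every vertex of \<open>W\<close> retains the degree that the walk
      count needs.\<close>
    define F where "F = {{w, y} | w y. w \<in> W \<and> y \<in> Y w}"
    have FC: "F \<subseteq> C i" using Y by (auto simp: F_def)
    have cF: "card F \<le> n * t"
    proof -
      have "card F \<le> card W * t"
        unfolding F_def using finW finY Y by (intro card_doubletons_le) auto
      also have "\<dots> \<le> n * t" using card_mono[OF finite_V W(1)] by simp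
      finally show ?thesis .
    qed
    have degF: "t \<le> card {y \<in> W. {x, y} \<in> F}" if "x \<in> W" for x
    proof -
      have "Y x \<subseteq> {y \<in> W. {x, y} \<in> F}" using Y[OF that] that by (auto simp: F_def)
      then have "card (Y x) \<le> card {y \<in> W. {x, y} \<in> F}" using finW by (intro card_mono) auto
      then show ?thesis using Y[OF that] by simp
    qed
    obtain T where T: "\<And>v. T v \<in> fingerprints"
      "\<And>v x. {v, x} \<in> C i - F \<Longrightarrow> x \<in> T v \<union> cont F (T v)"
      "\<And>v. cont F (T v) \<subseteq> V"
      "\<And>v x. x \<in> cont F (T v) \<Longrightarrow> card {y \<in> cont F (T v). x \<noteq> y \<and> nwalks V F m x y \<noteq> 0} < g"
      by (rule colour_class_containers[OF FC CV nocyc]) blast+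
    have small: "b\<^sup>2 * card (cont F (T v) \<inter> W) \<le> n" for v
      using FC CG W(1) by (intro even_container_small[OF assms W(1) _ T(3) _ _ T(4) closed degF]) auto
    have "b\<^sup>2 * card (covered W F T) \<le> n\<^sup>2"
    proof -
      have "card (cont F (T v) \<inter> W - {v}) \<le> n div b\<^sup>2" for v
      proof -
        have "card (cont F (T v) \<inter> W - {v}) \<le> card (cont F (T v) \<inter> W)"
          using finW by (intro card_mono) auto
        also have "\<dots> \<le> n div b\<^sup>2"
          using small[of v] b_pos by (simp add: less_eq_div_iff_mult_less_eq mult.commute)
        finally show ?thesis .
      qed
      then have "card (covered W F T) \<le> card W * (n div b\<^sup>2)"
        unfolding covered_def using finW by (intro card_doubletons_le) auto
      also have "\<dots> \<le> n * (n div b\<^sup>2)" using card_mono[OF finite_V W(1)] by simp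
      finally have "b\<^sup>2 * card (covered W F T) \<le> n * (b\<^sup>2 * (n div b\<^sup>2))" by simp
      also have "\<dots> \<le> n * n" by (intro mult_le_mono2) simp
      finally show ?thesis by (simp add: power2_eq_square)
    qed
    then have few: "card (G \<inter> covered W F T) < U * real B ^ 4 / (64 * r)"
      using G(4)[OF W(1), of F T] T(1) cF FC CV by (auto simp: few_edges_def)
    define Z where "Z = {{v, x} | v x. v \<in> V \<and> x \<in> T v}"
    have finT: "finite (T v) \<and> card (T v) \<le> t" for v
      using T(1)[of v] finite_V finite_subset unfolding fingerprints_def by blast
    have finZ: "finite Z" unfolding Z_def using finT by (intro finite_doubletons) auto
    have cZ: "card Z \<le> n * t"
      unfolding Z_def using card_doubletons_le[OF finite_V, of T t] finT by simp
    \<comment> \<open>An edge outside \<open>F\<close> is either recorded in a fingerprint, hence in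
      \<open>Z\<close>, or permitted by a container.\<close>
    have "{e \<in> C i. e \<subseteq> W} \<subseteq> F \<union> Z \<union> (G \<inter> covered W F T)"
    proof
      fix e assume e: "e \<in> {e \<in> C i. e \<subseteq> W}"
      then have "card e = 2" using CV by (auto simp: pairs_def)
      then obtain v x where vx: "e = {v, x}" "v \<noteq> x" by (auto simp: card_2_iff)
      show "e \<in> F \<union> Z \<union> (G \<inter> covered W F T)"
      proof (cases "e \<in> F")
        case False
        then have "{v, x} \<in> C i - F" using e vx by blast
        then have "x \<in> T v \<union> cont F (T v)" by (rule T(2))
        have "v \<in> W" "x \<in> W" using e vx by auto
        show ?thesis
        proof (cases "x \<in> T v")
          case True
          then have "e \<in> Z" unfolding Z_def using vx \<open>v \<in> W\<close> W(1) by blast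
          then show ?thesis by simp
        next
          case False
          then have "x \<in> cont F (T v) \<inter> W - {v}"
            using \<open>x \<in> T v \<union> cont F (T v)\<close> \<open>x \<in> W\<close> vx by simp
          then have "e \<in> covered W F T" unfolding covered_def using vx \<open>v \<in> W\<close> by blast
          then show ?thesis using e CG by blast
        qed
      qed simp
    qed
    then have "card {e \<in> C i. e \<subseteq> W} \<le> card (F \<union> Z \<union> (G \<inter> covered W F T))"
      using finG finZ finite_subset[OF FC finite_subset[OF CG finG]] by (intro card_mono) auto
    also have "\<dots> \<le> card F + card Z + card (G \<inter> covered W F T)"
      by (meson add_le_mono1 card_Un_le order_trans)
    finally have up: "real (card {e \<in> C i. e \<subseteq> W}) \<le> 2 * U + U * real B ^ 4 / (64 * r)"
      using few cF cZ unfolding U_def by linarith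
    have "{e \<in> C i. e \<subseteq> V} = C i" using CV by (auto simp: pairs_def)
    then have "card (C i) \<le> card {e \<in> C i. e \<subseteq> W} + t * b * n" using W(3) by simp
    then have "real (card (C i)) \<le> real (card {e \<in> C i. e \<subseteq> W} + t * b * n)" by (rule of_nat_mono)
    then have "real (card (C i)) \<le> real (card {e \<in> C i. e \<subseteq> W}) + U * real B ^ 2"
      by (simp add: U_def b_def mult_ac)
    moreover have "U * real B ^ 4 / 16 \<le> real r * card (C i)"
      using G(3) of_nat_mono[OF i(2), where ?'a = real] by simp
    then have "U * real B ^ 4 / (16 * r) \<le> card (C i)"
      using B_ge_real(5) by (simp add: divide_simps mult_ac)
    \<comment> \<open>The class has at least four times \<open>U * B ^ 4 / (64 * r)\<close> edges
      and the containers account for less than one of these parts; all other edges fit into the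
      remaining three.\<close>
    moreover have "3 * U + U * real B ^ 2 < U * real B ^ 4 / (64 * r) * 3"
    proof -
      have "64 * r * 3 + 64 * r * real B ^ 2 < real B ^ 4 * 3"
      proof -
        have "64 * real r \<le> real B" "1 \<le> real B" using B_ge_real by linarith+
        moreover have "real B \<le> real B ^ 4"
          using \<open>1 \<le> real B\<close> by (intro self_le_power) auto
        ultimately have "64 * real r * 3 \<le> real B ^ 4" using B_ge_real(1) by linarith
        moreover have "real B \<le> real B ^ 2"
          using \<open>1 \<le> real B\<close> by (intro self_le_power) auto
        then have "64 * real r \<le> real B ^ 2" using \<open>64 * real r \<le> real B\<close> by linarith
        then have "64 * real r * real B ^ 2 \<le> real B ^ 2 * real B ^ 2"
          by (rule mult_right_mono) simp
        then have "64 * real r * real B ^ 2 \<le> real B ^ 4" by (simp flip: power_add)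
        moreover have "0 < real B ^ 4" using \<open>1 \<le> real B\<close> by simp
        ultimately have "64 * real r * 3 + 64 * real r * real B ^ 2 < real B ^ 4 * 3" by linarith
        then show ?thesis by simp
      qed
      then have "U * (64 * r * 3 + 64 * r * real B ^ 2) < U * (real B ^ 4 * 3)"
        using U_ge(3) by (intro mult_strict_left_mono)
      then show ?thesis using B_ge_real(5) by (simp add: divide_simps algebra_simps)
    qed
    moreover have "U * real B ^ 4 / (16 * r) = 4 * (U * real B ^ 4 / (64 * r))" by simp
    ultimately show False using up U_ge(3) by linarith
  qed
  then show ?thesis
    using G(1,2) unfolding cycle_ramsey_host_def by (intro exI[of _ G] conjI) (auto simp: less_Suc_eq_le)
qed

end

subsection \<open>Arbitrary cycles\<close>

text \<open>A pair arises from at most two vertices. The order on the vertices turns the orientation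
  into a bit, which makes the encoding \<open>f\<close> injective.\<close>

lemma sum_card_le_doubletons:
  fixes X :: "'a :: linorder set"
  assumes "finite X" "\<And>v. v \<in> X \<Longrightarrow> Y v \<subseteq> X - {v}"
  shows "(\<Sum>v\<in>X. card (Y v)) \<le> 2 * card {{v, x} | v x. v \<in> X \<and> x \<in> Y v}"
proof -
  define P where "P = {{v, x} | v x. v \<in> X \<and> x \<in> Y v}"
  define f where "f w = ({fst w, snd w}, fst w < snd w)" for w :: "'a \<times> 'a"
  have finY: "finite (Y v)" if "v \<in> X" for v
    using assms(2)[OF that] assms(1) by (rule finite_subset[OF _ finite_Diff])
  have finP: "finite P" unfolding P_def using assms(1) finY by (rule finite_doubletons)
  have "inj_on f (Sigma X Y)"
    by (rule inj_onI) (auto simp: f_def doubleton_eq_iff)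
  moreover have "f ` Sigma X Y \<subseteq> P \<times> UNIV"
  proof
    fix z assume "z \<in> f ` Sigma X Y"
    then obtain v x where "v \<in> X" "x \<in> Y v" "z = f (v, x)" by (elim imageE SigmaE) simp
    then show "z \<in> P \<times> UNIV" unfolding P_def f_def by auto
  qed
  ultimately have "card (Sigma X Y) \<le> card (P \<times> (UNIV :: bool set))"
    using finP by (intro card_inj_on_le) auto
  then show ?thesis
    using assms(1) finY by (simp add: card_SigmaI card_cartesian_product P_def)
qed

locale odd_host_parameters = host_parameters +
  assumes B_very_large: "base_factor m * r * (2 * r) ^ (2 * r) \<le> B"
begin

text \<open>The square of \<open>(2 * r) ^ r\<close>: the vertex sets of the iteration have at least
  \<open>n / (2 * r) ^ r\<close> elements and hence span of the order of
  \<open>n\<^sup>2 / q\<close> pairs.\<close>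

definition q :: nat where "q = (2 * r) ^ (2 * r)"

lemma q_pos: "1 \<le> real q"
proof -
  have "0 < q" using r_pos by (simp add: q_def)
  then show ?thesis by linarith
qed

lemma B_ge_q: "1000 * real (expo m) * real r * real q \<le> real B" "1000 * real r * real q \<le> real B"
proof -
  have *: "1000 * x * r * q \<le> B" if "x \<le> expo m + walk_const m + (m + 1)\<^sup>2" for x
  proof -
    have "1000 * x * r * q \<le> base_factor m * r * q"
      unfolding base_factor_def by (intro mult_right_mono mult_left_mono that) auto
    also have "\<dots> \<le> B" using B_very_large unfolding q_def .
    finally show ?thesis .
  qed
  have "real (1000 * expo m * r * q) \<le> real B" by (intro of_nat_mono *) simp
  then show "1000 * real (expo m) * real r * real q \<le> real B" by simp
  have "real (1000 * 1 * r * q) \<le> real B" by (intro of_nat_mono *) (simp add: power2_eq_square)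
  then show "1000 * real r * real q \<le> real B" by simp
qed

text \<open>On such a pair an edge whose colour \<open>i\<close> is in \<open>I\<close> belongs to
  \<open>F i\<close> or to a fingerprint. So these sets should contain few edges, and it is lower
  bounds on the host that keep them small.\<close>

definition uncovered :: "nat set \<Rightarrow> nat set \<Rightarrow> (nat \<Rightarrow> nat set set) \<Rightarrow> (nat \<Rightarrow> nat \<Rightarrow> nat set) \<Rightarrow> nat set set" where
  "uncovered X I F T = {{v, x} | v x. v \<in> X \<and> x \<in> X - {v} - (\<Union>i\<in>I. cont (F i) (T i v))}"

lemma uncovered_cong:
  assumes "X \<subseteq> V" "I \<subseteq> {..<r}"
  shows "uncovered X I (restrict F {..<r}) (restrict (\<lambda>i. restrict (T i) V) {..<r}) = uncovered X I F T"
proof -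
  have "(\<Union>i\<in>I. cont (restrict F {..<r} i) (restrict (\<lambda>i. restrict (T i) V) {..<r} i v))
      = (\<Union>i\<in>I. cont (F i) (T i v))" if "v \<in> X" for v
  proof (rule SUP_cong[OF refl])
    fix i assume "i \<in> I"
    then show "cont (restrict F {..<r} i) (restrict (\<lambda>i. restrict (T i) V) {..<r} i v) = cont (F i) (T i v)"
      using assms that by (auto simp: subset_iff)
  qed
  then show ?thesis unfolding uncovered_def by (intro Collect_cong) (metis (no_types, lifting))
qed

lemma odd_host_graph:
  obtains G where "G \<subseteq> pairs V"
    "\<And>xs. distinct xs \<Longrightarrow> 3 \<le> length xs \<Longrightarrow> length xs \<le> m + 1 \<Longrightarrow> \<not> cyc_edges xs \<subseteq> G"
    "\<And>X I F T. X \<subseteq> V \<Longrightarrow> I \<subseteq> {..<r} \<Longrightarrow> (\<And>i. i < r \<Longrightarrow> F i \<in> few_edges (16 * (n * t))) \<Longrightarrow>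
      (\<And>i v. i < r \<Longrightarrow> T i v \<in> fingerprints) \<Longrightarrow> n\<^sup>2 \<le> 8 * q * card (uncovered X I F T) \<Longrightarrow>
      U * real B ^ 4 / (32 * real q) < card (G \<inter> uncovered X I F T) + U"
    "\<And>x. x \<in> V \<Longrightarrow> card {y \<in> V. {x, y} \<in> G} \<le> 4 * D"
    "card {xs. set xs \<subseteq> V \<and> length xs = 2 * m \<and> cyc_edges xs \<subseteq> G} \<le> real (4 * walk_const m * card V) * real D ^ m"
proof -
  define J where "J = Pow V \<times> Pow {..<r} \<times> ({..<r} \<rightarrow>\<^sub>E few_edges (16 * (n * t))) \<times>
    ({..<r} \<rightarrow>\<^sub>E (V \<rightarrow>\<^sub>E fingerprints))"
  define \<L> where "\<L> = {P \<in> (\<lambda>(X, I, F, T). uncovered X I F T) ` J. n\<^sup>2 \<le> 8 * q * card P}"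
  define star where "star v = (\<lambda>x. {v, x}) ` (V - {v})" for v
  define a where "a = U * real B ^ 4 / (32 * real q)"
  define l where "l = (real n)\<^sup>2 / (8 * real q)"
  have finJ: "finite J" unfolding J_def by (intro finite_cartesian_product finite_PiE) auto
  then have finL: "finite \<L>" by (simp add: \<L>_def)
  have subL: "P \<subseteq> pairs V \<and> l \<le> real (card P)" if P: "P \<in> \<L>" for P
  proof
    obtain X I F T where XIFT: "P = uncovered X I F T" "X \<subseteq> V" using P by (auto simp: \<L>_def J_def)
    then show "P \<subseteq> pairs V" by (auto simp: uncovered_def)
    have "real (n\<^sup>2) \<le> real (8 * q * card P)" using P by (intro of_nat_mono) (simp add: \<L>_def)
    then show "l \<le> real (card P)" using q_pos by (simp add: l_def divide_simps mult_ac)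
  qed
  have "card \<L> \<le> card ((\<lambda>(X, I, F, T). uncovered X I F T) ` J)"
    unfolding \<L>_def using finJ by (intro card_mono) auto
  also have "\<dots> \<le> card J" using finJ by (rule card_image_le)
  also have "real (card J) = 2 ^ n * (2 ^ r * (real (card (few_edges (16 * (n * t)))) ^ r *
      (real (card fingerprints) ^ n) ^ r))"
    by (simp add: J_def card_cartesian_product card_Pow card_PiE)
  also have "\<dots> \<le> exp n * (exp r * (exp (2 * expo m * B * (16 * (n * t))) ^ r *
      (exp (2 * expo m * B * t) ^ n) ^ r))"
    using card_few_edges[of "16 * (n * t)"] card_fingerprints
    by (intro mult_mono power_mono two_power_le_exp) (auto intro!: mult_nonneg_nonneg)
  \<comment> \<open>For each colour, a graph with up to \<open>16 * U\<close> edges contributes 32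
    and the fingerprints contribute 2.\<close>
  also have "\<dots> = exp (n + r + 34 * expo m * r * B * U)"
    by (simp add: U_def algebra_simps flip: exp_add exp_of_nat_mult)
  finally have cL: "real (card \<L>) \<le> exp (n + r + 34 * expo m * r * B * U)" by simp
  have big: "34 * real (expo m) * real r * real B + 6 \<le> real B ^ 4 / (32 * real q)"
  proof -
    define z where "z = real (expo m) * real r"
    have "6 \<le> z" unfolding z_def using mult_mono[of 6 "real (expo m)" 1 "real r"] B_ge_real(5,6) by simp
    have "34 * z * real B + 6 \<le> 35 * (z * real B)"
      using \<open>6 \<le> z\<close> B_ge_real(4) mult_mono[of 6 z 1 "real B"] by (simp add: algebra_simps)
    then have "32 * real q * (34 * z * real B + 6) \<le> 32 * real q * (35 * (z * real B))"
      by (intro mult_left_mono) auto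
    also have "\<dots> = 1120 * (z * real q) * real B" by simp
    also have "\<dots> \<le> (2 * real B) * real B"
      using B_ge_q(1) by (intro mult_right_mono) (auto simp: z_def mult_ac)
    also have "\<dots> \<le> real B ^ 2 * real B ^ 2"
    proof -
      have "real B \<le> real B ^ 2" using B_ge_real(4) by (intro self_le_power) auto
      then have "2 \<le> real B ^ 2" using B_ge_real(4) by linarith
      then have "2 * real B ^ 2 \<le> real B ^ 2 * real B ^ 2" by (rule mult_right_mono) simp
      then show ?thesis by (simp add: power2_eq_square)
    qed
    also have "\<dots> = real B ^ 4" by (simp flip: power_add)
    finally show ?thesis using q_pos by (simp add: z_def pos_le_divide_eq mult_ac)
  qed
  \<comment> \<open>The exponent \<open>a - p * l / 2\<close> becomes \<open>- a\<close>, which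
    beats the number of choices by \<open>big\<close>.\<close>
  have "p * l / 2 = 2 * a"
    unfolding a_def l_def p_def nD_eq[symmetric] using n_pos q_pos
    by (simp add: divide_simps power2_eq_square)
  have "real (card \<L>) * exp (a - p * l / 2) \<le> exp (n + r + 34 * expo m * r * B * U) * exp (- a)"
    unfolding \<open>p * l / 2 = 2 * a\<close> using cL by (intro mult_mono) auto
  also have "\<dots> = exp (n + r + 34 * expo m * r * B * U - a)" by (simp flip: exp_add)
  also have "\<dots> < 1 / 4"
  proof (rule exp_le_quarter)
    have "U * (34 * real (expo m) * real r * real B + 6) \<le> a"
      unfolding a_def using mult_left_mono[OF big, of U] U_ge by simp
    moreover have "real r \<le> U"
    proof -
      have "r \<le> B" using B_ge(1) by simp
      then have "r \<le> t" using B_le_b b_le_t by linarith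
      also have "t \<le> n * t" using n_pos by simp
      finally show ?thesis unfolding U_def by (rule of_nat_mono)
    qed
    ultimately show "n + r + 34 * expo m * r * B * U - a \<le> -4"
      using U_ge by (simp add: algebra_simps)
  qed
  finally have lower: "real (card \<L>) * exp (a - p * l / 2) < 1 / 4" .
  have cstar: "card (star v) \<le> n" for v
    unfolding star_def using finite_V
    by (intro order_trans[OF card_image_le]) (auto intro!: order_trans[OF card_Diff1_le])
  \<comment> \<open>Upper bounds on stars are degree bounds: the mean is at most \<open>D\<close>,
    and exceeding \<open>4 * D\<close> costs \<open>exp (- (2 * D))\<close>, enough for
    \<open>n\<close> stars.\<close>
  have "(\<Sum>P\<in>star ` V. exp (2 * p * card P - 4 * D)) \<le> (\<Sum>P\<in>star ` V. exp (- (2 * real D)))"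
  proof (rule sum_mono)
    fix P assume "P \<in> star ` V"
    then have "p * card P \<le> p * n" using cstar p(1) by (intro mult_left_mono) auto
    also have "\<dots> = D" using p(3) by simp
    finally show "exp (2 * p * card P - 4 * D) \<le> exp (- (2 * real D))" by simp
  qed
  also have "\<dots> = card (star ` V) * exp (- (2 * real D))" by simp
  also have "\<dots> \<le> exp (expo m * B) * exp (- (2 * real D))"
    using card_image_le[OF finite_V, of star] n_le_exp by (intro mult_right_mono) auto
  also have "\<dots> = exp (expo m * B - 2 * real D)" by (simp flip: exp_add)
  also have "\<dots> < 1 / 4"
  proof (rule exp_le_quarter)
    have "expo m * B \<le> D"
    proof -
      have "expo m * 1 \<le> expo m * r" using r_pos by (intro mult_le_mono2)
      then have "expo m \<le> B" using B_ge(2) by linarith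
      then have "expo m * B \<le> b" by (simp add: b_def power2_eq_square)
      also have "\<dots> \<le> t" by (rule b_le_t)
      also have "\<dots> \<le> D" using b_pos by (simp add: D_eq)
      finally show ?thesis .
    qed
    then have "real (expo m * B) \<le> real D" by (rule of_nat_mono)
    then show "expo m * B - 2 * real D \<le> -4" using n_large(2) by simp
  qed
  finally have upper: "(\<Sum>P\<in>star ` V. exp (2 * p * card P - 4 * D)) < 1 / 4" .
  obtain G where G: "G \<subseteq> pairs V"
    "\<And>xs. distinct xs \<Longrightarrow> 3 \<le> length xs \<Longrightarrow> length xs \<le> m + 1 \<Longrightarrow> \<not> cyc_edges xs \<subseteq> G"
    "\<And>P. P \<in> \<L> \<Longrightarrow> a < card (G \<inter> P) + real (4 * (m + 1)\<^sup>2) * real D ^ (m + 1)"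
    "\<And>P. P \<in> star ` V \<Longrightarrow> card (G \<inter> P) < real (4 * D)"
    "card {xs. set xs \<subseteq> V \<and> length xs = 2 * m \<and> cyc_edges xs \<subseteq> G} \<le> real (4 * walk_const m * card V) * real D ^ m"
  proof (rule host_graph_exists[OF finite_V V_nonempty p, of \<L> l "star ` V" a "\<lambda>_. real (4 * D)"])
    show "real (card \<L>) * exp (a - p * l / 2) + (\<Sum>P\<in>star ` V. exp (2 * p * real (card P) - real (4 * D))) < 1 / 2"
      using upper lower by linarith
  qed (use m_pos subL finL in \<open>auto simp: star_def\<close>)
  show ?thesis
  proof
    fix X I F T assume XIFT: "X \<subseteq> V" "I \<subseteq> {..<r}" "\<And>i. i < r \<Longrightarrow> F i \<in> few_edges (16 * (n * t))"
      "\<And>i v. i < r \<Longrightarrow> T i v \<in> fingerprints" "n\<^sup>2 \<le> 8 * q * card (uncovered X I F T)"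
    have "(X, I, restrict F {..<r}, restrict (\<lambda>i. restrict (T i) V) {..<r}) \<in> J"
      using XIFT by (auto simp: J_def)
    then have "uncovered X I F T \<in> (\<lambda>(X, I, F, T). uncovered X I F T) ` J"
      using uncovered_cong[OF XIFT(1,2)]
      by (intro image_eqI[of _ _ "(X, I, restrict F {..<r}, restrict (\<lambda>i. restrict (T i) V) {..<r})"]) auto
    then have "uncovered X I F T \<in> \<L>" using XIFT(5) by (simp add: \<L>_def)
    from G(3)[OF this] show "U * real B ^ 4 / (32 * real q) < card (G \<inter> uncovered X I F T) + U"
      using deleted_le by (simp add: a_def)
  next
    fix x assume x: "x \<in> V"
    have "(\<lambda>y. {x, y}) ` {y \<in> V. {x, y} \<in> G} \<subseteq> G \<inter> star x"
    proof
      fix e assume "e \<in> (\<lambda>y. {x, y}) ` {y \<in> V. {x, y} \<in> G}"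
      then obtain y where y: "y \<in> V" "{x, y} \<in> G" "e = {x, y}" by auto
      then have "{x, y} \<in> pairs V" using G(1) by blast
      then show "e \<in> G \<inter> star x" using y by (auto simp: star_def)
    qed
    then have "card ((\<lambda>y. {x, y}) ` {y \<in> V. {x, y} \<in> G}) \<le> card (G \<inter> star x)"
      by (intro card_mono) (auto simp: star_def)
    moreover have "inj_on (\<lambda>y. {x, y}) {y \<in> V. {x, y} \<in> G}" by (auto simp: inj_on_def doubleton_eq_iff)
    ultimately have "card {y \<in> V. {x, y} \<in> G} \<le> card (G \<inter> star x)" by (simp add: card_image)
    moreover have "card (G \<inter> star x) < 4 * D" using G(4)[of "star x"] x by (simp only: of_nat_less_iff imageI)
    ultimately show "card {y \<in> V. {x, y} \<in> G} \<le> 4 * D" by linarith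
  qed (use G in auto)
qed

text \<open>A sample of density \<open>1 / b\<^sup>2\<close>, small enough to be enumerated, that
  detects every vertex set on which \<open>C\<close> is dense. The class has at most
  \<open>4 * U * b\<^sup>2\<close> edges, so the sample has fewer than \<open>16 * U\<close>; the
  \<open>2 ^ n\<close> vertex sets are affordable since \<open>n \<le> U / b\<close>. It is used in
  the contrapositive: where \<open>F\<close> is sparse, so is \<open>C\<close>.\<close>

lemma sparse_subgraph:
  assumes "C \<subseteq> pairs V" "\<And>x. x \<in> V \<Longrightarrow> card {y \<in> V. {x, y} \<in> C} \<le> 4 * D"
  obtains F where "F \<subseteq> C" "F \<in> few_edges (16 * (n * t))"
    "\<And>X. X \<subseteq> V \<Longrightarrow> 64 * U * b \<le> card {e \<in> C. e \<subseteq> X} \<Longrightarrow> 16 * U / b < card {e \<in> F. e \<subseteq> X}"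
proof -
  define s where "s = 64 * U * b"
  define \<F> where "\<F> = {E \<in> (\<lambda>X. {e \<in> C. e \<subseteq> X}) ` Pow V. s \<le> card E}"
  define \<rho> where "\<rho> = 1 / (real b)\<^sup>2"
  define M where "M = 4 * U * (real b)\<^sup>2"
  have finC: "finite C" using assms(1) finite_pairs[OF finite_V] by (rule finite_subset)
  have b1: "1 \<le> real b" using b_pos by linarith
  have \<rho>: "0 < \<rho>" "\<rho> \<le> 1" using b1 by (auto simp: \<rho>_def divide_simps)
  have \<rho>s: "\<rho> * s / 4 = 16 * U / b" using b1 by (simp add: \<rho>_def s_def power2_eq_square)
  have \<rho>M: "4 * \<rho> * M = real (16 * (n * t))" using b1 by (simp add: \<rho>_def M_def U_def)
  have "{e \<in> C. e \<subseteq> V} = C" using assms(1) by (auto simp: pairs_def)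
  then have "card C \<le> n * (4 * D)"
    using card_edges_le_degree[OF finite_V assms] by simp
  then have "real (card C) \<le> real (n * (4 * D))" by (rule of_nat_mono)
  then have cC: "real (card C) \<le> M" by (simp add: M_def U_def D_eq mult_ac)
  have finF: "finite \<F>" by (simp add: \<F>_def)
  have "card \<F> \<le> card ((\<lambda>X. {e \<in> C. e \<subseteq> X}) ` Pow V)" unfolding \<F>_def by (intro card_mono) auto
  also have "\<dots> \<le> card (Pow V)" by (intro card_image_le) simp
  also have "\<dots> = 2 ^ n" by (simp add: card_Pow)
  finally have "real (card \<F>) \<le> real (2 ^ n)" by (rule of_nat_mono)
  also have "\<dots> \<le> exp n" using two_power_le_exp[of n] by simp
  finally have "card \<F> * exp (- (\<rho> * s / 4)) \<le> exp n * exp (- (16 * U / b))"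
    unfolding \<rho>s by (intro mult_right_mono) auto
  also have "\<dots> = exp (n - 16 * U / b)" by (simp flip: exp_add)
  also have "\<dots> < 1 / 4"
  proof (rule exp_le_quarter)
    have "real n * b \<le> U"
      unfolding U_def of_nat_mult using b_le_t by (intro mult_left_mono) auto
    then have "real n \<le> U / b" using b1 by (simp add: divide_simps)
    then show "n - 16 * U / b \<le> -4" using n_large(1) by simp
  qed
  finally have small: "card \<F> * exp (- (\<rho> * s / 4)) \<le> 1 / 2" by linarith
  have "0 < M" using U_ge b1 by (simp add: M_def)
  have sub: "E \<subseteq> C \<and> s \<le> real (card E)" if "E \<in> \<F>" for E using that by (auto simp: \<F>_def)
  obtain F where F: "F \<subseteq> C" "card F < 4 * \<rho> * M" "\<And>E. E \<in> \<F> \<Longrightarrow> \<rho> * s / 4 < card (F \<inter> E)"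
    using sparse_sample[OF finC finF sub \<rho> cC \<open>0 < M\<close> small] by blast
  show ?thesis
  proof
    show "F \<subseteq> C" by fact
    show "F \<in> few_edges (16 * (n * t))"
      using F(1,2) assms(1) unfolding \<rho>M few_edges_def of_nat_less_iff by auto
    show "16 * U / b < card {e \<in> F. e \<subseteq> X}" if "X \<subseteq> V" "64 * U * b \<le> card {e \<in> C. e \<subseteq> X}" for X
    proof -
      have "{e \<in> C. e \<subseteq> X} \<in> \<F>" using that by (auto simp: \<F>_def s_def)
      moreover have "F \<inter> {e \<in> C. e \<subseteq> X} = {e \<in> F. e \<subseteq> X}" using F(1) by auto
      ultimately show ?thesis using F(3)[of "{e \<in> C. e \<subseteq> X}"] unfolding \<rho>s by simp
    qed
  qed
qed

text \<open>The exponents of \<open>b\<close> agree exactly; strictness comes from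
  \<open>4 * walk_const m < b\<close>.\<close>

lemma odd_walk_numbers: "4 * walk_const m * b ^ 6 * (g * D ^ m) < (b ^ (6 * m + 9)) ^ (2 * m)"
proof -
  have "4 * walk_const m * b ^ 6 * (g * D ^ m) < b * b ^ 6 * (g * D ^ m)"
    using walk_const_less_b b_pos g_pos D_pos by simp
  also have "\<dots> = b ^ (1 + 6 + (12 * m\<^sup>2 + 18 * m - 7))"
    unfolding g_D_power by (simp only: power_add power_one_right)
  also have "1 + 6 + (12 * m\<^sup>2 + 18 * m - 7) = (6 * m + 9) * (2 * m)"
  proof -
    have "(6 * m + 9) * (2 * m) = 12 * m\<^sup>2 + 18 * m" by (simp add: power2_eq_square algebra_simps)
    then show ?thesis using m_pos by linarith
  qed
  finally show ?thesis by (simp add: power_mult)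
qed

text \<open>Suppose \<open>F\<close> has more than \<open>16 * U / b = 16 * d * n\<close> edges in
  \<open>X\<close>. Removing low degrees leaves a \<open>W\<close> of minimum degree
  \<open>d\<close> with more than \<open>15 * d * n\<close> edges, and the degree bound
  \<open>4 * D = 4 * d * b ^ 3\<close> makes \<open>W\<close> larger than \<open>n / b ^ 3\<close>.
  The walks of length \<open>m\<close> inside \<open>W\<close> are then too many for a
  container.\<close>

lemma container_sparse:
  assumes "F \<subseteq> G" "G \<subseteq> pairs V" "K \<subseteq> V" "X \<subseteq> K"
    and deg: "\<And>x. x \<in> K \<Longrightarrow> card {y \<in> K. x \<noteq> y \<and> nwalks V F m x y \<noteq> 0} < g"
    and closed: "card {xs. set xs \<subseteq> V \<and> length xs = 2 * m \<and> cyc_edges xs \<subseteq> G}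
      \<le> real (4 * walk_const m * card V) * real D ^ m"
    and Delta: "\<And>x. x \<in> V \<Longrightarrow> card {y \<in> V. {x, y} \<in> G} \<le> 4 * D"
  shows "card {e \<in> F. e \<subseteq> X} \<le> 16 * U / b"
proof (rule ccontr)
  assume "\<not> ?thesis"
  then have dense: "16 * U / b < card {e \<in> F. e \<subseteq> X}" by simp
  define d where "d = b ^ (6 * m + 9)"
  have dt: "d * b = t" 
    unfolding d_def t_def power_Suc2[symmetric] by (rule arg_cong[of _ _ "(^) b"]) simp
  have dD: "d * b ^ 3 = D"
    unfolding d_def D_def power_add[symmetric] by (rule arg_cong[of _ _ "(^) b"]) simp
  have Ud: "U / b = real (d * n)" using b_pos by (simp add: U_def mult_ac flip: dt)
  have XV: "X \<subseteq> V" using assms by blast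
  have finX: "finite X" using XV finite_V by (rule finite_subset)
  have FV: "F \<subseteq> pairs V" using assms by blast
  obtain W where W: "W \<subseteq> X" "\<forall>x\<in>W. d \<le> card {y \<in> W. {x, y} \<in> F}"
    "card {e \<in> F. e \<subseteq> X} \<le> card {e \<in> F. e \<subseteq> W} + d * card X"
    using ex_min_degree_subset[OF finX FV] by blast
  have finW: "finite W" and WV: "W \<subseteq> V" using W(1) finX XV finite_subset by auto
  have "16 * real (d * n) < real (card {e \<in> F. e \<subseteq> X})" using dense Ud by simp
  then have "16 * (d * n) < card {e \<in> F. e \<subseteq> X}" by linarith
  moreover have "d * card X \<le> d * n" using card_mono[OF finite_V XV] by simp
  ultimately have "15 * (d * n) < card {e \<in> F. e \<subseteq> W}" using W(3) by linarith
  also have "\<dots> \<le> card W * (4 * D)"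
  proof (rule card_edges_le_degree[OF finW FV])
    fix x assume "x \<in> W"
    then have "card {y \<in> W. {x, y} \<in> F} \<le> card {y \<in> V. {x, y} \<in> G}"
      using WV assms(1) by (intro card_mono) auto
    also have "\<dots> \<le> 4 * D" using Delta \<open>x \<in> W\<close> WV by blast
    finally show "card {y \<in> W. {x, y} \<in> F} \<le> 4 * D" .
  qed
  also have "\<dots> = d * (4 * (card W * b ^ 3))" by (simp flip: dD)
  finally have "d * (15 * n) < d * (4 * (card W * b ^ 3))" by (simp only: mult_ac)
  then have "15 * n < 4 * (card W * b ^ 3)" by simp
  then have nW: "n \<le> card W * b ^ 3" by linarith
  define S where "S = (\<Sum>x\<in>W. \<Sum>y\<in>W. nwalks V F m x y)"
  have "(\<Sum>x\<in>W. real d ^ m) \<le> S"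
    unfolding S_def using W(2) WV by (intro sum_mono min_degree_nwalks[OF finite_V]) auto
  then have "(card W * real d ^ m)\<^sup>2 \<le> S\<^sup>2" by (intro power_mono) auto
  also have "\<dots> \<le> real (4 * walk_const m * g * D ^ m) * real n ^ 2"
    unfolding S_def using W(1) assms(4) by (intro sparse_walks_bound[OF assms(3) _ assms(1) deg closed]) auto
  also have "\<dots> = real (4 * walk_const m * (g * D ^ m) * n\<^sup>2)" by simp
  also have "(card W * real d ^ m)\<^sup>2 = real ((card W)\<^sup>2 * d ^ (2 * m))"
    by (simp add: power_mult_distrib mult.commute flip: power_mult)
  finally have "(card W)\<^sup>2 * d ^ (2 * m) \<le> 4 * walk_const m * (g * D ^ m) * n\<^sup>2"
    by (simp only: of_nat_le_iff)
  also have "\<dots> \<le> 4 * walk_const m * (g * D ^ m) * (card W * b ^ 3)\<^sup>2"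
    using nW by (intro mult_left_mono power_mono) auto
  also have "\<dots> = (card W)\<^sup>2 * (4 * walk_const m * b ^ 6 * (g * D ^ m))"
    by (simp add: power_mult_distrib flip: power_mult)
  finally have "(card W)\<^sup>2 * d ^ (2 * m) \<le> (card W)\<^sup>2 * (4 * walk_const m * b ^ 6 * (g * D ^ m))" .
  moreover have "0 < card W" using nW n_pos by (cases "card W") auto
  ultimately have "d ^ (2 * m) \<le> 4 * walk_const m * b ^ 6 * (g * D ^ m)" by simp
  then show False using odd_walk_numbers unfolding d_def by linarith
qed

lemma q_powers: "j \<le> r \<Longrightarrow> ((2 * r) ^ j)\<^sup>2 \<le> q" "j \<le> r \<Longrightarrow> 4 * (2 * r) ^ j \<le> n"
proof -
  assume j: "j \<le> r"
  have r2: "1 \<le> 2 * r" using r_pos by simp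
  have "((2 * r) ^ j)\<^sup>2 = (2 * r) ^ (2 * j)" by (simp only: power_mult[symmetric] mult.commute[of j])
  also have "\<dots> \<le> q" unfolding q_def using j r2 by (intro power_increasing) auto
  finally show sq: "((2 * r) ^ j)\<^sup>2 \<le> q" .
  have "1 * real q \<le> 1000 * real r * real q" using B_ge_real(5) by (intro mult_right_mono) auto
  then have "q \<le> B" using B_ge_q(2) by linarith
  have "(2 * r) ^ j \<le> ((2 * r) ^ j)\<^sup>2" by (rule self_le_power) (use r_pos in auto)
  then have "4 * (2 * r) ^ j \<le> 4 * B" using sq \<open>q \<le> B\<close> by linarith
  also have "\<dots> \<le> B * B" using B_ge(5) by (intro mult_right_mono) auto
  also have "\<dots> = b" by (simp add: b_def power2_eq_square)
  also have "\<dots> \<le> t" by (rule b_le_t)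
  also have "\<dots> \<le> D" using b_pos by (simp add: D_eq)
  also have "\<dots> \<le> n" by (rule D_le_n)
  finally show "4 * (2 * r) ^ j \<le> n" .
qed

text \<open>One round of the iteration. The edges on uncovered pairs have a colour of
  \<open>S\<close>, sparse on \<open>X\<close>, or lie in the graphs \<open>F i\<close> or the
  fingerprints. That is too few for a large set of pairs, so less than
  \<open>(card X)\<^sup>2 / 8\<close> pairs are uncovered. Hence the containers of some vertex for
  the colours outside \<open>S\<close> cover half of \<open>X\<close>, and one of them covers a
  fraction \<open>1 / (2 * r)\<close>. There its own colour is sparse, and the colours in
  \<open>S\<close> remain so.\<close>

lemma extend_sparse_colours:
  assumes G: "G \<subseteq> pairs V" "\<And>e. e \<in> G \<Longrightarrow> c e < r"
    and C: "\<And>i. C i = {e \<in> G. c e = i}"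
    and F: "\<And>i. i < r \<Longrightarrow> F i \<subseteq> C i" "\<And>i. i < r \<Longrightarrow> F i \<in> few_edges (16 * (n * t))"
      "\<And>i X. i < r \<Longrightarrow> X \<subseteq> V \<Longrightarrow> 64 * U * b \<le> card {e \<in> C i. e \<subseteq> X} \<Longrightarrow> 16 * U / b < card {e \<in> F i. e \<subseteq> X}"
    and T: "\<And>i v. i < r \<Longrightarrow> T i v \<in> fingerprints"
      "\<And>i v x. i < r \<Longrightarrow> {v, x} \<in> C i - F i \<Longrightarrow> x \<in> T i v \<union> cont (F i) (T i v)"
    and sparse: "\<And>i v X. i < r \<Longrightarrow> X \<subseteq> cont (F i) (T i v) \<Longrightarrow> card {e \<in> F i. e \<subseteq> X} \<le> 16 * U / b"
    and lower: "\<And>X I. X \<subseteq> V \<Longrightarrow> I \<subseteq> {..<r} \<Longrightarrow> n\<^sup>2 \<le> 8 * q * card (uncovered X I F T) \<Longrightarrow>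
      U * real B ^ 4 / (32 * real q) < card (G \<inter> uncovered X I F T) + U"
    and S: "S \<subseteq> {..<r}" "X \<subseteq> V" "n \<le> card X * (2 * r) ^ card S"
      "\<And>i. i \<in> S \<Longrightarrow> card {e \<in> C i. e \<subseteq> X} < 64 * U * b"
  shows "\<exists>i\<in>{..<r} - S. \<exists>X'\<subseteq>V. n \<le> card X' * (2 * r) ^ Suc (card S) \<and>
    (\<forall>j\<in>insert i S. card {e \<in> C j. e \<subseteq> X'} < 64 * U * b)"
proof -
  define I where "I = {..<r} - S"
  define P where "P = uncovered X I F T"
  have finG: "finite G" using G(1) finite_pairs[OF finite_V] by (rule finite_subset)
  have finX: "finite X" using S(2) finite_V by (rule finite_subset)
  have finS: "finite S" using S(1) finite_subset by blast
  have cS: "card S \<le> r" using card_mono[OF _ S(1)] by simp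
  have finC: "finite (C i)" for i using finG by (simp add: C)
  have finF: "finite (F i)" if "i < r" for i using F(1)[OF that] finC by (rule finite_subset)
  define Z where "Z i = {{v, x} | v x. v \<in> V \<and> x \<in> T i v}" for i
  have finT: "finite (T i v) \<and> card (T i v) \<le> t" if "i < r" for i v
    using T(1)[OF that, of v] finite_V finite_subset unfolding fingerprints_def by blast
  have finZ: "finite (Z i)" if "i < r" for i
    unfolding Z_def using finT[OF that] by (intro finite_doubletons) auto
  have cZ: "card (Z i) \<le> n * t" if "i < r" for i
    unfolding Z_def using card_doubletons_le[OF finite_V, of "T i" t] finT[OF that] by simp
  have "G \<inter> P \<subseteq> (\<Union>i\<in>I. F i) \<union> (\<Union>i\<in>I. Z i) \<union> (\<Union>i\<in>S. {e \<in> C i. e \<subseteq> X})"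
  proof
    fix e assume e: "e \<in> G \<inter> P"
    then obtain v x where vx: "e = {v, x}" "v \<in> X" "x \<in> X" "v \<noteq> x" "x \<notin> (\<Union>i\<in>I. cont (F i) (T i v))"
      unfolding P_def uncovered_def by blast
    define i where "i = c e"
    have i: "i < r" "e \<in> C i" using e G(2) by (auto simp: C i_def)
    show "e \<in> (\<Union>i\<in>I. F i) \<union> (\<Union>i\<in>I. Z i) \<union> (\<Union>i\<in>S. {e \<in> C i. e \<subseteq> X})"
    proof (cases "i \<in> S")
      case True
      have "e \<subseteq> X" using vx by simp
      then show ?thesis using True i by blast
    next
      case False
      then have "i \<in> I" using i by (simp add: I_def)
      show ?thesis
      proof (cases "e \<in> F i")
        case False
        then have "{v, x} \<in> C i - F i" using i vx by simp
        then have "x \<in> T i v \<union> cont (F i) (T i v)" by (rule T(2)[OF i(1)])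
        then have "x \<in> T i v" using vx(5) \<open>i \<in> I\<close> by blast
        then have "e \<in> Z i" unfolding Z_def using vx S(2) by blast
        then show ?thesis using \<open>i \<in> I\<close> by blast
      qed (use \<open>i \<in> I\<close> in blast)
    qed
  qed
  then have "card (G \<inter> P) \<le> card ((\<Union>i\<in>I. F i) \<union> (\<Union>i\<in>I. Z i) \<union> (\<Union>i\<in>S. {e \<in> C i. e \<subseteq> X}))"
    using finF finZ finC finS by (intro card_mono) (auto simp: I_def)
  also have "\<dots> \<le> (\<Sum>i\<in>I. card (F i)) + (\<Sum>i\<in>I. card (Z i)) + (\<Sum>i\<in>S. card {e \<in> C i. e \<subseteq> X})"
    using finS by (intro order_trans[OF card_Un_le] add_mono card_UN_le) (auto simp: I_def)
  finally have "real (card (G \<inter> P)) \<le> (\<Sum>i\<in>I. real (card (F i))) + (\<Sum>i\<in>I. real (card (Z i)))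
      + (\<Sum>i\<in>S. real (card {e \<in> C i. e \<subseteq> X}))"
    unfolding of_nat_sum[symmetric] of_nat_add[symmetric] by (rule of_nat_mono)
  also have "\<dots> \<le> (\<Sum>i\<in>I. 16 * U) + (\<Sum>i\<in>I. U) + (\<Sum>i\<in>S. 64 * U * b)"
  proof (intro add_mono sum_mono)
    fix i assume "i \<in> I"
    then have i: "i < r" by (simp add: I_def)
    have "card (F i) \<le> 16 * (n * t)" using F(2)[OF i] by (simp add: few_edges_def)
    then have "real (card (F i)) \<le> real (16 * (n * t))" by (rule of_nat_mono)
    then show "real (card (F i)) \<le> 16 * U" by (simp add: U_def)
    show "real (card (Z i)) \<le> U" using of_nat_mono[OF cZ[OF i]] unfolding U_def .
  next
    fix i assume "i \<in> S"
    then show "real (card {e \<in> C i. e \<subseteq> X}) \<le> 64 * U * b" using S(4) by (simp only: less_imp_le)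
  qed
  also have "\<dots> = real (card I) * (17 * U) + real (card S) * (64 * U * b)" by simp
  also have "\<dots> \<le> real r * (17 * U) + real r * (64 * U * b)"
    using U_ge(3) cS card_mono[of "{..<r}" I] by (intro add_mono mult_right_mono) (auto simp: I_def)
  finally have up: "real (card (G \<inter> P)) \<le> U * (real r * (17 + 64 * b))" by (simp add: algebra_simps)
  have "8 * q * card P < n\<^sup>2"
  proof (rule ccontr)
    assume "\<not> ?thesis"
    then have "U * real B ^ 4 / (32 * real q) < card (G \<inter> P) + U"
      unfolding P_def using S(2) by (intro lower) (auto simp: I_def not_less)
    also have "\<dots> \<le> U * (real r * (17 + 64 * b) + 1)" using up by (simp add: algebra_simps)
    finally have "U * (real B ^ 4 / (32 * real q)) < U * (real r * (17 + 64 * b) + 1)" by simp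
    then have lt: "real B ^ 4 / (32 * real q) < real r * (17 + 64 * b) + 1"
      using U_ge(3) by (simp only: mult_less_cancel_left_pos)
    have "1 \<le> real r * b" using B_ge_real(5) b_pos mult_mono[of 1 "real r" 1 "real b"] by simp
    moreover have "real r * 1 \<le> real r * b" using b_pos by (intro mult_left_mono) auto
    ultimately have "real r * (17 + 64 * b) + 1 \<le> 82 * (real r * b)" by (simp add: algebra_simps)
    then have "real B ^ 4 / (32 * real q) < 82 * (real r * b)" using lt by linarith
    then have "real B ^ 4 < 82 * (real r * b) * (32 * real q)" using q_pos by (simp add: pos_divide_less_eq)
    also have "\<dots> = 2624 * (real r * real q) * b" by simp
    also have "\<dots> \<le> real B ^ 2 * b"
    proof (rule mult_right_mono)
      have "2624 * (real r * real q) \<le> 3 * real B" using B_ge_q(2) by simp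
      also have "\<dots> \<le> real B * real B" using B_ge_real(4) by (intro mult_right_mono) auto
      finally show "2624 * (real r * real q) \<le> real B ^ 2" by (simp add: power2_eq_square)
    qed simp
    also have "\<dots> = real B ^ 4" by (simp add: b_def flip: power_add)
    finally show False by simp
  qed
  also have "n\<^sup>2 \<le> (card X * (2 * r) ^ card S)\<^sup>2" using S(3) by (rule power_mono) simp
  also have "\<dots> = (card X)\<^sup>2 * ((2 * r) ^ card S)\<^sup>2" by (rule power_mult_distrib)
  also have "\<dots> \<le> (card X)\<^sup>2 * q" using q_powers(1)[OF cS] by (rule mult_left_mono) simp
  finally have cP: "8 * card P < (card X)\<^sup>2" by simp
  have X4: "4 \<le> card X"
  proof -
    have "4 * (2 * r) ^ card S \<le> card X * (2 * r) ^ card S" using q_powers(2)[OF cS] S(3) by linarith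
    moreover have "0 < (2 * r) ^ card S" using r_pos by simp
    ultimately show ?thesis by (simp only: mult_le_cancel2)
  qed
  define N where "N v = X - {v} - (\<Union>i\<in>I. cont (F i) (T i v))" for v
  \<comment> \<open>Each uncovered pair is counted at most twice, so the sets \<open>N v\<close>
    have average size below \<open>card X / 4\<close>.\<close>
  have "\<exists>v\<in>X. 4 * card (N v) < card X"
  proof (rule ccontr)
    assume "\<not> ?thesis"
    then have "(\<Sum>v\<in>X. card X) \<le> (\<Sum>v\<in>X. 4 * card (N v))" by (intro sum_mono) (auto simp: not_less)
    also have "\<dots> = 4 * (\<Sum>v\<in>X. card (N v))" by (simp add: sum_distrib_left)
    also have "\<dots> \<le> 4 * (2 * card P)"
      unfolding P_def uncovered_def N_def[symmetric]
      using finX by (intro mult_le_mono2 sum_card_le_doubletons) (auto simp: N_def)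
    finally show False using cP by (simp add: power2_eq_square)
  qed
  then obtain v where v: "v \<in> X" "4 * card (N v) < card X" by blast
  have "X \<subseteq> insert v (N v) \<union> (\<Union>i\<in>I. cont (F i) (T i v) \<inter> X)" by (auto simp: N_def)
  then have "card X \<le> card (insert v (N v) \<union> (\<Union>i\<in>I. cont (F i) (T i v) \<inter> X))"
    using finX by (intro card_mono) (auto simp: N_def I_def)
  also have "\<dots> \<le> card (insert v (N v)) + (\<Sum>i\<in>I. card (cont (F i) (T i v) \<inter> X))"
    by (intro order_trans[OF card_Un_le] add_mono card_UN_le) (auto simp: I_def)
  \<comment> \<open>The successor accounts for \<open>v\<close> itself; as
    \<open>4 \<le> card X\<close>, still at most half of \<open>X\<close> is lost.\<close>
  also have "card (insert v (N v)) \<le> Suc (card (N v))" by (rule card_insert_le_m1) auto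
  finally have cX: "card X \<le> 2 * (\<Sum>i\<in>I. card (cont (F i) (T i v) \<inter> X))"
    using v(2) X4 by linarith
  have "\<exists>i\<in>I. card X \<le> 2 * r * card (cont (F i) (T i v) \<inter> X)"
  proof (rule ccontr)
    assume no: "\<not> ?thesis"
    have "I \<noteq> {}" using cX X4 by (intro notI) simp
    then have "(\<Sum>i\<in>I. 2 * r * card (cont (F i) (T i v) \<inter> X)) < (\<Sum>i\<in>I. card X)"
      using no by (intro sum_strict_mono) (auto simp: not_le I_def)
    also have "\<dots> \<le> r * card X" using card_mono[of "{..<r}" I] by (simp add: I_def)
    finally have "r * (2 * (\<Sum>i\<in>I. card (cont (F i) (T i v) \<inter> X))) < r * card X"
      by (simp add: sum_distrib_left mult_ac)
    then show False using cX by simp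
  qed
  then obtain i where i: "i \<in> I" "card X \<le> 2 * r * card (cont (F i) (T i v) \<inter> X)" by blast
  define X' where "X' = cont (F i) (T i v) \<inter> X"
  have ir: "i < r" "i \<in> {..<r} - S" using i by (auto simp: I_def)
  have X'V: "X' \<subseteq> V" using S(2) by (auto simp: X'_def)
  have "n \<le> card X * (2 * r) ^ card S" by (rule S(3))
  also have "\<dots> \<le> (2 * r * card X') * (2 * r) ^ card S"
    using i(2) unfolding X'_def by (rule mult_right_mono) simp
  also have "\<dots> = card X' * (2 * r) ^ Suc (card S)" by simp
  finally have nX': "n \<le> card X' * (2 * r) ^ Suc (card S)" .
  have "card {e \<in> C j. e \<subseteq> X'} < 64 * U * b" if j: "j \<in> insert i S" for j
  proof (cases "j = i")
    case True
    have "card {e \<in> F i. e \<subseteq> X'} \<le> 16 * U / b"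
      by (rule sparse[OF ir(1), where v = v]) (simp add: X'_def)
    \<comment> \<open>Were \<open>C i\<close> dense on \<open>X'\<close>, its sample
      \<open>F i\<close> would exceed \<open>16 * U / b\<close> there.\<close>
    then have "\<not> 64 * U * b \<le> card {e \<in> C i. e \<subseteq> X'}" using F(3)[OF ir(1) X'V] by linarith
    then show ?thesis using True by simp
  next
    case False
    then have "j \<in> S" using j by simp
    have "card {e \<in> C j. e \<subseteq> X'} \<le> card {e \<in> C j. e \<subseteq> X}"
      using finC by (intro card_mono) (auto simp: X'_def)
    then have "real (card {e \<in> C j. e \<subseteq> X'}) \<le> real (card {e \<in> C j. e \<subseteq> X})" by (rule of_nat_mono)
    then show ?thesis using S(4)[OF \<open>j \<in> S\<close>] by linarith
  qed
  then have "X' \<subseteq> V \<and> n \<le> card X' * (2 * r) ^ Suc (card S) \<and>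
      (\<forall>j\<in>insert i S. card {e \<in> C j. e \<subseteq> X'} < 64 * U * b)"
    using X'V nX' by blast
  then show ?thesis using ir(2) by blast
qed

lemma cycle_ramsey_host_exists:
  "\<exists>G. cycle_ramsey_host V (m + 2) r G"
proof -
  obtain G where G: "G \<subseteq> pairs V"
    "\<And>xs. distinct xs \<Longrightarrow> 3 \<le> length xs \<Longrightarrow> length xs \<le> m + 1 \<Longrightarrow> \<not> cyc_edges xs \<subseteq> G"
    "\<And>X I F T. X \<subseteq> V \<Longrightarrow> I \<subseteq> {..<r} \<Longrightarrow> (\<And>i. i < r \<Longrightarrow> F i \<in> few_edges (16 * (n * t))) \<Longrightarrow>
      (\<And>i v. i < r \<Longrightarrow> T i v \<in> fingerprints) \<Longrightarrow> n\<^sup>2 \<le> 8 * q * card (uncovered X I F T) \<Longrightarrow>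
      U * real B ^ 4 / (32 * real q) < card (G \<inter> uncovered X I F T) + U"
    "\<And>x. x \<in> V \<Longrightarrow> card {y \<in> V. {x, y} \<in> G} \<le> 4 * D"
    "card {xs. set xs \<subseteq> V \<and> length xs = 2 * m \<and> cyc_edges xs \<subseteq> G} \<le> real (4 * walk_const m * card V) * real D ^ m"
    by (fact odd_host_graph)
  have "\<exists>i<r. \<exists>xs. distinct xs \<and> length xs = m + 2 \<and> cyc_edges xs \<subseteq> {e \<in> G. c e = i}"
    if c: "\<forall>e\<in>G. c e < r" for c :: "nat set \<Rightarrow> nat"
  proof (rule ccontr)
    assume no: "\<not> ?thesis"
    define C where "C i = {e \<in> G. c e = i}" for i
    have CG: "C i \<subseteq> G" for i by (auto simp: C_def)
    have CV: "C i \<subseteq> pairs V" for i using CG G(1) by blast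
    have nocyc: "\<not> cyc_edges xs \<subseteq> C i"
      if "i < r" and xs: "distinct xs" "3 \<le> length xs" "length xs \<le> m + 2" for xs i
    proof
      assume sub: "cyc_edges xs \<subseteq> C i"
      then have "\<not> length xs \<le> m + 1" using G(2) xs CG by blast
      then have "length xs = m + 2" using xs by linarith
      then show False using no \<open>i < r\<close> xs(1) sub by (auto simp: C_def)
    qed
    have "\<exists>E. E \<subseteq> C i \<and> E \<in> few_edges (16 * (n * t)) \<and>
      (\<forall>X. X \<subseteq> V \<longrightarrow> 64 * U * b \<le> card {e \<in> C i. e \<subseteq> X} \<longrightarrow> 16 * U / b < card {e \<in> E. e \<subseteq> X})" for i
    proof -
      have deg: "card {y \<in> V. {x, y} \<in> C i} \<le> 4 * D" if "x \<in> V" for x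
      proof -
        have "card {y \<in> V. {x, y} \<in> C i} \<le> card {y \<in> V. {x, y} \<in> G}"
          using CG[of i] by (intro card_mono) auto
        then show ?thesis using G(4)[OF that] by linarith
      qed
      obtain E where "E \<subseteq> C i" "E \<in> few_edges (16 * (n * t))"
        "\<And>X. X \<subseteq> V \<Longrightarrow> 64 * U * b \<le> card {e \<in> C i. e \<subseteq> X} \<Longrightarrow> 16 * U / b < card {e \<in> E. e \<subseteq> X}"
        by (rule sparse_subgraph[OF CV deg]) blast+
      then show ?thesis by (intro exI[of _ E]) simp
    qed
    then have "\<forall>i. \<exists>E. E \<subseteq> C i \<and> E \<in> few_edges (16 * (n * t)) \<and>
      (\<forall>X. X \<subseteq> V \<longrightarrow> 64 * U * b \<le> card {e \<in> C i. e \<subseteq> X} \<longrightarrow> 16 * U / b < card {e \<in> E. e \<subseteq> X})" ..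
    from choice[OF this] obtain F where F: "\<forall>i. F i \<subseteq> C i \<and> F i \<in> few_edges (16 * (n * t)) \<and>
      (\<forall>X. X \<subseteq> V \<longrightarrow> 64 * U * b \<le> card {e \<in> C i. e \<subseteq> X} \<longrightarrow> 16 * U / b < card {e \<in> F i. e \<subseteq> X})" ..
    have FC: "F i \<subseteq> C i" and Ffew: "F i \<in> few_edges (16 * (n * t))"
      and Fdense: "X \<subseteq> V \<Longrightarrow> 64 * U * b \<le> card {e \<in> C i. e \<subseteq> X} \<Longrightarrow> 16 * U / b < card {e \<in> F i. e \<subseteq> X}" for i X
      using F[THEN spec, of i] by blast+
    have "\<exists>T. i < r \<longrightarrow> (\<forall>v. T v \<in> fingerprints \<and> (\<forall>x. {v, x} \<in> C i - F i \<longrightarrow> x \<in> T v \<union> cont (F i) (T v)) \<and>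
      cont (F i) (T v) \<subseteq> V \<and>
      (\<forall>x\<in>cont (F i) (T v). card {y \<in> cont (F i) (T v). x \<noteq> y \<and> nwalks V (F i) m x y \<noteq> 0} < g))" for i
    proof (cases "i < r")
      case True
      obtain T where "\<And>v. T v \<in> fingerprints"
        "\<And>v x. {v, x} \<in> C i - F i \<Longrightarrow> x \<in> T v \<union> cont (F i) (T v)"
        "\<And>v. cont (F i) (T v) \<subseteq> V"
        "\<And>v x. x \<in> cont (F i) (T v) \<Longrightarrow> card {y \<in> cont (F i) (T v). x \<noteq> y \<and> nwalks V (F i) m x y \<noteq> 0} < g"
        by (rule colour_class_containers[OF FC CV nocyc[OF True]]) blast+
      then show ?thesis by (intro exI[of _ T]) simp
    qed simp
    then have "\<forall>i. \<exists>T. i < r \<longrightarrow> (\<forall>v. T v \<in> fingerprints \<and> (\<forall>x. {v, x} \<in> C i - F i \<longrightarrow> x \<in> T v \<union> cont (F i) (T v)) \<and>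
      cont (F i) (T v) \<subseteq> V \<and>
      (\<forall>x\<in>cont (F i) (T v). card {y \<in> cont (F i) (T v). x \<noteq> y \<and> nwalks V (F i) m x y \<noteq> 0} < g))" ..
    from choice[OF this] obtain T where T: "\<forall>i. i < r \<longrightarrow> (\<forall>v. T i v \<in> fingerprints \<and>
      (\<forall>x. {v, x} \<in> C i - F i \<longrightarrow> x \<in> T i v \<union> cont (F i) (T i v)) \<and> cont (F i) (T i v) \<subseteq> V \<and>
      (\<forall>x\<in>cont (F i) (T i v). card {y \<in> cont (F i) (T i v). x \<noteq> y \<and> nwalks V (F i) m x y \<noteq> 0} < g))" ..
    note Ti = T[THEN spec, THEN mp, THEN spec]
    have sparse: "card {e \<in> F i. e \<subseteq> X} \<le> 16 * U / b"
      if i: "i < r" and X: "X \<subseteq> cont (F i) (T i v)" for i v X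
    proof (rule container_sparse[OF _ G(1) _ X _ G(5) G(4)])
      show "F i \<subseteq> G" using FC CG by blast
      show "cont (F i) (T i v) \<subseteq> V" using Ti[OF i, of v] by blast
      show "card {y \<in> cont (F i) (T i v). x \<noteq> y \<and> nwalks V (F i) m x y \<noteq> 0} < g"
        if "x \<in> cont (F i) (T i v)" for x using Ti[OF i, of v] that by blast
    qed
    have step: "\<exists>i\<in>{..<r} - S. \<exists>X'\<subseteq>V. n \<le> card X' * (2 * r) ^ Suc (card S) \<and>
        (\<forall>j\<in>insert i S. card {e \<in> C j. e \<subseteq> X'} < 64 * U * b)"
      if S: "S \<subseteq> {..<r}" "X \<subseteq> V" "n \<le> card X * (2 * r) ^ card S"
        "\<And>i. i \<in> S \<Longrightarrow> card {e \<in> C i. e \<subseteq> X} < 64 * U * b" for S X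
    proof (rule extend_sparse_colours[OF G(1) _ C_def FC Ffew Fdense _ _ sparse _ S])
      show "c e < r" if "e \<in> G" for e using c that by blast
      show "T i v \<in> fingerprints" if "i < r" for i v using Ti[OF that] by blast
      show "x \<in> T i v \<union> cont (F i) (T i v)" if "i < r" "{v, x} \<in> C i - F i" for i v x
        using Ti[OF that(1), of v] that(2) by blast
      show "U * real B ^ 4 / (32 * real q) < card (G \<inter> uncovered X I F T) + U"
        if "X \<subseteq> V" "I \<subseteq> {..<r}" "n\<^sup>2 \<le> 8 * q * card (uncovered X I F T)" for X I
        using G(3)[OF that(1,2) Ffew _ that(3)] Ti by blast
    qed
    have "\<exists>S\<subseteq>{..<r}. card S = j \<and> (\<exists>X\<subseteq>V. n \<le> card X * (2 * r) ^ j \<and>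
        (\<forall>i\<in>S. card {e \<in> C i. e \<subseteq> X} < 64 * U * b))" for j
    proof (induction j)
      case 0
      show ?case by (intro exI[of _ "{}"] conjI exI[of _ V]) auto
    next
      case (Suc j)
      then obtain S X where S: "S \<subseteq> {..<r}" "card S = j" "X \<subseteq> V" "n \<le> card X * (2 * r) ^ j"
        "\<forall>i\<in>S. card {e \<in> C i. e \<subseteq> X} < 64 * U * b" by blast
      obtain i X' where i: "i \<in> {..<r} - S" "X' \<subseteq> V" "n \<le> card X' * (2 * r) ^ Suc (card S)"
        "\<forall>j\<in>insert i S. card {e \<in> C j. e \<subseteq> X'} < 64 * U * b"
        using step[OF S(1,3)] S(2,4,5) by blast
      have "card (insert i S) = Suc j" using i(1) S(1,2) finite_subset[OF S(1)] by simp
      then show ?case using i S(1,2) by (intro exI[of _ "insert i S"] conjI exI[of _ X']) auto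
    qed
    \<comment> \<open>There are only \<open>r\<close> colours. The contradiction comes from the
      round with all of them in \<open>S\<close>: no container is left, although containers would
      have to cover half of \<open>X\<close>.\<close>
    from this[of "Suc r"] obtain S where "S \<subseteq> {..<r}" "card S = Suc r" by blast
    then show False using card_mono[of "{..<r}" S] by simp
  qed
  then show ?thesis
    using G(1,2) unfolding cycle_ramsey_host_def by (intro exI[of _ G]) auto
qed

end

subsection \<open>Passing to graphs\<close>

lemma embeds_cycle_graph_cyc_edges:
  assumes "embeds f (cycle_graph l) (V, G)"
  shows "distinct (map f [0..<l])" "cyc_edges (map f [0..<l]) \<subseteq> G"
proof -
  have f: "inj_on f {..<l}" "\<forall>e\<in>edges (cycle_graph l). f ` e \<in> G"
    using assms by (auto simp: embeds_def cycle_graph_def)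
  have edge: "f ` {i, Suc i mod l} \<in> G" if "i < l" for i
    using that by (intro f(2)[rule_format]) (auto simp: cycle_graph_def)
  show "distinct (map f [0..<l])"
    using f(1) by (simp add: distinct_map atLeast0LessThan)
  show "cyc_edges (map f [0..<l]) \<subseteq> G"
    using edge by (auto simp: cyc_edges_def cyc_edge_def)
qed

lemma cycle_ramsey_host_graph:
  fixes V :: "'a set"
  assumes "finite V" "3 \<le> k" "1 \<le> r" "cycle_ramsey_host V k r G"
  shows "finite_simple_graph (V, G)" "girth (V, G) = enat k" "arrows (V, G) (cycle_graph k) r"
proof -
  have G: "G \<subseteq> pairs V" "\<And>xs. distinct xs \<Longrightarrow> 3 \<le> length xs \<Longrightarrow> length xs < k \<Longrightarrow> \<not> cyc_edges xs \<subseteq> G"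
    and mono: "\<And>c. \<forall>e\<in>G. c e < r \<Longrightarrow>
      \<exists>i<r. \<exists>xs. distinct xs \<and> length xs = k \<and> cyc_edges xs \<subseteq> {e \<in> G. c e = i}"
    using assms(4) by (auto simp: cycle_ramsey_host_def)
  show "finite_simple_graph (V, G)"
    using assms(1) G(1) by (auto simp: finite_simple_graph_def pairs_def)
  show arr: "arrows (V, G) (cycle_graph k) r"
    unfolding arrows_def
  proof (intro allI impI)
    fix c :: "'a set \<Rightarrow> nat" assume "\<forall>e\<in>edges (V, G). c e < r"
    then obtain i xs where i: "i < r" and xs: "distinct xs" "length xs = k" "cyc_edges xs \<subseteq> {e \<in> G. c e = i}"
      using mono[of c] by auto
    have setV: "set xs \<subseteq> V" using xs(3) G(1) by (intro cyc_edges_subset_pairs) blast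
    have edge: "(!) xs ` {j, Suc j mod k} \<in> {e \<in> G. c e = i}" if "j < k" for j
      using that xs(2,3) by (auto simp: cyc_edges_def cyc_edge_def)
    have "embeds ((!) xs) (cycle_graph k) (V, G)"
      unfolding embeds_def
    proof (intro conjI ballI)
      show "inj_on ((!) xs) (verts (cycle_graph k))"
        using xs(1,2) by (auto simp: cycle_graph_def inj_on_def nth_eq_iff_index_eq)
      show "(!) xs ` verts (cycle_graph k) \<subseteq> verts (V, G)"
        using setV xs(2) by (auto simp: cycle_graph_def)
      show "(!) xs ` e \<in> edges (V, G)" if "e \<in> edges (cycle_graph k)" for e
        using that edge by (auto simp: cycle_graph_def)
    qed
    moreover have "\<forall>e\<in>edges (cycle_graph k). c ((!) xs ` e) = i"
      using edge by (auto simp: cycle_graph_def)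
    ultimately show "\<exists>f. \<exists>i<r. embeds f (cycle_graph k) (V, G) \<and> (\<forall>e\<in>edges (cycle_graph k). c (f ` e) = i)"
      using i by blast
  qed
  show "girth (V, G) = enat k"
    unfolding girth_eq_iff
  proof (intro conjI allI impI)
    \<comment> \<open>A cycle of length \<open>k\<close> exists because the constant colouring must
      have a monochromatic copy.\<close>
    show "\<exists>f. embeds f (cycle_graph k) (V, G)"
      using arr[unfolded arrows_def, THEN spec, of "\<lambda>_. 0"] assms(3) by auto
    show "\<not> (\<exists>f. embeds f (cycle_graph l) (V, G))" if "3 \<le> l \<and> l < k" for l
      using that embeds_cycle_graph_cyc_edges[of _ l V G] G(2)[of "map _ [0..<l]"] by auto
  qed fact
qed

section \<open>The number of vertices in terms of the number of colours\<close>

lemma host_size_even: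
  assumes "2 \<le> r" "1 \<le> a"
  shows "real ((a * r) ^ e) \<le> real r powr (e * (log 2 a + 1))"
proof -
  have "real a = 2 powr log 2 a" using assms by simp
  also have "\<dots> \<le> real r powr log 2 a" using assms by (intro powr_mono2) auto
  finally have "real a * real r \<le> real r powr log 2 a * real r" by (intro mult_right_mono) auto
  also have "\<dots> = real r powr (log 2 a + 1)" using assms by (simp add: powr_add)
  finally have "(real a * real r) ^ e \<le> (real r powr (log 2 a + 1)) ^ e" by (intro power_mono) auto
  also have "\<dots> = real r powr (e * (log 2 a + 1))" using assms by (simp add: powr_power mult.commute)
  finally show ?thesis by simp
qed

text \<open>With \<open>x = log 2 r \<ge> 1\<close>, the base has logarithm
  \<open>log 2 a + x + 2 * r + 2 * r * x\<close>, and its last three terms are at most 1, 2 and 2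
  times \<open>r * x\<close>; this is the 5.\<close>

lemma host_size_odd:
  assumes "2 \<le> r" "1 \<le> a"
  shows "real ((a * r * (2 * r) ^ (2 * r)) ^ e) \<le> (2 powr (e * (log 2 a + 5))) powr (real r * log 2 r)"
proof -
  define x where "x = log 2 (real r)"
  have x: "1 \<le> x" using assms by (simp add: x_def le_log_iff)
  have r: "real r = 2 powr x" using assms by (simp add: x_def)
  have a: "real a = 2 powr log 2 a" using assms by simp
  have la: "0 \<le> log 2 a" using assms by simp
  have rx: "1 \<le> real r * x" "x \<le> real r * x" "real r \<le> real r * x"
    using assms x mult_mono[of 1 "real r" 1 x] mult_right_mono[of 1 "real r" x] by auto
  have "real (a * r * (2 * r) ^ (2 * r)) = real a * real r * (2 * real r) ^ (2 * r)" by simp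
  also have "\<dots> = 2 powr log 2 a * 2 powr x * (2 powr 1 * 2 powr x) ^ (2 * r)"
    using a r by simp
  also have "\<dots> = 2 powr (log 2 a + x + real (2 * r) * (1 + x))"
    by (simp only: powr_add[symmetric] powr_power mult.commute[of _ "real (2 * r)"])
  also have "\<dots> \<le> 2 powr ((log 2 a + 5) * (real r * x))"
  proof (intro powr_mono)
    have "log 2 a * 1 \<le> log 2 a * (real r * x)" using rx(1) la by (rule mult_left_mono)
    then show "log 2 a + x + real (2 * r) * (1 + x) \<le> (log 2 a + 5) * (real r * x)"
      using rx by (simp add: algebra_simps)
  qed simp
  finally have "real (a * r * (2 * r) ^ (2 * r)) ^ e \<le> (2 powr ((log 2 a + 5) * (real r * x))) ^ e"
    by (intro power_mono) auto
  also have "\<dots> = (2 powr (e * (log 2 a + 5))) powr (real r * log 2 r)"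
    by (simp add: powr_power powr_powr x_def mult_ac)
  finally show ?thesis by simp
qed

theorem corollary1p2:
  fixes k :: nat
  assumes "k \<ge> 3"
  shows "\<exists>K\<^sub>e K\<^sub>o :: real. K\<^sub>o > 0 \<and>
    (\<forall>r::nat. r \<ge> 2 \<longrightarrow>
      (\<exists>H :: nat graph. finite_simple_graph H \<and>
         girth H = enat k \<and> arrows H (cycle_graph k) r \<and>
         (even k \<longrightarrow> real (card (verts H)) \<le> real r powr K\<^sub>e) \<and>
         (odd k \<longrightarrow> real (card (verts H)) \<le> K\<^sub>o powr (real r * log 2 (real r)))))"
proof -
  define m where "m = k - 2"
  have m: "k = m + 2" "1 \<le> m" using assms by (auto simp: m_def)
  define a e where "a = base_factor m" and "e = expo m"
  have a: "1 \<le> a" by (simp add: a_def base_factor_def Suc_le_eq)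
  have "\<exists>H :: nat graph. finite_simple_graph H \<and> girth H = enat k \<and> arrows H (cycle_graph k) r \<and>
      (even k \<longrightarrow> real (card (verts H)) \<le> real r powr (e * (log 2 a + 1))) \<and>
      (odd k \<longrightarrow> real (card (verts H)) \<le> (2 powr (e * (log 2 a + 5))) powr (real r * log 2 (real r)))"
    if r: "2 \<le> r" for r :: nat
  proof (cases "even k")
    case True
    define B where "B = a * r"
    interpret host_parameters m r B
      using m r by unfold_locales (auto simp: a_def B_def)
    obtain G where G: "cycle_ramsey_host V k r G"
      using even_cycle_ramsey_host True m by auto
    have "real (card (verts (V, G))) \<le> real r powr (e * (log 2 a + 1))"
      using host_size_even[OF r a, of e] by (simp only: fst_conv card_V n_power e_def B_def[symmetric])
    then show ?thesis
      using cycle_ramsey_host_graph[OF finite_V assms _ G] r True by (intro exI[of _ "(V, G)"]) simp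
  next
    case False
    \<comment> \<open>The extra factor is \<open>q\<close>, needed to control sets of only
      \<open>n / (2 * r) ^ r\<close> vertices. It is the source of the exponent
      \<open>r * log 2 r\<close>.\<close>
    define B where "B = a * r * (2 * r) ^ (2 * r)"
    interpret odd_host_parameters m r B
    proof
      show "1 \<le> m" "1 \<le> r" using m r by auto
      show "base_factor m * r * (2 * r) ^ (2 * r) \<le> B" by (simp add: a_def B_def)
      have "a * r * 1 \<le> B" unfolding B_def using r by (intro mult_le_mono2) (simp add: Suc_le_eq)
      then show "base_factor m * r \<le> B" by (simp add: a_def)
    qed
    obtain G where G: "cycle_ramsey_host V k r G"
      using cycle_ramsey_host_exists m by auto
    have "real (card (verts (V, G))) \<le> (2 powr (e * (log 2 a + 5))) powr (real r * log 2 (real r))"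
      using host_size_odd[OF r a, of e] by (simp only: fst_conv card_V n_power e_def B_def[symmetric])
    then show ?thesis
      using cycle_ramsey_host_graph[OF finite_V assms _ G] r False by (intro exI[of _ "(V, G)"]) simp
  qed
  then show ?thesis
    by (intro exI[of _ "e * (log 2 a + 1)"] exI[of _ "2 powr (e * (log 2 a + 5))"]) simp
qed

end
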